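(* Let $p>2$ be a prime and let $k$ be any field of characteristic $p$. Then the $T$-space $CP(G)$ of $k_1\langle X\rangle$ is not finitely based.
   Context: $X=\{x_i\mid i\ge 0\}$ is a countably infinite set and $k_1\langle X\rangle$ is the free unitary associative $k$-algebra on $X$. A $T$-space of $k_1\langle X\rangle$ is a linear subspace invariant under every (unitary) algebra endomorphism of $k_1\langle X\rangle$; for $H\subseteq k_1\langle X\rangle$, $H^{S}$ denotes the smallest $T$-space of $k_1\langle X\rangle$ containing $H$, and a $T$-space $V$ is finitely based if $V=H^S$ for some finite $H$. $G$ is the infinite-dimensional unitary Grassmann algebra over $k$: it has linear basis $1$ together with the products $e_{i_1}\cdots e_{i_n}$ ($n\ge1$, $i_1<\dots<i_n$), where $e_i$ ($i\ge1$) satisfy $e_ie_j=-e_je_i$, $e_i^2=0$. $T(G)$ is the set of $f\in k_1\langle X\rangle$ lying in the kernel of every unitary homomorphism $k_1\langle X\rangle\to G$. A central polynomial of $G$ is an $f\notin T(G)$ whose image under every unitary homomorphism $k_1\langle X\rangle\to G$ lies in the centre of $G$; $CP(G)$ is the $T$-space of $k_1\langle X\rangle$ generated by all central polynomials of $G$. *)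

theory Defs
  imports Main "HOL-Computational_Algebra.Primes"
begin

text \<open>An element of k_1<X> is a finitely supported function from words in the
variables (lists of variable indices; [] is the empty word, i.e. the unit 1)
to the field k.\<close>

definition FA :: "(nat list \<Rightarrow> 'k::field) set" where
  "FA = {f. finite {w. f w \<noteq> 0}}"

definition fa_mult :: "(nat list \<Rightarrow> 'k::field) \<Rightarrow> (nat list \<Rightarrow> 'k) \<Rightarrow> (nat list \<Rightarrow> 'k)" where
  "fa_mult f g = (\<lambda>w. \<Sum>(u, v) \<in> {(u, v). u @ v = w}. f u * g v)"

definition fa_one :: "nat list \<Rightarrow> 'k::field" where
  "fa_one = (\<lambda>w. if w = [] then 1 else 0)"

text \<open>Basis element e_{i_1}...e_{i_n} (i_1 < ... < i_n, all i_j >= 1) is indexed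
by the finite set {i_1,...,i_n}; the empty set gives 1.\<close>

definition GR :: "(nat set \<Rightarrow> 'k::field) set" where
  "GR = {g. finite {S. g S \<noteq> 0} \<and> (\<forall>S. g S \<noteq> 0 \<longrightarrow> finite S \<and> 0 \<notin> S)}"

text \<open>Sign of e_S e_T = sign * e_(S union T) for disjoint S, T.\<close>
definition gr_sign :: "nat set \<Rightarrow> nat set \<Rightarrow> 'k::field" where
  "gr_sign S T = (- 1) ^ card {(s, t). s \<in> S \<and> t \<in> T \<and> t < s}"

definition gr_mult :: "(nat set \<Rightarrow> 'k::field) \<Rightarrow> (nat set \<Rightarrow> 'k) \<Rightarrow> (nat set \<Rightarrow> 'k)" where
  "gr_mult a b = (\<lambda>U. \<Sum>(S, T) \<in> {(S, T). S \<union> T = U \<and> S \<inter> T = {}}.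
                         gr_sign S T * a S * b T)"

definition gr_one :: "nat set \<Rightarrow> 'k::field" where
  "gr_one = (\<lambda>U. if U = {} then 1 else 0)"

definition unital_alg_hom ::
  "('a \<Rightarrow> 'k::field) set \<Rightarrow> (('a \<Rightarrow> 'k) \<Rightarrow> ('a \<Rightarrow> 'k) \<Rightarrow> ('a \<Rightarrow> 'k)) \<Rightarrow> ('a \<Rightarrow> 'k) \<Rightarrow>
   ('b \<Rightarrow> 'k) set \<Rightarrow> (('b \<Rightarrow> 'k) \<Rightarrow> ('b \<Rightarrow> 'k) \<Rightarrow> ('b \<Rightarrow> 'k)) \<Rightarrow> ('b \<Rightarrow> 'k) \<Rightarrow>
   (('a \<Rightarrow> 'k) \<Rightarrow> ('b \<Rightarrow> 'k)) \<Rightarrow> bool" where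
  "unital_alg_hom A mA oA B mB oB \<phi> \<longleftrightarrow>
     (\<forall>f\<in>A. \<phi> f \<in> B) \<and>
     (\<forall>f\<in>A. \<forall>g\<in>A. \<phi> (\<lambda>x. f x + g x) = (\<lambda>y. \<phi> f y + \<phi> g y)) \<and>
     (\<forall>c. \<forall>f\<in>A. \<phi> (\<lambda>x. c * f x) = (\<lambda>y. c * \<phi> f y)) \<and>
     (\<forall>f\<in>A. \<forall>g\<in>A. \<phi> (mA f g) = mB (\<phi> f) (\<phi> g)) \<and>
     \<phi> oA = oB"

definition fa_endo :: "((nat list \<Rightarrow> 'k::field) \<Rightarrow> (nat list \<Rightarrow> 'k)) \<Rightarrow> bool" where
  "fa_endo \<phi> \<longleftrightarrow> unital_alg_hom FA fa_mult fa_one FA fa_mult fa_one \<phi>"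

definition fa_to_G :: "((nat list \<Rightarrow> 'k::field) \<Rightarrow> (nat set \<Rightarrow> 'k)) \<Rightarrow> bool" where
  "fa_to_G \<phi> \<longleftrightarrow> unital_alg_hom FA fa_mult fa_one GR gr_mult gr_one \<phi>"

definition Tspace :: "(nat list \<Rightarrow> 'k::field) set \<Rightarrow> bool" where
  "Tspace V \<longleftrightarrow> V \<subseteq> FA \<and> (\<lambda>_. 0) \<in> V \<and>
     (\<forall>f\<in>V. \<forall>g\<in>V. (\<lambda>w. f w + g w) \<in> V) \<and>
     (\<forall>c. \<forall>f\<in>V. (\<lambda>w. c * f w) \<in> V) \<and>
     (\<forall>\<phi>. fa_endo \<phi> \<longrightarrow> (\<forall>f\<in>V. \<phi> f \<in> V))"

definition Tspan :: "(nat list \<Rightarrow> 'k::field) set \<Rightarrow> (nat list \<Rightarrow> 'k) set" where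
  "Tspan H = \<Inter> {V. Tspace V \<and> H \<subseteq> V}"

definition finitely_based :: "(nat list \<Rightarrow> 'k::field) set \<Rightarrow> bool" where
  "finitely_based V \<longleftrightarrow> Tspace V \<and> (\<exists>H. finite H \<and> H \<subseteq> FA \<and> V = Tspan H)"

definition TG :: "(nat list \<Rightarrow> 'k::field) set" where
  "TG = {f \<in> FA. \<forall>\<phi>. fa_to_G \<phi> \<longrightarrow> \<phi> f = (\<lambda>_. 0)}"

definition gr_centre :: "(nat set \<Rightarrow> 'k::field) set" where
  "gr_centre = {z \<in> GR. \<forall>y\<in>GR. gr_mult z y = gr_mult y z}"

definition central_poly_G :: "(nat list \<Rightarrow> 'k::field) \<Rightarrow> bool" where
  "central_poly_G f \<longleftrightarrow> f \<in> FA \<and> f \<notin> TG \<and>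
     (\<forall>\<phi>. fa_to_G \<phi> \<longrightarrow> \<phi> f \<in> gr_centre)"

definition CPG :: "(nat list \<Rightarrow> 'k::field) set" where
  "CPG = Tspan {f. central_poly_G f}"

end

theory Submission
  imports Defs
begin

text \<open>
Let \<open>\<Omega>\<close> be the algebra of differential forms over \<open>k[t\<^sub>0, t\<^sub>1, \<dots>]/(t\<^sub>i\<^sup>p)\<close>. The elements \<open>a + da\<close> with
\<open>a\<close> an even form constitute a subalgebra of \<open>\<Omega>\<close>, so for every linear functional \<open>L\<close> the polynomials \<open>f\<close> with
\<open>L (f (a\<^sub>0 + da\<^sub>0, a\<^sub>1 + da\<^sub>1, \<dots>)) = 0\<close> for all even \<open>a\<^sub>i\<close> form a T-space. Let \<open>L\<close> be the coefficient of
\<open>(t\<^sub>0 \<cdots> t\<^sub>m\<^sub>-\<^sub>1)\<^sup>p\<^sup>-\<^sup>1 dt\<^sub>0 \<cdots> dt\<^sub>m\<^sub>-\<^sub>1\<close>; it vanishes on exact forms.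

If \<open>f\<close> has central values in the Grassmann algebra, then \<open>f (\<alpha>\<^sub>0 + t\<^sub>0 + dt\<^sub>0, \<dots>)\<close> is even, hence a closed form. By
the Poincare lemma for truncated polynomials it is, in \<open>N\<close> variables, exact up to products of at most \<open>N\<close>
factors \<open>t\<^sub>i\<^sup>p\<^sup>-\<^sup>1 dt\<^sub>i\<close>, and this remains true after substituting arbitrary even forms for the \<open>t\<^sub>i\<close>. So if
\<open>N < m\<close>, all central polynomials in \<open>N\<close> variables lie in the T-space belonging to \<open>L\<close>. The product of the
central polynomials \<open>[x\<^sub>2\<^sub>i, x\<^sub>2\<^sub>i\<^sub>+\<^sub>1] x\<^sub>2\<^sub>i\<^sup>p\<^sup>-\<^sup>1 x\<^sub>2\<^sub>i\<^sub>+\<^sub>1\<^sup>p\<^sup>-\<^sup>1\<close> over \<open>2 i < m\<close> (\<open>m\<close> even) does not.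
\<close>

text \<open>Centrality speaks about the Grassmann algebra, which carries no differential, while
  closedness needs one. Both are read off a single universal value of \<open>f\<close>, taken at the
  generic point \<open>\<alpha>_i + t_i + dt_i\<close>. Two substitutions connect it with the rest.
  Replacing \<open>t_i\<close> by sums of pairs of generators and \<open>dt_i\<close> by independent
  generators is injective in finitely many variables and carries evenness from the Grassmann algebra
  back to forms. Replacing \<open>t_i\<close> by \<open>b_i\<close> and \<open>dt_i\<close> by
  \<open>db_i\<close> commutes with \<open>d\<close> and carries closedness on to arbitrary
  evaluations. The constants \<open>\<alpha>_i\<close> appear because only nilpotent elements may
  replace \<open>t_i\<close>, and a general even form is a constant plus such an element.

  The obstacle is that \<open>b_i\<close> may have high degree, which threatens the bound by the
  number of variables. It is overcome because, modulo exact forms, \<open>b ^ (p - 1) * db\<close>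
  depends only on the linear part of \<open>b\<close>. For a product \<open>b\<close> of two odd
  forms this needs \<open>b ^ (p - 1) = 0\<close>, hence \<open>p > 2\<close>. The invertibility of
  \<open>2\<close> also gives \<open>d d = 0\<close> and separates even from odd.\<close>

lemma finsupp_induct [consumes 1, case_names zero add]:
  fixes f :: "'a \<Rightarrow> 'k::field"
  assumes "finite {x. f x \<noteq> 0}"
    and "P (\<lambda>_. 0)"
    and "\<And>g x c. finite {y. g y \<noteq> 0} \<Longrightarrow> f x \<noteq> 0 \<Longrightarrow> {y. g y \<noteq> 0} \<subseteq> {y. f y \<noteq> 0} \<Longrightarrow> P g \<Longrightarrow>
           P (\<lambda>y. g y + c * (if y = x then 1 else 0))"
  shows "P f"
proof -
  have "P (\<lambda>y. if y \<in> A then f y else 0)" if "finite A" "A \<subseteq> {x. f x \<noteq> 0}" for A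
    using that
  proof (induction A rule: finite_induct)
    case empty
    then show ?case using assms(2) by simp
  next
    case (insert x A)
    let ?g = "\<lambda>y. if y \<in> A then f y else 0"
    have "P (\<lambda>y. ?g y + f x * (if y = x then 1 else 0))"
    proof (rule assms(3))
      show "finite {y. ?g y \<noteq> 0}" using insert.hyps(1) by (rule rev_finite_subset) auto
    qed (use insert in auto)
    also have "(\<lambda>y. ?g y + f x * (if y = x then 1 else 0)) = (\<lambda>y. if y \<in> insert x A then f y else 0)"
      using insert.hyps(2) by auto
    finally show ?case .
  qed
  from this[OF assms(1) subset_refl] have "P (\<lambda>y. if f y \<noteq> 0 then f y else 0)" by simp
  also have "(\<lambda>y. if f y \<noteq> 0 then f y else 0) = f" by auto
  finally show ?thesis .
qed

subsection \<open>The Grassmann product\<close>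

lemma gr_mult_Pow:
  assumes "finite U"
  shows "gr_mult a b U = (\<Sum>S\<in>Pow U. gr_sign S (U - S) * a S * b (U - S))"
  unfolding gr_mult_def
proof (rule sum.reindex_bij_witness[where i = "\<lambda>S. (S, U - S)" and j = fst], goal_cases)
  case (5 x)
  then have "U - fst x = snd x" by auto
  then show ?case by (simp add: split_def)
qed auto

lemma gr_sign_Un_left:
  assumes "finite R" "finite Q" "finite P" "R \<inter> Q = {}"
  shows "gr_sign (R \<union> Q) P = (gr_sign R P * gr_sign Q P :: 'k::field)"
proof -
  have *: "{(s, t). s \<in> R \<union> Q \<and> t \<in> P \<and> t < s} = {(s, t). s \<in> R \<and> t \<in> P \<and> t < s} \<union> {(s, t). s \<in> Q \<and> t \<in> P \<and> t < s}"
    by auto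
  have f: "finite {(s, t). s \<in> X \<and> t \<in> P \<and> t < s}" if "finite X" for X :: "nat set"
    by (rule finite_subset[of _ "X \<times> P"]) (use that assms in auto)
  show ?thesis
    unfolding gr_sign_def * using assms f
    by (subst card_Un_disjoint) (auto simp: power_add)
qed

lemma gr_sign_Un_right:
  assumes "finite R" "finite Q" "finite P" "Q \<inter> P = {}"
  shows "gr_sign R (Q \<union> P) = (gr_sign R Q * gr_sign R P :: 'k::field)"
proof -
  have *: "{(s, t). s \<in> R \<and> t \<in> Q \<union> P \<and> t < s} = {(s, t). s \<in> R \<and> t \<in> Q \<and> t < s} \<union> {(s, t). s \<in> R \<and> t \<in> P \<and> t < s}"
    by auto
  have f: "finite {(s, t). s \<in> R \<and> t \<in> X \<and> t < s}" if "finite X" for X :: "nat set"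
    by (rule finite_subset[of _ "R \<times> X"]) (use that assms in auto)
  show ?thesis
    unfolding gr_sign_def * using assms f
    by (subst card_Un_disjoint) (auto simp: power_add)
qed

text \<open>Both sides sum over the ordered partitions of \<open>U\<close> into three sets.
  Inversions are counted pairwise, so both signs equal the product of the three pairwise
  signs.\<close>

lemma gr_mult_assoc:
  fixes a b c :: "nat set \<Rightarrow> 'k::field"
  assumes U: "finite U"
  shows "gr_mult (gr_mult a b) c U = gr_mult a (gr_mult b c) U"
proof -
  have "gr_mult (gr_mult a b) c U =
    (\<Sum>S\<in>Pow U. \<Sum>R\<in>Pow S. gr_sign S (U - S) * (gr_sign R (S - R) * a R * b (S - R)) * c (U - S))"
    unfolding gr_mult_Pow[OF U]
    by (rule sum.cong) (auto simp: gr_mult_Pow finite_subset[OF _ U] sum_distrib_left sum_distrib_right)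
  also have "\<dots> = (\<Sum>(S, R)\<in>Sigma (Pow U) Pow. gr_sign S (U - S) * (gr_sign R (S - R) * a R * b (S - R)) * c (U - S))"
    by (rule sum.Sigma) (use U in \<open>auto intro: finite_subset\<close>)
  also have "\<dots> = (\<Sum>(R, Q)\<in>Sigma (Pow U) (\<lambda>R. Pow (U - R)).
      gr_sign R (U - R) * a R * (gr_sign Q (U - R - Q) * b Q * c (U - R - Q)))"
  proof (rule sum.reindex_bij_witness[where i = "\<lambda>(R, Q). (R \<union> Q, R)" and j = "\<lambda>(S, R). (R, S - R)"], goal_cases)
    case (5 x)
    then obtain S R where x: "x = (S, R)" and SR: "S \<subseteq> U" "R \<subseteq> S" by auto
    have S: "S = R \<union> (S - R)" and UR: "U - R = (S - R) \<union> (U - S)" using SR by auto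
    have fin: "finite S" "finite R" "finite (S - R)" "finite (U - S)"
      using SR U by (auto intro: finite_subset)
    have "gr_sign S (U - S) = (gr_sign R (U - S) * gr_sign (S - R) (U - S) :: 'k)"
      using gr_sign_Un_left[of R "S - R" "U - S"] S fin by simp
    moreover have "gr_sign R (U - R) = (gr_sign R (S - R) * gr_sign R (U - S) :: 'k)"
      using gr_sign_Un_right[of R "S - R" "U - S"] fin SR by (subst UR) auto
    moreover have "U - R - (S - R) = U - S" using SR by auto
    ultimately show ?case by (simp add: x algebra_simps)
  qed auto
  also have "\<dots> = (\<Sum>R\<in>Pow U. \<Sum>Q\<in>Pow (U - R). gr_sign R (U - R) * a R * (gr_sign Q (U - R - Q) * b Q * c (U - R - Q)))"
    by (rule sum.Sigma[symmetric]) (use U in \<open>auto intro: finite_subset\<close>)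
  also have "\<dots> = gr_mult a (gr_mult b c) U"
    unfolding gr_mult_Pow[OF U]
    by (rule sum.cong) (auto simp: gr_mult_Pow finite_subset[OF _ U] sum_distrib_left U)
  finally show ?thesis .
qed

definition gr_e :: "nat set \<Rightarrow> nat set \<Rightarrow> 'k::field" where
  "gr_e S = (\<lambda>U. if U = S then 1 else 0)"

text \<open>The sign picked up when \<open>e_i\<close>, standing in front of the increasing product
  over \<open>U - {i}\<close>, is moved to its place in \<open>U\<close>.\<close>

definition gsign :: "nat \<Rightarrow> nat set \<Rightarrow> 'k::field" where
  "gsign i U = (- 1) ^ card {j \<in> U. j < i}"

lemma gsign_insert:
  assumes "finite U" "n \<notin> U"
  shows "gsign i (insert n U) = (if n < i then - gsign i U else (gsign i U :: 'k::field))"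
proof -
  have "{j \<in> insert n U. j < i} = (if n < i then insert n {j \<in> U. j < i} else {j \<in> U. j < i})" by auto
  then show ?thesis using assms by (auto simp: gsign_def)
qed

text \<open>The smaller of \<open>i\<close> and \<open>j\<close> counts in the sign of the larger
  one only if it has not been removed before, so the two orders of removal differ by exactly one
  sign. This is the source of all anticommutation below.\<close>

lemma gsign_swap:
  assumes "finite U" "i \<in> U" "j \<in> U" "i \<noteq> j"
  shows "gsign i U * gsign j (U - {i}) = - (gsign j U * gsign i (U - {j}) :: 'k::field)"
proof -
  define W where "W = U - {i, j}"
  have U: "U = insert i (insert j W)" "U - {i} = insert j W" "U - {j} = insert i W"
    and W: "finite W" "i \<notin> W" "j \<notin> W"
    using assms by (auto simp: W_def)
  have "gsign i (insert i (insert j W)) = (gsign i (insert j W) :: 'k)"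
    "gsign j (insert i (insert j W)) = (if i < j then - gsign j (insert j W) else gsign j (insert j W) :: 'k)"
    using W assms(4) gsign_insert[of "insert j W" i i, where 'k='k] gsign_insert[of "insert j W" i j, where 'k='k] by auto
  then show ?thesis
    unfolding U(2,3) using W assms(4) by (auto simp: U(1) gsign_insert)
qed

lemma gr_mult_e_left:
  assumes "finite U" "S \<subseteq> U"
  shows "gr_mult (gr_e S) x U = gr_sign S (U - S) * x (U - S)"
proof -
  have "gr_mult (gr_e S) x U = (\<Sum>S'\<in>Pow U. if S' = S then gr_sign S (U - S) * x (U - S) else 0)"
    unfolding gr_mult_Pow[OF assms(1)] by (rule sum.cong) (auto simp: gr_e_def)
  then show ?thesis using assms by simp
qed

lemma gr_mult_e_left_0:
  assumes "finite U" "\<not> S \<subseteq> U"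
  shows "gr_mult (gr_e S) x U = 0"
  unfolding gr_mult_Pow[OF assms(1)] by (rule sum.neutral) (use assms in \<open>auto simp: gr_e_def\<close>)

lemma gr_mult_e_right:
  assumes "finite U" "S \<subseteq> U"
  shows "gr_mult x (gr_e S) U = gr_sign (U - S) S * x (U - S)"
proof -
  have "gr_mult x (gr_e S) U = (\<Sum>S'\<in>Pow U. if S' = U - S then gr_sign (U - S) S * x (U - S) else 0)"
    unfolding gr_mult_Pow[OF assms(1)]
  proof (rule sum.cong, goal_cases)
    case (2 S')
    have "U - S' = S \<longleftrightarrow> S' = U - S" using 2 assms by auto
    then show ?case using assms by (auto simp: gr_e_def double_diff)
  qed simp
  then show ?thesis using assms by simp
qed

lemma gr_sign_single: "gr_sign {i} U = gsign i U"
proof -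
  have "{(s, t). s \<in> {i} \<and> t \<in> U \<and> t < s} = Pair i ` {j \<in> U. j < i}" by auto
  then have "card {(s, t). s \<in> {i} \<and> t \<in> U \<and> t < s} = card {j \<in> U. j < i}"
    by (simp add: card_image inj_on_def)
  then show ?thesis by (simp add: gr_sign_def gsign_def)
qed

lemma gsign_Diff: "gsign i (U - {i}) = gsign i U"
  by (auto simp: gsign_def intro!: arg_cong[where f = "\<lambda>x. (-1) ^ x"] arg_cong[where f = card])

lemma gr_mult_single_left:
  assumes "finite U"
  shows "gr_mult (gr_e {i}) x U = (if i \<in> U then gsign i U * x (U - {i}) else 0)"
  using assms by (auto simp: gr_mult_e_left gr_mult_e_left_0 gr_sign_single gsign_Diff)

lemma gr_sign_below:
  assumes "\<And>s. s \<in> S \<Longrightarrow> s < i"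
  shows "gr_sign S {i} = 1"
proof -
  have *: "{(s, t). s \<in> S \<and> t \<in> {i} \<and> t < s} = {}" using assms by fastforce
  show ?thesis unfolding gr_sign_def * by simp
qed

lemma gr_sign_above:
  assumes "\<And>s. s \<in> S \<Longrightarrow> s < i" "finite S"
  shows "gr_sign {i} S = (-1) ^ card S"
proof -
  have "{j \<in> S. j < i} = S" using assms by auto
  then show ?thesis by (simp add: gr_sign_single gsign_def)
qed

lemma gr_mult_e_insert:
  assumes "\<And>s. s \<in> S \<Longrightarrow> s < i" "finite U"
  shows "gr_mult (gr_e S) (gr_e {i}) U = gr_e (insert i S) U"
proof (cases "S \<subseteq> U")
  case True
  have "U - S = {i} \<longleftrightarrow> U = insert i S" if "i \<notin> S" using that True by auto
  moreover have "i \<notin> S" using assms by auto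
  ultimately show ?thesis
    using assms True gr_sign_below[of S i]
    by (simp add: gr_mult_e_left) (auto simp: gr_e_def)
next
  case False
  then show ?thesis using assms by (simp add: gr_mult_e_left_0) (auto simp: gr_e_def)
qed

lemma gr_mult_GR:
  assumes "a \<in> GR" "b \<in> GR"
  shows "gr_mult a b \<in> GR"
proof -
  have nz: "\<exists>S T. U = S \<union> T \<and> a S \<noteq> 0 \<and> b T \<noteq> 0" if nz: "gr_mult a b U \<noteq> 0" for U
  proof -
    obtain z where "z \<in> {(S, T). S \<union> T = U \<and> S \<inter> T = {}}" "(case z of (S, T) \<Rightarrow> gr_sign S T * a S * b T) \<noteq> 0"
      using nz unfolding gr_mult_def by (rule sum.not_neutral_contains_not_neutral)
    then show ?thesis by (cases z) auto
  qed
  have "finite {U. gr_mult a b U \<noteq> 0}"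
  proof (rule finite_subset)
    show "{U. gr_mult a b U \<noteq> 0} \<subseteq> (\<lambda>(S, T). S \<union> T) ` ({S. a S \<noteq> 0} \<times> {T. b T \<noteq> 0})"
      using nz by force
  qed (use assms in \<open>auto simp: GR_def\<close>)
  then show ?thesis using nz assms unfolding GR_def by fast
qed

lemma gr_one_GR: "gr_one \<in> GR"
  by (auto simp: GR_def gr_one_def)

lemma gr_add_GR: "a \<in> GR \<Longrightarrow> b \<in> GR \<Longrightarrow> (\<lambda>U. a U + b U) \<in> GR"
proof -
  assume "a \<in> GR" "b \<in> GR"
  moreover have "finite {U. a U + b U \<noteq> 0}" if "finite {U. a U \<noteq> 0}" "finite {U. b U \<noteq> 0}"
    by (rule finite_subset[of _ "{U. a U \<noteq> 0} \<union> {U. b U \<noteq> 0}"]) (use that in auto)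
  ultimately show ?thesis unfolding GR_def by (auto, metis add.left_neutral, metis add.left_neutral)
qed

lemma gr_scale_GR: "a \<in> GR \<Longrightarrow> (\<lambda>U. c * a U) \<in> GR"
proof -
  assume "a \<in> GR"
  moreover have "finite {U. c * a U \<noteq> 0}" if "finite {U. a U \<noteq> 0}"
    by (rule finite_subset[OF _ that]) auto
  ultimately show ?thesis unfolding GR_def by auto
qed

lemma gr_e_GR: "finite S \<Longrightarrow> 0 \<notin> S \<Longrightarrow> gr_e S \<in> GR"
  by (auto simp: GR_def gr_e_def)

text \<open>As there are infinitely many generators, some \<open>e_j\<close> lies beyond all of
  \<open>S\<close>. Moving it past an odd product changes the sign, so commuting with
  \<open>e_j\<close> forces \<open>z S = - z S\<close>.\<close>

lemma gr_centre_odd_coeff: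
  fixes z :: "nat set \<Rightarrow> 'k::field"
  assumes "z \<in> gr_centre" "odd (card S)" "(2::'k) \<noteq> 0"
  shows "z S = 0"
proof (cases "finite S")
  case True
  obtain j where j: "\<And>s. s \<in> insert 0 S \<Longrightarrow> s < j"
    using True by (metis finite_insert finite_nat_set_iff_bounded)
  then have jS: "j \<notin> S" "j \<noteq> 0" by auto
  have "gr_mult z (gr_e {j}) = gr_mult (gr_e {j}) z"
    using assms(1) jS by (auto simp: gr_centre_def gr_e_GR)
  then have "gr_mult z (gr_e {j}) (insert j S) = gr_mult (gr_e {j}) z (insert j S)" by simp
  moreover have "gr_sign S {j} = (1::'k)" "gr_sign {j} S = (-1::'k)"
    using j True assms(2) by (simp_all add: gr_sign_below gr_sign_above)
  ultimately have "z S = - z S"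
    using True jS by (simp add: gr_mult_e_right gr_mult_e_left)
  then have "2 * z S = 0" by (metis add.right_inverse mult_2)
  then show ?thesis using assms(3) by simp
next
  \<comment> \<open>An infinite set has \<open>card\<close> equal to \<open>0\<close>, which is not
    odd.\<close>
  case False
  then show ?thesis using assms by simp
qed

subsection \<open>Operators on truncated differential forms\<close>

text \<open>The value \<open>v a U\<close> is the coefficient at \<open>\<Prod>i. t\<^sub>i ^ a i\<close> times the product of the
\<open>dt\<^sub>i\<close>, \<open>i \<in> U\<close> (increasing order), of a differential form over \<open>k[t\<^sub>0, t\<^sub>1, \<dots>]/(t\<^sub>i\<^sup>p)\<close>.
Coefficients at non-admissible exponents or infinite sets are junk and get truncated to \<open>0\<close>.\<close>

type_synonym 'k form = "(nat \<Rightarrow> nat) \<Rightarrow> nat set \<Rightarrow> 'k"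

text \<open>The exponent \<open>0\<close> has to be admissible over every field, since the operators
  are made a ring with \<open>0 \<noteq> 1\<close> before the characteristic is fixed.\<close>

definition admissible :: "'k::field itself \<Rightarrow> (nat \<Rightarrow> nat) \<Rightarrow> bool" where
  "admissible _ a \<longleftrightarrow> CHAR('k) = 0 \<or> (\<forall>i. a i < CHAR('k))"

lemma admissible_0 [simp]: "admissible TYPE('k::field) (\<lambda>_. 0)"
  by (auto simp: admissible_def)

lemma admissible_dec [simp]: "admissible TYPE('k::field) a \<Longrightarrow> admissible TYPE('k) (a(i := a i - Suc 0))"
  by (auto simp: admissible_def less_imp_diff_less)

text \<open>The truncation is left only from the exponent \<open>p - 1\<close>, and there
  differentiation supplies the factor \<open>p = 0\<close>. This is why \<open>d\<close> is well
  defined on truncated polynomials.\<close>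

lemma not_admissible_inc:
  assumes "admissible TYPE('k::field) a" "\<not> admissible TYPE('k) (a(i := Suc (a i)))"
  shows "of_nat (Suc (a i)) = (0::'k)"
proof -
  have "Suc (a i) = CHAR('k)"
    using assms unfolding admissible_def by (auto split: if_splits) (metis Suc_lessI)
  then show ?thesis by (metis of_nat_CHAR)
qed

definition truncate :: "'k::field form \<Rightarrow> 'k form" where
  "truncate v = (\<lambda>a U. if admissible TYPE('k) a \<and> finite U then v a U else 0)"

definition linear_op :: "('k::field form \<Rightarrow> 'k form) \<Rightarrow> bool" where
  "linear_op F \<longleftrightarrow> (\<forall>u v. F (\<lambda>a U. u a U + v a U) = (\<lambda>a U. F u a U + F v a U)) \<and>
             (\<forall>c v. F (\<lambda>a U. c * v a U) = (\<lambda>a U. c * F v a U))"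

text \<open>Forms are represented by the operators of left multiplication, so that associativity is free
and the differential of a form becomes its supercommutator with the operator \<open>D\<close> below.\<close>

typedef (overloaded) 'k endo = "{F :: 'k::field form \<Rightarrow> 'k form.
    linear_op F \<and> (\<forall>v. F (truncate v) = F v) \<and> (\<forall>v. truncate (F v) = F v)}"
  morphisms app Endo
  by (rule exI[of _ "\<lambda>_ _ _. 0"]) (simp add: linear_op_def truncate_def)

lemma truncate_truncate [simp]: "truncate (truncate v) = truncate v"
  by (auto simp: truncate_def fun_eq_iff)

lemma truncate_add: "truncate (\<lambda>a U. u a U + v a U) = (\<lambda>a U. truncate u a U + truncate v a U)"
  by (auto simp: truncate_def fun_eq_iff)

lemma truncate_scale: "truncate (\<lambda>a U. c * v a U) = (\<lambda>a U. c * truncate v a U)"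
  by (auto simp: truncate_def fun_eq_iff)

lemma truncate_uminus: "truncate (\<lambda>a U. - v a U) = (\<lambda>a U. - truncate v a U)"
  by (auto simp: truncate_def fun_eq_iff)

lemma truncate_diff: "truncate (\<lambda>a U. u a U - v a U) = (\<lambda>a U. truncate u a U - truncate v a U)"
  by (auto simp: truncate_def fun_eq_iff)

lemma app_linear_op: "linear_op (app x)" and app_truncate [simp]: "app x (truncate v) = app x v"
  and truncate_app [simp]: "truncate (app x v) = app x v"
  using app[of x] by auto

lemma app_add: "app x (\<lambda>a U. u a U + v a U) = (\<lambda>a U. app x u a U + app x v a U)"
  and app_scale: "app x (\<lambda>a U. c * v a U) = (\<lambda>a U. c * app x v a U)"
  using app_linear_op[of x] by (auto simp: linear_op_def)

lemma app_zero: "app x (\<lambda>_ _. 0) = (\<lambda>_ _. 0)"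
  using app_scale[of x 0 "\<lambda>_ _. 0"] by simp

lemma app_not_admissible: "\<not> (admissible TYPE('k) a \<and> finite U) \<Longrightarrow> app (x :: 'k::field endo) v a U = 0"
  by (subst truncate_app[symmetric]) (auto simp only: truncate_def if_False)

definition mk_endo :: "('k::field form \<Rightarrow> 'k form) \<Rightarrow> 'k endo" where
  "mk_endo F = Endo (\<lambda>v. truncate (F (truncate v)))"

lemma app_mk_endo: "linear_op F \<Longrightarrow> app (mk_endo F) v = truncate (F (truncate v))"
  unfolding mk_endo_def by (subst Endo_inverse) (auto simp: linear_op_def truncate_add truncate_scale)

lemma endo_eqI:
  fixes x y :: "'k::field endo"
  assumes "\<And>v a U. truncate v = v \<Longrightarrow> admissible TYPE('k) a \<Longrightarrow> finite U \<Longrightarrow> app x v a U = app y v a U"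
  shows "x = y"
proof -
  have "app x v = app y v" for v
  proof (intro ext)
    fix a U
    show "app x v a U = app y v a U"
    proof (cases "admissible TYPE('k) a \<and> finite U")
      case True
      have "app x (truncate v) a U = app y (truncate v) a U"
        by (rule assms) (use True in auto)
      then show ?thesis by simp
    next
      case False
      then show ?thesis by (simp add: app_not_admissible)
    qed
  qed
  then show ?thesis by (simp add: app_inject[symmetric] fun_eq_iff)
qed

instantiation endo :: (field) ring_1
begin

definition one_endo :: "'a endo" where "1 = mk_endo (\<lambda>v. v)"
definition zero_endo :: "'a endo" where "0 = mk_endo (\<lambda>_ _ _. 0)"
definition plus_endo :: "'a endo \<Rightarrow> 'a endo \<Rightarrow> 'a endo" where
  "x + y = mk_endo (\<lambda>v a U. app x v a U + app y v a U)"
definition minus_endo :: "'a endo \<Rightarrow> 'a endo \<Rightarrow> 'a endo" where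
  "x - y = mk_endo (\<lambda>v a U. app x v a U - app y v a U)"
definition uminus_endo :: "'a endo \<Rightarrow> 'a endo" where
  "- x = mk_endo (\<lambda>v a U. - app x v a U)"
definition times_endo :: "'a endo \<Rightarrow> 'a endo \<Rightarrow> 'a endo" where
  "x * y = mk_endo (\<lambda>v. app x (app y v))"

lemma app_one: "app 1 v = truncate v"
  unfolding one_endo_def by (subst app_mk_endo) (auto simp: linear_op_def)
lemma app_0: "app 0 v = (\<lambda>_ _. 0)"
  unfolding zero_endo_def by (subst app_mk_endo) (auto simp: linear_op_def truncate_def)
lemma app_plus: "app (x + y) v = (\<lambda>a U. app x v a U + app y v a U)"
  unfolding plus_endo_def by (subst app_mk_endo) (auto simp: linear_op_def app_add app_scale algebra_simps truncate_add)
lemma app_minus: "app (x - y) v = (\<lambda>a U. app x v a U - app y v a U)"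
  unfolding minus_endo_def by (subst app_mk_endo) (auto simp: linear_op_def app_add app_scale algebra_simps truncate_diff)
lemma app_uminus: "app (- x) v = (\<lambda>a U. - app x v a U)"
  unfolding uminus_endo_def by (subst app_mk_endo) (auto simp: linear_op_def app_add app_scale algebra_simps truncate_uminus)
lemma app_times: "app (x * y) v = app x (app y v)"
  unfolding times_endo_def by (subst app_mk_endo) (auto simp: linear_op_def app_add app_scale algebra_simps)

instance
proof
  fix a b c :: "'a endo"
  show "(0::'a endo) \<noteq> 1"
  proof
    assume "(0::'a endo) = 1"
    then have "app (0::'a endo) (\<lambda>_ _. 1) (\<lambda>_. 0) {} = app 1 (\<lambda>_ _. 1) (\<lambda>_. 0) {}" by simp
    then show False by (simp add: app_0 app_one truncate_def)
  qed
qed (rule endo_eqI; simp add: app_one app_0 app_plus app_minus app_uminus app_times app_add algebra_simps)+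

end

definition scal :: "'k::field \<Rightarrow> 'k endo" where
  "scal c = mk_endo (\<lambda>v a U. c * v a U)"

lemma app_scal: "app (scal c) v = (\<lambda>a U. c * truncate v a U)"
  unfolding scal_def by (subst app_mk_endo) (auto simp: linear_op_def truncate_scale algebra_simps)

lemma scal_comm: "scal c * x = x * scal c"
  by (rule endo_eqI) (simp add: app_times app_scal app_scale)

lemma scal_add: "scal (c + d) = scal c + scal d"
  and scal_mult: "scal (c * d) = scal c * scal d"
  and scal_0 [simp]: "scal 0 = 0" and scal_1 [simp]: "scal 1 = 1"
  and scal_uminus: "scal (- c) = - scal c"
  by (rule endo_eqI; simp add: app_plus app_uminus app_times app_scal app_0 app_one truncate_scale algebra_simps)+

lemma scal_of_nat: "scal (of_nat n) = of_nat n"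
  by (induction n) (simp_all add: scal_add)

lemma scal_inverse_mult: "c \<noteq> 0 \<Longrightarrow> scal (inverse c) * (scal c * x) = x"
  by (simp add: mult.assoc[symmetric] scal_mult[symmetric])

lemma of_nat_CHAR_endo: "of_nat CHAR('k) = (0 :: 'k::field endo)"
  by (simp add: scal_of_nat[symmetric])

section \<open>Multiplication operators, the exterior derivative and the parity operator\<close>

definition iota :: "(nat set \<Rightarrow> 'k::field) \<Rightarrow> 'k endo" where
  "iota g = mk_endo (\<lambda>v a U. if finite U then gr_mult g (v a) U else 0)"

definition tvar :: "nat \<Rightarrow> 'k::field endo" where
  "tvar i = mk_endo (\<lambda>v a U. if 0 < a i then v (a(i := a i - 1)) U else 0)"

definition theta :: "nat \<Rightarrow> 'k::field endo" where
  "theta i = mk_endo (\<lambda>v a U. if i \<in> U then gsign i U * v a (U - {i}) else 0)"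

text \<open>The exterior derivative in coordinates: the exponent \<open>a\<close> at
  \<open>t_i\<close> arises from \<open>Suc (a i)\<close> by a partial derivative, and
  \<open>gsign\<close> sorts the new \<open>dt_i\<close> into its place.\<close>

definition dform :: "'k::field form \<Rightarrow> 'k form" where
  "dform v = (\<lambda>a U. \<Sum>i\<in>U. of_nat (Suc (a i)) * gsign i U * v (a(i := Suc (a i))) (U - {i}))"

definition D :: "'k::field endo" where
  "D = mk_endo dform"

definition parity :: "'k::field endo" where
  "parity = mk_endo (\<lambda>v a U. (-1) ^ card U * v a U)"

text \<open>The form \<open>1\<close>. Applying a left multiplication to it recovers the form that
  is multiplied by.\<close>

definition vacuum :: "'k::field form" where
  "vacuum = (\<lambda>a U. if a = (\<lambda>_. 0) \<and> U = {} then 1 else 0)"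

lemma truncate_admissible: "admissible TYPE('k) a \<Longrightarrow> finite U \<Longrightarrow> truncate (v :: 'k::field form) a U = v a U"
  by (simp add: truncate_def)

lemma truncate_vacuum [simp]: "truncate vacuum = vacuum"
  by (intro ext) (auto simp: truncate_def vacuum_def)

lemma linear_op_iota: "linear_op (\<lambda>v a U. if finite U then gr_mult g (v a) U else 0)"
  by (auto simp: linear_op_def gr_mult_Pow fun_eq_iff sum.distrib sum_distrib_left algebra_simps)

lemma app_iota:
  assumes "admissible TYPE('k) a" "finite U"
  shows "app (iota g) v a U = gr_mult g ((v :: 'k::field form) a) U"
  using assms finite_subset[OF _ assms(2)]
  unfolding iota_def by (subst app_mk_endo[OF linear_op_iota]) (auto simp: truncate_def gr_mult_Pow intro!: sum.cong)

lemma app_tvar: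
  assumes "admissible TYPE('k) a" "finite U"
  shows "app (tvar i) v a U = (if 0 < a i then (v :: 'k::field form) (a(i := a i - 1)) U else 0)"
proof -
  have "admissible TYPE('k) (a(i := a i - 1))" using assms by simp
  then show ?thesis
    unfolding tvar_def using assms by (subst app_mk_endo) (auto simp: linear_op_def truncate_def fun_eq_iff)
qed

lemma app_theta:
  assumes "admissible TYPE('k) a" "finite U"
  shows "app (theta i) v a U = (if i \<in> U then gsign i U * (v :: 'k::field form) a (U - {i}) else 0)"
  unfolding theta_def using assms by (subst app_mk_endo) (auto simp: linear_op_def truncate_def fun_eq_iff algebra_simps)

lemma app_parity:
  assumes "admissible TYPE('k) a" "finite U"
  shows "app parity v a U = (-1) ^ card U * (v :: 'k::field form) a U"
  unfolding parity_def using assms by (subst app_mk_endo) (auto simp: linear_op_def truncate_def algebra_simps)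

lemma linear_op_dform: "linear_op dform"
  by (auto simp: linear_op_def fun_eq_iff dform_def sum.distrib sum_distrib_left algebra_simps)

lemma app_D:
  assumes "admissible TYPE('k) a" "finite U" "truncate v = v"
  shows "app D v a U = dform (v :: 'k::field form) a U"
  unfolding D_def using assms by (subst app_mk_endo[OF linear_op_dform]) (auto simp: truncate_def)

text \<open>The Grassmann generators act as the differentials \<open>dt_i\<close>. So Grassmann
  elements and forms live in one ring, and a single notion of substitution serves both.\<close>

lemma iota_single: "iota (gr_e {i}) = theta i"
  by (rule endo_eqI) (auto simp: app_iota app_theta gr_mult_single_left)

lemma iota_mult: "iota (gr_mult g h) = iota g * (iota h :: 'k::field endo)"
proof (rule endo_eqI)
  fix v :: "'k form" and a :: "nat \<Rightarrow> nat" and U :: "nat set"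
  assume a: "admissible TYPE('k) a" "finite U"
  have "gr_mult g (gr_mult h (v a)) U = gr_mult g (app (iota h) v a) U"
    using a finite_subset[OF _ a(2)] by (auto simp: gr_mult_Pow app_iota intro!: sum.cong)
  then show "app (iota (gr_mult g h)) v a U = app (iota g * iota h) v a U"
    using a by (simp add: app_times app_iota gr_mult_assoc)
qed

lemma iota_add: "iota (\<lambda>U. g U + h U) = iota g + (iota h :: 'k::field endo)"
  by (rule endo_eqI) (simp add: app_plus app_iota gr_mult_Pow sum.distrib algebra_simps)

lemma iota_scale: "iota (\<lambda>U. c * g U) = scal c * (iota g :: 'k::field endo)"
  by (rule endo_eqI) (simp add: app_times app_scal app_iota gr_mult_Pow sum_distrib_left algebra_simps)

lemma gr_e_empty: "gr_e {} = gr_one"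
  by (auto simp: gr_e_def gr_one_def)

lemma iota_one: "iota gr_one = (1 :: 'k::field endo)"
  by (rule endo_eqI) (simp add: app_one app_iota gr_e_empty[symmetric] gr_mult_e_left gr_sign_def)

lemma iota_zero: "iota (\<lambda>_. 0) = (0 :: 'k::field endo)"
  using iota_scale[of 0 "\<lambda>_. 0"] by simp

lemma app_iota_vacuum:
  assumes "finite U"
  shows "app (iota g) (vacuum :: 'k::field form) (\<lambda>_. 0) U = g U"
proof -
  have "app (iota g) (vacuum :: 'k form) (\<lambda>_. 0) U = gr_mult g (gr_e {}) U"
    using assms by (subst app_iota) (auto simp: vacuum_def gr_e_def intro!: arg_cong2[where f = "\<lambda>x. gr_mult g x"])
  then show ?thesis using assms by (simp add: gr_mult_e_right gr_sign_def)
qed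

lemma iota_inj:
  assumes "g \<in> GR" "h \<in> GR" "iota g = (iota h :: 'k::field endo)"
  shows "g = h"
proof
  fix U
  show "g U = h U"
  proof (cases "finite U")
    case True
    then show ?thesis using assms(3) app_iota_vacuum[of U g] app_iota_vacuum[of U h] by simp
  next
    case False
    then show ?thesis using assms(1,2) unfolding GR_def by (metis (mono_tags, lifting) mem_Collect_eq)
  qed
qed

section \<open>Commutation relations\<close>

lemma tvar_tvar: "tvar i * tvar j = tvar j * (tvar i :: 'k::field endo)"
proof (rule endo_eqI)
  fix v :: "'k form" and a :: "nat \<Rightarrow> nat" and U :: "nat set"
  assume a: "admissible TYPE('k) a" "finite U"
  then show "app (tvar i * tvar j) v a U = app (tvar j * tvar i) v a U"
    using a by (cases "i = j") (auto simp: app_times app_tvar fun_upd_twist)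
qed

lemma tvar_theta: "tvar i * theta j = theta j * (tvar i :: 'k::field endo)"
proof (rule endo_eqI)
  fix v :: "'k form" and a :: "nat \<Rightarrow> nat" and U :: "nat set"
  assume a: "admissible TYPE('k) a" "finite U"
  then show "app (tvar i * theta j) v a U = app (theta j * tvar i) v a U"
    using a by (auto simp: app_times app_tvar app_theta)
qed

lemma theta_theta:
  assumes "i \<noteq> j"
  shows "theta i * theta j = - (theta j * (theta i :: 'k::field endo))"
proof (rule endo_eqI)
  fix v :: "'k form" and a :: "nat \<Rightarrow> nat" and U :: "nat set"
  assume a: "admissible TYPE('k) a" "finite U"
  have "U - {i} - {j} = U - {j} - {i}" by auto
  then show "app (theta i * theta j) v a U = app (- (theta j * theta i)) v a U"
    using a gsign_swap[of U i j, where 'k='k] assms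
    by (auto simp: app_times app_theta app_uminus mult.assoc[symmetric])
qed

lemma theta_sq: "theta i * theta i = (0 :: 'k::field endo)"
  by (rule endo_eqI) (auto simp: app_times app_theta app_0)

text \<open>This is the Leibniz rule for \<open>t_i\<close> times a form. The terms with
  \<open>j \<noteq> i\<close> cancel; at \<open>j = i\<close> the factors \<open>Suc (a i)\<close>
  and \<open>a i\<close> differ by one.\<close>

lemma D_tvar: "D * tvar i - tvar i * D = (theta i :: 'k::field endo)"
proof (rule endo_eqI)
  fix v :: "'k form" and a :: "nat \<Rightarrow> nat" and U :: "nat set"
  assume a: "admissible TYPE('k) a" "finite U" and v: "truncate v = v"
  let ?c = "\<lambda>j. of_nat (Suc (a j)) * gsign j U :: 'k"
  let ?w = "\<lambda>j. if 0 < a i then v (a(j := Suc (a j), i := a i - 1)) (U - {j}) else 0"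
  have "app (D * tvar i) v a U = (\<Sum>j\<in>U. ?c j * app (tvar i) v (a(j := Suc (a j))) (U - {j}))"
    using a by (simp add: app_times app_D dform_def)
  also have "\<dots> = (\<Sum>j\<in>U. (if j = i then ?c i * v a (U - {i}) else ?c j * ?w j))"
  proof (rule sum.cong)
    fix j assume "j \<in> U"
    show "?c j * app (tvar i) v (a(j := Suc (a j))) (U - {j}) =
      (if j = i then ?c i * v a (U - {i}) else ?c j * ?w j)"
    proof (cases "admissible TYPE('k) (a(j := Suc (a j)))")
      case True
      then show ?thesis using a by (auto simp: app_tvar)
    next
      case False
      then show ?thesis using a not_admissible_inc[OF a(1) False] by auto
    qed
  qed simp
  finally have DT: "app (D * tvar i) v a U = (\<Sum>j\<in>U. (if j = i then ?c i * v a (U - {i}) else ?c j * ?w j))" .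
  have "app (tvar i * D) v a U = (\<Sum>j\<in>U. (if j = i then of_nat (a i) * gsign i U * v a (U - {i}) else ?c j * ?w j))"
  proof (cases "0 < a i")
    case True
    then show ?thesis using a v
      by (auto simp: app_times app_tvar app_D dform_def fun_upd_twist intro!: sum.cong)
  next
    case False
    then show ?thesis using a v by (auto simp: app_times app_tvar intro!: sum.neutral)
  qed
  then have "app (D * tvar i - tvar i * D) v a U =
     (\<Sum>j\<in>U. (if j = i then ?c i * v a (U - {i}) else ?c j * ?w j) -
       (if j = i then of_nat (a i) * gsign i U * v a (U - {i}) else ?c j * ?w j))"
    using DT by (simp add: app_minus sum_subtractf)
  also have "\<dots> = (\<Sum>j\<in>U. if j = i then gsign i U * v a (U - {i}) else 0)"
    by (rule sum.cong) (auto simp: algebra_simps)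
  also have "\<dots> = app (theta i) v a U" using a by (simp add: app_theta)
  finally show "app (D * tvar i - tvar i * D) v a U = app (theta i) v a U" .
qed

lemma D_theta: "D * theta i + theta i * D = (0 :: 'k::field endo)"
proof (rule endo_eqI)
  fix v :: "'k form" and a :: "nat \<Rightarrow> nat" and U :: "nat set"
  assume a: "admissible TYPE('k) a" "finite U" and v: "truncate v = v"
  let ?c = "\<lambda>j. of_nat (Suc (a j)) :: 'k"
  let ?w = "\<lambda>j. v (a(j := Suc (a j))) (U - {j} - {i})"
  have "app (D * theta i) v a U = (\<Sum>j\<in>U. ?c j * gsign j U * app (theta i) v (a(j := Suc (a j))) (U - {j}))"
    using a by (simp add: app_times app_D dform_def)
  also have "\<dots> = (\<Sum>j\<in>U. if i \<in> U - {j} then - (?c j * gsign i U * gsign j (U - {i}) * ?w j) else 0)"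
  proof (rule sum.cong)
    fix j assume j: "j \<in> U"
    show "?c j * gsign j U * app (theta i) v (a(j := Suc (a j))) (U - {j}) =
      (if i \<in> U - {j} then - (?c j * gsign i U * gsign j (U - {i}) * ?w j) else 0)"
    proof (cases "admissible TYPE('k) (a(j := Suc (a j)))")
      case True
      have "gsign j U * (gsign i (U - {j}) * x) = - (gsign i U * (gsign j (U - {i}) * x))" if "i \<in> U" "i \<noteq> j" for x :: 'k
        using gsign_swap[of U i j, where 'k='k] a j that by (simp add: mult.assoc[symmetric])
      then show ?thesis using a j True by (auto simp: app_theta mult.assoc)
    next
      case False
      then show ?thesis using a not_admissible_inc[OF a(1) False] by (simp add: app_not_admissible)
    qed
  qed simp
  also have "\<dots> = - app (theta i * D) v a U"
  proof (cases "i \<in> U")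
    case True
    have "(\<Sum>j\<in>U. if i \<in> U - {j} then - (?c j * gsign i U * gsign j (U - {i}) * ?w j) else 0) =
        (\<Sum>j\<in>U - {i}. - (?c j * gsign i U * gsign j (U - {i}) * ?w j))"
      using a True by (intro sum.mono_neutral_cong_right) auto
    also have "\<dots> = - (gsign i U * (\<Sum>j\<in>U - {i}. ?c j * gsign j (U - {i}) * v (a(j := Suc (a j))) (U - {i} - {j})))"
      by (simp add: sum_distrib_left sum_negf[symmetric] algebra_simps Diff_insert2[symmetric] insert_commute)
    finally show ?thesis using a v True by (simp add: app_times app_theta app_D dform_def)
  next
    case False
    then show ?thesis using a v by (auto simp: app_times app_theta intro!: sum.neutral)
  qed
  finally show "app (D * theta i + theta i * D) v a U = app 0 v a U"
    by (simp add: app_plus app_0)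
qed

text \<open>Mixed partial derivatives agree while the two new differentials anticommute, so the
  double sum is antisymmetric and equal to its own negative.\<close>

lemma D_D:
  assumes two: "(2::'k::field) \<noteq> 0"
  shows "D * D = (0 :: 'k::field endo)"
proof (rule endo_eqI)
  fix v :: "'k form" and a :: "nat \<Rightarrow> nat" and U :: "nat set"
  assume a: "admissible TYPE('k) a" "finite U" and v: "truncate v = v"
  let ?c = "\<lambda>j. of_nat (Suc (a j)) :: 'k"
  define F where "F i j = (if i = j then 0 else ?c i * gsign i U * (?c j * gsign j (U - {i})
    * v (a(i := Suc (a i), j := Suc (a j))) (U - {i} - {j})))" for i j
  have "app (D * D) v a U = (\<Sum>i\<in>U. ?c i * gsign i U * app D v (a(i := Suc (a i))) (U - {i}))"
    using a by (simp add: app_times app_D dform_def)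
  also have "\<dots> = (\<Sum>i\<in>U. \<Sum>j\<in>U. F i j)"
  proof (rule sum.cong)
    fix i assume i: "i \<in> U"
    show "?c i * gsign i U * app D v (a(i := Suc (a i))) (U - {i}) = (\<Sum>j\<in>U. F i j)"
    proof (cases "admissible TYPE('k) (a(i := Suc (a i)))")
      case True
      have "(\<Sum>j\<in>U. F i j) = (\<Sum>j\<in>U - {i}. F i j)"
        using a i by (intro sum.mono_neutral_right) (auto simp: F_def)
      then show ?thesis using a v i True
        by (auto simp: app_D dform_def F_def sum_distrib_left intro!: sum.cong)
    next
      case False
      show ?thesis
        using not_admissible_inc[OF a(1) False] a(2) by (auto simp: F_def simp del: of_nat_Suc intro!: sum.neutral)
    qed
  qed simp
  finally have eq: "app (D * D) v a U = (\<Sum>i\<in>U. \<Sum>j\<in>U. F i j)" .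
  have F: "F i j = - F j i" if "i \<in> U" "j \<in> U" for i j
  proof (cases "i = j")
    case False
    have U: "U - {i} - {j} = U - {j} - {i}" by auto
    have "gsign i U * gsign j (U - {i}) = - (gsign j U * gsign i (U - {j}) :: 'k)"
      using gsign_swap[of U i j] a that False by simp
    moreover have "F i j = (gsign i U * gsign j (U - {i})) * (?c i * ?c j * v (a(i := Suc (a i), j := Suc (a j))) (U - {j} - {i}))"
      using False by (simp add: F_def algebra_simps U)
    moreover have "F j i = (gsign j U * gsign i (U - {j})) * (?c i * ?c j * v (a(i := Suc (a i), j := Suc (a j))) (U - {j} - {i}))"
      using False by (simp add: F_def algebra_simps fun_upd_twist)
    ultimately show ?thesis by simp
  qed (simp add: F_def)
  have "(\<Sum>i\<in>U. \<Sum>j\<in>U. F i j) = (\<Sum>i\<in>U. \<Sum>j\<in>U. - F j i)"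
    by (intro sum.cong) (auto intro: F)
  also have "\<dots> = - (\<Sum>i\<in>U. \<Sum>j\<in>U. F i j)"
    by (subst sum.swap) (simp add: sum_negf)
  finally have "2 * (\<Sum>i\<in>U. \<Sum>j\<in>U. F i j) = 0" by (metis add.right_inverse mult_2)
  then show "app (D * D) v a U = app 0 v a U"
    using eq two by (simp add: app_0)
qed

lemma minus_one_power_Diff:
  assumes "finite U" "i \<in> U"
  shows "(-1) ^ (card U - Suc 0) = - ((-1) ^ card U :: 'a::ring_1)"
  using assms card_gt_0_iff[of U] by (cases "card U") auto

lemma parity_parity: "parity * parity = (1 :: 'k::field endo)"
  by (rule endo_eqI) (simp add: app_times app_parity app_one mult.assoc[symmetric] power_add[symmetric])

lemma parity_tvar: "parity * tvar i = tvar i * (parity :: 'k::field endo)"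
  by (rule endo_eqI) (simp add: app_times app_parity app_tvar)

lemma parity_theta: "parity * theta i = - (theta i * (parity :: 'k::field endo))"
  by (rule endo_eqI) (auto simp: app_times app_parity app_theta app_uminus minus_one_power_Diff)

lemma parity_D: "parity * D = - (D * (parity :: 'k::field endo))"
proof (rule endo_eqI)
  fix v :: "'k form" and a :: "nat \<Rightarrow> nat" and U :: "nat set"
  assume a: "admissible TYPE('k) a" "finite U" and v: "truncate v = v"
  let ?c = "\<lambda>j. of_nat (Suc (a j)) * gsign j U :: 'k"
  have "app (D * parity) v a U = (\<Sum>j\<in>U. ?c j * app parity v (a(j := Suc (a j))) (U - {j}))"
    using a by (simp add: app_times app_D dform_def)
  also have "\<dots> = (\<Sum>j\<in>U. - ((-1) ^ card U * (?c j * v (a(j := Suc (a j))) (U - {j}))))"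
  proof (rule sum.cong)
    fix j assume j: "j \<in> U"
    show "?c j * app parity v (a(j := Suc (a j))) (U - {j}) =
      - ((-1) ^ card U * (?c j * v (a(j := Suc (a j))) (U - {j})))"
    proof (cases "admissible TYPE('k) (a(j := Suc (a j)))")
      case True
      then show ?thesis using a j by (simp add: app_parity minus_one_power_Diff)
    next
      case False
      then show ?thesis using a not_admissible_inc[OF a(1) False] by simp
    qed
  qed simp
  also have "\<dots> = - app (parity * D) v a U"
    using a v by (simp add: app_times app_parity app_D dform_def sum_distrib_left sum_negf)
  finally show "app (parity * D) v a U = app (- (D * parity)) v a U"
    by (simp add: app_uminus)
qed

lemma app_tvar_power:
  assumes "admissible TYPE('k) a" "finite U" "truncate v = v"
  shows "app (tvar i ^ n) v a U = (if n \<le> a i then (v :: 'k::field form) (a(i := a i - n)) U else 0)"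
  using assms(1)
proof (induction n arbitrary: a)
  case 0
  then show ?case using assms by (simp add: app_one)
next
  case (Suc n)
  have "app (tvar i ^ n) v (a(i := a i - Suc 0)) U =
      (if n \<le> a i - Suc 0 then v (a(i := a i - Suc 0 - n)) U else 0)"
  proof -
    define b where "b = a(i := a i - Suc 0)"
    have "admissible TYPE('k) b" "b i = a i - Suc 0" "b(i := k) = a(i := k)" for k
      using Suc.prems by (simp_all add: b_def)
    then show ?thesis unfolding b_def[symmetric] using Suc.IH[of b] by simp
  qed
  then show ?case
    using Suc.prems assms(2) by (auto simp: app_times app_tvar fun_upd_def)
qed

lemma tvar_CHAR: "CHAR('k) > 0 \<Longrightarrow> tvar i ^ CHAR('k) = (0 :: 'k::field endo)"
proof (rule endo_eqI)
  fix v :: "'k form" and a :: "nat \<Rightarrow> nat" and U :: "nat set"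
  assume a: "admissible TYPE('k) a" "finite U" and v: "truncate v = v" and "CHAR('k) > 0"
  then have "\<not> CHAR('k) \<le> a i" by (auto simp: admissible_def not_le)
  then show "app (tvar i ^ CHAR('k)) v a U = app 0 v a U"
    using a v by (simp add: app_tvar_power app_0)
qed

lemma app_D_vacuum: "app D vacuum = (\<lambda>_ _. 0 :: 'k::field)"
proof (intro ext)
  fix a U
  show "app D (vacuum :: 'k form) a U = 0"
  proof (cases "admissible TYPE('k) a \<and> finite U")
    case True
    then have "app D (vacuum :: 'k form) a U = dform vacuum a U" by (simp add: app_D)
    also have "\<dots> = 0" by (auto simp: dform_def vacuum_def fun_eq_iff intro!: sum.neutral)
    finally show ?thesis .
  qed (simp add: app_not_admissible)
qed

lemma app_parity_vacuum: "app parity vacuum = (vacuum :: 'k::field form)"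
proof (intro ext)
  fix a U
  show "app parity (vacuum :: 'k form) a U = vacuum a U"
  proof (cases "admissible TYPE('k) a \<and> finite U")
    case True
    then show ?thesis by (auto simp: app_parity vacuum_def)
  next
    case False
    then show ?thesis by (auto simp: app_not_admissible vacuum_def)
  qed
qed

subsection \<open>The differential and the parity automorphism\<close>

lemma scal_left_commute: "x * (scal c * y) = scal c * (x * y)"
  by (metis mult.assoc scal_comm)

definition bar :: "'k::field endo \<Rightarrow> 'k endo" where
  "bar z = parity * z * parity"

text \<open>With \<open>bar\<close> in the place of a sign depending on the degree, the Leibniz rule
  holds for all operators, without any homogeneity.\<close>

definition dd :: "'k::field endo \<Rightarrow> 'k endo" where
  "dd z = D * z - bar z * D"

lemma bar_add: "bar (x + y) = bar x + bar y"
  and bar_diff: "bar (x - y) = bar x - bar y"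
  and bar_uminus: "bar (- x) = - bar x"
  and bar_0 [simp]: "bar 0 = 0"
  by (simp_all add: bar_def algebra_simps)

lemma bar_mult: "bar (x * y) = bar x * bar y"
proof -
  have "bar x * bar y = parity * x * (parity * parity) * y * parity" by (simp only: bar_def mult.assoc)
  then show ?thesis by (simp add: parity_parity bar_def mult.assoc)
qed

lemma bar_scal [simp]: "bar (scal c) = scal c"
  by (metis bar_def mult.assoc mult.right_neutral scal_comm parity_parity)

lemma bar_1 [simp]: "bar 1 = 1"
  using bar_scal[of 1] by simp

lemma bar_power: "bar (x ^ n) = bar x ^ n"
  by (induction n) (simp_all add: bar_mult)

lemma bar_bar [simp]: "bar (bar x) = x"
proof -
  have "bar (bar x) = (parity * parity) * x * (parity * parity)" by (simp only: bar_def mult.assoc)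
  then show ?thesis by (simp add: parity_parity)
qed

lemma bar_tvar [simp]: "bar (tvar i) = tvar i"
  unfolding bar_def by (metis mult.assoc mult.right_neutral parity_tvar parity_parity)

lemma bar_theta [simp]: "bar (theta i) = - theta i"
  unfolding bar_def by (simp add: parity_theta mult.assoc parity_parity)

lemma bar_D: "bar D = - D"
  unfolding bar_def by (simp add: parity_D mult.assoc parity_parity)

lemma dd_add: "dd (x + y) = dd x + dd y"
  and dd_0 [simp]: "dd 0 = 0"
  by (simp_all add: dd_def bar_add bar_diff bar_uminus algebra_simps)

lemma dd_mult: "dd (x * y) = dd x * y + bar x * dd y"
  by (simp add: dd_def bar_mult algebra_simps)

lemma dd_scal [simp]: "dd (scal c) = 0"
  by (simp add: dd_def scal_comm)

lemma dd_1 [simp]: "dd 1 = 0"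
  using dd_scal[of 1] by simp

lemma dd_of_nat [simp]: "dd (of_nat n) = 0"
  by (simp add: scal_of_nat[symmetric])

lemma dd_scal_mult: "dd (scal c * x) = scal c * dd x"
  by (simp add: dd_mult)

lemma dd_sum: "dd (sum f A) = (\<Sum>i\<in>A. dd (f i))"
  by (induction A rule: infinite_finite_induct) (simp_all add: dd_add)

lemma bar_sum: "bar (sum f A) = (\<Sum>i\<in>A. bar (f i))"
  by (induction A rule: infinite_finite_induct) (simp_all add: bar_add)

lemma dd_tvar [simp]: "dd (tvar i) = theta i"
  by (simp add: dd_def D_tvar)

lemma dd_theta [simp]: "dd (theta i) = 0"
  by (simp add: dd_def D_theta)

lemma bar_dd: "bar (dd x) = - dd (bar x)"
  by (simp add: dd_def bar_diff bar_mult bar_D)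

lemma dd_dd [simp]:
  assumes "(2::'k::field) \<noteq> 0"
  shows "dd (dd x) = (0 :: 'k endo)"
proof -
  have "dd (dd x) = D * dd x + dd (bar x) * D"
    by (simp add: dd_def[of "dd x"] bar_dd)
  also have "\<dots> = (D * D) * x - x * (D * D)"
    by (simp add: dd_def right_diff_distrib left_diff_distrib mult.assoc)
  finally show ?thesis by (simp add: D_D[OF assms])
qed

subsection \<open>The supercommutative algebra of forms\<close>

text \<open>The flag is \<open>True\<close> for forms of odd degree.\<close>

inductive homog :: "bool \<Rightarrow> 'k::field endo \<Rightarrow> bool" where
  homog_scal: "homog False (scal c)"
| homog_tvar: "homog False (tvar i)"
| homog_theta: "homog True (theta i)"
| homog_add: "homog s x \<Longrightarrow> homog s y \<Longrightarrow> homog s (x + y)"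
| homog_mult: "homog s x \<Longrightarrow> homog t y \<Longrightarrow> homog (s \<noteq> t) (x * y)"

lemma homog_mult': "homog s x \<Longrightarrow> homog t y \<Longrightarrow> u = (s \<noteq> t) \<Longrightarrow> homog u (x * y)"
  using homog_mult by auto

lemma homog_scale: "homog s x \<Longrightarrow> homog s (scal c * x)"
  by (rule homog_mult'[OF homog_scal]) auto

lemma homog_uminus: "homog s x \<Longrightarrow> homog s (- x)"
  using homog_scale[of s x "-1"] by (simp add: scal_uminus)

lemma homog_diff: "homog s x \<Longrightarrow> homog s y \<Longrightarrow> homog s (x - y)"
  using homog_add[of s x "- y"] homog_uminus[of s y] by simp

lemma homog_zero: "homog s 0"
  using homog_scale[OF homog_tvar, of 0] homog_scale[OF homog_theta, of 0] by (cases s) auto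

lemma homog_one: "homog False 1"
  using homog_scal[of 1] by simp

lemma homog_power: "homog False x \<Longrightarrow> homog False (x ^ n)"
  by (induction n) (auto simp: homog_one intro: homog_mult')

lemma homog_sum: "(\<And>i. i \<in> A \<Longrightarrow> homog s (f i)) \<Longrightarrow> homog s (sum f A)"
  by (induction A rule: infinite_finite_induct) (auto simp: homog_zero homog_add)

lemma homog_tvar_comm: "homog t y \<Longrightarrow> tvar i * y = y * tvar i"
proof (induction rule: homog.induct)
  case (homog_mult s x t y)
  then show ?case by (metis mult.assoc)
qed (simp_all add: scal_comm tvar_tvar tvar_theta algebra_simps)

lemma homog_theta_comm: "homog t y \<Longrightarrow> theta i * y = (if t then - (y * theta i) else y * theta i)"
proof (induction rule: homog.induct)
  case (homog_theta j)
  then show ?case using theta_theta[of i j] by (cases "i = j") (simp_all add: theta_sq)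
next
  case (homog_mult s x t y)
  have "theta i * (x * y) = (theta i * x) * y" by (simp add: mult.assoc)
  also have "\<dots> = (if s then - (x * (theta i * y)) else x * (theta i * y))"
    using homog_mult.IH(1) by (simp add: mult.assoc)
  finally show ?case using homog_mult.IH(2) by (auto simp: mult.assoc)
qed (auto simp: scal_comm tvar_theta algebra_simps)

lemma homog_comm: "homog s x \<Longrightarrow> homog t y \<Longrightarrow> x * y = (if s \<and> t then - (y * x) else y * x)"
proof (induction rule: homog.induct)
  case (homog_mult s x s' x')
  have "x * x' * y = x * (x' * y)" by (simp add: mult.assoc)
  also have "\<dots> = (if s' \<and> t then - (x * y * x') else x * y * x')"
    using homog_mult.IH(2)[OF homog_mult.prems] by (simp add: mult.assoc)
  finally show ?case using homog_mult.IH(1)[OF homog_mult.prems] by (auto simp: mult.assoc)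
qed (auto simp: scal_comm homog_tvar_comm homog_theta_comm algebra_simps)

lemma homog_even_comm: "homog False x \<Longrightarrow> homog t y \<Longrightarrow> x * y = y * x"
  using homog_comm[of False x t y] by simp

lemma homog_odd_sq:
  assumes "homog True x" "(2::'k::field) \<noteq> 0"
  shows "x * x = (0 :: 'k endo)"
proof -
  have "x * x = - (x * x)" using homog_comm[OF assms(1) assms(1)] by simp
  then have "scal 2 * (x * x) = 0"
    by (simp add: eq_neg_iff_add_eq_0 mult_2 scal_of_nat[of 2, simplified])
  then show ?thesis using scal_inverse_mult[OF assms(2), of "x * x"] by simp
qed

lemma homog_bar: "homog s x \<Longrightarrow> bar x = (if s then - x else x)"
  by (induction rule: homog.induct) (auto simp: bar_add bar_mult)

lemma homog_dd: "homog s x \<Longrightarrow> homog (\<not> s) (dd x)"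
proof (induction rule: homog.induct)
  case (homog_mult s x t y)
  have "homog (\<not> (s \<noteq> t)) (dd x * y)" using homog_mult by (auto intro: homog_mult')
  moreover have "homog (\<not> (s \<noteq> t)) (x * dd y)" using homog_mult by (auto intro: homog_mult')
  ultimately show ?case
    using homog_mult by (auto simp: dd_mult homog_bar intro!: homog_add homog_diff)
qed (auto simp: homog_zero homog_theta dd_add homog_add)

definition is_form :: "'k::field endo \<Rightarrow> bool" where
  "is_form z \<longleftrightarrow> (\<exists>x y. homog False x \<and> homog True y \<and> z = x + y)"

lemma homog_is_form: "homog s x \<Longrightarrow> is_form x"
proof (cases s)
  case True
  moreover assume "homog s x"
  ultimately show ?thesis
    unfolding is_form_def by (intro exI[of _ 0] exI[of _ x]) (simp add: homog_zero)
next
  case False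
  moreover assume "homog s x"
  ultimately show ?thesis
    unfolding is_form_def by (intro exI[of _ x] exI[of _ 0]) (simp add: homog_zero)
qed

lemma is_form_add: "is_form x \<Longrightarrow> is_form y \<Longrightarrow> is_form (x + y)"
proof -
  assume "is_form x" "is_form y"
  then obtain a b c d where "homog False a" "homog True b" "x = a + b" "homog False c" "homog True d" "y = c + d"
    unfolding is_form_def by blast
  then have "homog False (a + c)" "homog True (b + d)" "x + y = (a + c) + (b + d)"
    by (auto intro: homog_add simp: algebra_simps)
  then show ?thesis unfolding is_form_def by blast
qed

lemma is_form_mult: "is_form x \<Longrightarrow> is_form y \<Longrightarrow> is_form (x * y)"
proof -
  assume "is_form x" "is_form y"
  then obtain a b c d where *: "homog False a" "homog True b" "x = a + b" "homog False c" "homog True d" "y = c + d"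
    unfolding is_form_def by blast
  then have "homog False (a * c + b * d)" "homog True (a * d + b * c)"
    by (auto intro!: homog_add intro: homog_mult')
  moreover have "x * y = (a * c + b * d) + (a * d + b * c)" by (simp add: * algebra_simps)
  ultimately show ?thesis unfolding is_form_def by blast
qed

lemma is_form_scale: "is_form x \<Longrightarrow> is_form (scal c * x)"
  by (rule is_form_mult[OF homog_is_form[OF homog_scal]])

lemma is_form_sum: "(\<And>i. i \<in> A \<Longrightarrow> is_form (f i)) \<Longrightarrow> is_form (sum f A)"
  by (induction A rule: infinite_finite_induct) (auto simp: homog_is_form[OF homog_zero] is_form_add)

lemma is_form_even_comm: "homog False b \<Longrightarrow> is_form z \<Longrightarrow> b * z = z * b"
  unfolding is_form_def by (auto simp: algebra_simps homog_even_comm)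

lemma is_form_odd_comm: "homog True b \<Longrightarrow> is_form z \<Longrightarrow> b * z = bar z * b"
proof -
  assume b: "homog True b" and "is_form z"
  then obtain x y where z: "homog False x" "homog True y" "z = x + y" unfolding is_form_def by blast
  have "b * x = x * b" "b * y = - (y * b)" using homog_comm[OF b z(1)] homog_comm[OF b z(2)] by simp_all
  then show ?thesis using z by (simp add: bar_add homog_bar algebra_simps)
qed

subsection \<open>The forms b^(p-1) db modulo exact forms\<close>

lemma mult_power_commute:
  fixes x y :: "'a::monoid_mult"
  assumes "x * y = y * x"
  shows "x ^ n * y = y * x ^ n"
  using assms by (rule power_commuting_commutes)

lemma power_mult_commute:
  fixes x y :: "'a::monoid_mult"
  assumes "x * y = y * x"
  shows "(x * y) ^ n = x ^ n * y ^ n"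
proof (induction n)
  case (Suc n)
  have "(x * y) ^ Suc n = x * (y * x ^ n) * y ^ n" using Suc by (simp add: mult.assoc)
  also have "y * x ^ n = x ^ n * y" using mult_power_commute[OF assms, of n] by simp
  finally show ?case by (simp add: mult.assoc)
qed simp

lemma of_nat_left_commute: "x * (of_nat n * y) = of_nat n * (x * (y :: 'a::semiring_1))"
  by (metis mult.assoc mult_of_nat_commute)

lemma binomial_commute:
  fixes x y :: "'a::ring_1"
  assumes xy: "x * y = y * x"
  shows "(x + y) ^ n = (\<Sum>k\<le>n. of_nat (n choose k) * (x ^ k * y ^ (n - k)))"
proof (induction n)
  case (Suc n)
  let ?f = "\<lambda>n k. of_nat (n choose k) * (x ^ k * y ^ (n - k))"
  have yx: "y * (x ^ k * z) = x ^ k * (y * z)" for k z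
    using mult_power_commute[OF xy, of k] by (metis mult.assoc)
  have "(x + y) ^ Suc n = x * (\<Sum>k\<le>n. ?f n k) + y * (\<Sum>k\<le>n. ?f n k)"
    using Suc by (simp add: distrib_right)
  also have "x * (\<Sum>k\<le>n. ?f n k) = (\<Sum>k\<le>n. of_nat (n choose k) * (x ^ Suc k * y ^ (Suc n - Suc k)))"
    by (simp add: sum_distrib_left of_nat_left_commute mult.assoc)
  also have "y * (\<Sum>k\<le>n. ?f n k) = (\<Sum>k\<le>n. of_nat (n choose k) * (x ^ k * y ^ (Suc n - k)))"
    unfolding sum_distrib_left
  proof (rule sum.cong)
    fix k assume "k \<in> {..n}"
    have "y * ?f n k = of_nat (n choose k) * (y * (x ^ k * y ^ (n - k)))"
      by (rule of_nat_left_commute)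
    then show "y * ?f n k = of_nat (n choose k) * (x ^ k * y ^ (Suc n - k))"
      using \<open>k \<in> {..n}\<close> by (simp add: yx Suc_diff_le)
  qed simp
  also have "\<dots> = y ^ Suc n + (\<Sum>k\<le>n. of_nat (n choose Suc k) * (x ^ Suc k * y ^ (Suc n - Suc k)))"
  proof -
    have "(\<Sum>k\<le>n. of_nat (n choose k) * (x ^ k * y ^ (Suc n - k))) =
        (\<Sum>k\<le>Suc n. of_nat (n choose k) * (x ^ k * y ^ (Suc n - k)))" by (simp add: binomial_eq_0)
    also have "\<dots> = y ^ Suc n + (\<Sum>k\<le>n. of_nat (n choose Suc k) * (x ^ Suc k * y ^ (Suc n - Suc k)))"
      by (subst sum.atMost_Suc_shift) simp
    finally show ?thesis .
  qed
  finally have "(x + y) ^ Suc n = y ^ Suc n +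
      (\<Sum>k\<le>n. of_nat (Suc n choose Suc k) * (x ^ Suc k * y ^ (Suc n - Suc k)))"
    by (simp add: sum.distrib algebra_simps)
  also have "\<dots> = (\<Sum>k\<le>Suc n. ?f (Suc n) k)"
    by (subst sum.atMost_Suc_shift) simp
  finally show ?case .
qed simp

lemma dd_power:
  assumes "homog False b"
  shows "dd (b ^ n) = of_nat n * (b ^ (n - 1) * dd b)"
proof (induction n)
  case (Suc n)
  have "dd b * b ^ n = b ^ n * dd b"
    using homog_even_comm[OF homog_power[OF assms] homog_dd[OF assms], of n] by simp
  then have "dd (b ^ Suc n) = b ^ n * dd b + of_nat n * (b * b ^ (n - 1) * dd b)"
    using Suc homog_bar[OF assms]
    by (simp add: dd_mult of_nat_left_commute mult.assoc)
  also have "of_nat n * (b * b ^ (n - 1) * dd b) = of_nat n * (b ^ n * dd b)"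
    by (cases n) auto
  finally show ?case by (simp add: algebra_simps)
qed simp

text \<open>The integers \<open>(p choose k) div p\<close> are the coefficients of
  \<open>((b + c) ^ p - b ^ p - c ^ p) / p\<close>. The two identities compute its partial
  derivatives; the division by \<open>p\<close> must be done before passing to characteristic
  \<open>p\<close>.\<close>

lemma CHAR_choose_dvd:
  assumes "prime p" "0 < k" "k < p"
  shows "(p choose k) div p * k = (p - 1) choose (k - 1)"
    and "(p choose k) div p * (p - k) = (p - 1) choose k"
proof -
  have d: "p dvd (p choose k)" using assms by (intro dvd_choose_prime) auto
  then obtain q where q: "p choose k = p * q" by blast
  have "p > 0" using assms by auto
  have "k * (p choose k) = p * ((p - 1) choose (k - 1))"
    using assms by (intro times_binomial_minus1_eq)
  then have "p * (q * k) = p * ((p - 1) choose (k - 1))" by (simp add: q mult_ac)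
  then show "(p choose k) div p * k = (p - 1) choose (k - 1)" using \<open>p > 0\<close> by (simp add: q)
  have "(p - k) * (p choose k) = p * ((p - 1) choose k)"
    by (rule binomial_absorb_comp)
  then have "p * (q * (p - k)) = p * ((p - 1) choose k)" by (simp add: q mult_ac)
  then show "(p choose k) div p * (p - k) = (p - 1) choose k" using \<open>p > 0\<close> by (simp add: q)
qed

lemma freshman_endo:
  fixes b c :: "'k::field endo"
  assumes p: "prime CHAR('k)" and bc: "b * c = c * b"
  shows "(b + c) ^ CHAR('k) = b ^ CHAR('k) + c ^ CHAR('k)"
proof -
  let ?p = "CHAR('k)"
  have p0: "?p > 0" using p prime_gt_0_nat by blast
  have z: "of_nat (?p choose k) = (0 :: 'k endo)" if "0 < k" "k < ?p" for k
  proof -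
    have "?p dvd (?p choose k)" using p that by (intro dvd_choose_prime) auto
    then obtain q where "?p choose k = ?p * q" by blast
    then show ?thesis by (simp add: of_nat_CHAR_endo)
  qed
  have "(b + c) ^ ?p = (\<Sum>k\<in>{0, ?p}. of_nat (?p choose k) * (b ^ k * c ^ (?p - k)))"
    unfolding binomial_commute[OF bc]
    by (rule sum.mono_neutral_right) (auto, metis z bot_nat_0.not_eq_extremum le_neq_implies_less mult_zero_left)
  then show ?thesis using p0 by (simp add: add.commute)
qed

text \<open>Formally \<open>x ^ (p - 1) * dx\<close> is \<open>d (x ^ p) / p\<close>. Hence the
  defect of additivity is the differential of \<open>((b + c) ^ p - b ^ p - c ^ p) / p\<close>, a
  polynomial with integer coefficients, which serves as \<open>y\<close>.\<close>

lemma power_form_add: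
  fixes b c :: "'k::field endo"
  assumes p: "prime CHAR('k)" and b: "homog False b" and c: "homog False c"
  shows "\<exists>y. (b + c) ^ (CHAR('k) - Suc 0) * dd (b + c) =
     b ^ (CHAR('k) - Suc 0) * dd b + c ^ (CHAR('k) - Suc 0) * dd c + dd y"
proof -
  let ?p = "CHAR('k)"
  have p0: "?p > 0" using p prime_gt_0_nat by blast
  have bc: "b * c = c * b" by (rule homog_even_comm[OF b c])
  define y where "y = (\<Sum>k\<in>{1..<?p}. of_nat ((?p choose k) div ?p) * (b ^ k * c ^ (?p - k)))"
  have trm: "dd (of_nat ((?p choose k) div ?p) * (b ^ k * c ^ (?p - k))) =
      of_nat ((?p - 1) choose (k - 1)) * (b ^ (k - 1) * c ^ (?p - k)) * dd b +
      of_nat ((?p - 1) choose k) * (b ^ k * c ^ (?p - 1 - k)) * dd c" if k: "k \<in> {1..<?p}" for k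
  proof -
    let ?q = "of_nat ((?p choose k) div ?p) :: 'k endo"
    define l where "l = ?p - k"
    have l: "?p - 1 - k = l - 1" by (simp add: l_def)
    have "dd b * c ^ l = c ^ l * dd b"
      using homog_even_comm[OF homog_power[OF c] homog_dd[OF b]] by simp
    then have "dd (b ^ k * c ^ l) = of_nat k * (b ^ (k - 1) * c ^ l * dd b) +
        b ^ k * (of_nat l * (c ^ (l - 1) * dd c))"
      by (simp add: dd_mult dd_power b c homog_bar[OF homog_power[OF b]] mult.assoc)
    also have "b ^ k * (of_nat l * (c ^ (l - 1) * dd c)) = of_nat l * (b ^ k * c ^ (l - 1) * dd c)"
      by (simp add: of_nat_left_commute mult.assoc)
    finally have "dd (?q * (b ^ k * c ^ l)) =
        of_nat ((?p choose k) div ?p * k) * (b ^ (k - 1) * c ^ l * dd b) +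
        of_nat ((?p choose k) div ?p * l) * (b ^ k * c ^ (l - 1) * dd c)"
      unfolding of_nat_mult
      by (simp add: dd_mult distrib_left mult.assoc scal_of_nat[symmetric])
    then have "dd (?q * (b ^ k * c ^ l)) =
        of_nat ((?p - 1) choose (k - 1)) * (b ^ (k - 1) * c ^ l) * dd b +
        of_nat ((?p - 1) choose k) * (b ^ k * c ^ (l - 1)) * dd c"
      using CHAR_choose_dvd[OF p, of k] k by (simp only: l_def mult.assoc) auto
    then show ?thesis unfolding l by (simp add: l_def)
  qed
  have s1: "(\<Sum>k\<in>{1..<?p}. of_nat ((?p - 1) choose (k - 1)) * (b ^ (k - 1) * c ^ (?p - k))) =
      (b + c) ^ (?p - 1) - b ^ (?p - 1)"
  proof -
    have "(\<Sum>k\<in>{1..<?p}. of_nat ((?p - 1) choose (k - 1)) * (b ^ (k - 1) * c ^ (?p - k))) =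
      (\<Sum>k<?p - 1. of_nat ((?p - 1) choose k) * (b ^ k * c ^ (?p - 1 - k)))"
      by (rule sum.reindex_bij_witness[of _ Suc "\<lambda>k. k - 1"]) auto
    moreover have "(b + c) ^ (?p - 1) = (\<Sum>k<?p - 1. of_nat ((?p - 1) choose k) * (b ^ k * c ^ (?p - 1 - k))) + b ^ (?p - 1)"
      unfolding binomial_commute[OF bc] by (simp add: lessThan_Suc_atMost[symmetric])
    ultimately show ?thesis by simp
  qed
  have s2: "(\<Sum>k\<in>{1..<?p}. of_nat ((?p - 1) choose k) * (b ^ k * c ^ (?p - 1 - k))) =
      (b + c) ^ (?p - 1) - c ^ (?p - 1)"
  proof -
    have "{..?p - 1} = insert 0 {1..<?p}" using p0 by auto
    then have "(b + c) ^ (?p - 1) = c ^ (?p - 1) + (\<Sum>k\<in>{1..<?p}. of_nat ((?p - 1) choose k) * (b ^ k * c ^ (?p - 1 - k)))"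
      unfolding binomial_commute[OF bc] by simp
    then show ?thesis by simp
  qed
  have "dd y = (\<Sum>k\<in>{1..<?p}. of_nat ((?p - 1) choose (k - 1)) * (b ^ (k - 1) * c ^ (?p - k)) * dd b +
      of_nat ((?p - 1) choose k) * (b ^ k * c ^ (?p - 1 - k)) * dd c)"
    unfolding y_def dd_sum by (rule sum.cong[OF refl]) (rule trm[unfolded One_nat_def[symmetric]])
  also have "\<dots> = ((b + c) ^ (?p - 1) - b ^ (?p - 1)) * dd b + ((b + c) ^ (?p - 1) - c ^ (?p - 1)) * dd c"
    by (simp only: sum.distrib sum_distrib_right[symmetric] s1 s2)
  finally have dy: "dd y = \<dots>" .
  have generic_point: "X * (B + C) = P * B + Q * C + ((X - P) * B + (X - Q) * C)" for X P Q B C :: "'k endo"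
    by (simp add: algebra_simps)
  have "(b + c) ^ (?p - 1) * dd (b + c) = b ^ (?p - 1) * dd b + c ^ (?p - 1) * dd c + dd y"
    unfolding dy dd_add by (rule generic_point)
  then show ?thesis unfolding One_nat_def by (rule exI[of _ y])
qed

text \<open>Modulo exact forms, \<open>b \<mapsto> b ^ (p - 1) * db\<close> is additive on nilpotent even forms and kills
products of nilpotent elements, so that only the linear part of \<open>b\<close> survives
(inverse Cartier operator). Hence substituting arbitrary even forms for the variables in a product of
\<open>n\<close> factors \<open>x ^ (p - 1) * dx\<close> produces, up to exact forms, a form of degree at most \<open>n\<close>.\<close>

inductive cartier1 :: "'k::field endo \<Rightarrow> bool" where
  cartier1_0: "cartier1 0"
| cartier1_generator: "cartier1 (tvar j ^ (CHAR('k) - Suc 0) * (theta j :: 'k endo))"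
| cartier1_scale: "cartier1 q \<Longrightarrow> cartier1 (scal c * q)"
| cartier1_add: "cartier1 q \<Longrightarrow> cartier1 r \<Longrightarrow> cartier1 (q + r)"

inductive cartier :: "nat \<Rightarrow> 'k::field endo \<Rightarrow> bool" where
  cartier_scal: "cartier n (scal c)"
| cartier_step: "cartier n q \<Longrightarrow> cartier (Suc n) (q * (tvar j ^ (CHAR('k) - Suc 0) * (theta j :: 'k endo)))"
| cartier_add: "cartier n q \<Longrightarrow> cartier n r \<Longrightarrow> cartier n (q + r)"

definition cartier_exact :: "nat \<Rightarrow> 'k::field endo \<Rightarrow> bool" where
  "cartier_exact n z \<longleftrightarrow> (\<exists>y q. cartier n q \<and> z = dd y + q)"

text \<open>The elements that may replace a variable \<open>t_i\<close>. The vanishing power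
  respects the truncation; the last condition controls \<open>t_i ^ (p - 1) * dt_i\<close>, the one
  power that has no primitive.\<close>

definition nilcartier :: "'k::field endo \<Rightarrow> bool" where
  "nilcartier b \<longleftrightarrow> homog False b \<and> b ^ CHAR('k) = 0 \<and>
    (\<exists>y q. cartier1 q \<and> b ^ (CHAR('k) - Suc 0) * dd b = dd y + q)"

lemma cartier_0: "cartier n 0"
  using cartier_scal[of n 0] by simp

lemma cartier_scale: "cartier n q \<Longrightarrow> cartier n (scal c * q)"
proof (induction rule: cartier.induct)
  case (cartier_scal n d)
  then show ?case by (metis scal_mult cartier.cartier_scal)
next
  case (cartier_step n q j)
  then show ?case using cartier.cartier_step[of n "scal c * q" j] by (simp add: mult.assoc)
qed (simp add: distrib_left cartier_add)

lemma cartier_Suc: "cartier n q \<Longrightarrow> cartier (Suc n) q"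
  by (induction rule: cartier.induct) (auto intro: cartier.intros)

lemma cartier_mult_cartier1: "cartier1 r \<Longrightarrow> cartier n q \<Longrightarrow> cartier (Suc n) (q * r)"
proof (induction rule: cartier1.induct)
  case (cartier1_scale r c)
  then show ?case by (simp add: scal_left_commute[of q] cartier_scale)
qed (auto simp: distrib_left cartier_0 intro: cartier.intros)

lemma dd_cartier1_generator: "dd (tvar j ^ n * theta j) = (0 :: 'k::field endo)"
  by (simp add: dd_mult dd_power[OF homog_tvar] theta_sq mult.assoc)

lemma cartier1_dd: "cartier1 q \<Longrightarrow> dd q = 0"
  by (induction rule: cartier1.induct) (auto simp: dd_add dd_scal_mult dd_cartier1_generator)

lemma cartier_dd: "cartier n q \<Longrightarrow> dd q = 0"
  by (induction rule: cartier.induct) (auto simp: dd_add dd_mult[of _ "_ * _"] dd_cartier1_generator)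

lemma cartier_exact_dd: "cartier_exact n (dd y)"
  unfolding cartier_exact_def using cartier_0 by (metis add.right_neutral)

lemma cartier_exact_Suc: "cartier_exact n z \<Longrightarrow> cartier_exact (Suc n) z"
  unfolding cartier_exact_def using cartier_Suc by blast

lemma cartier_exact_scal: "cartier_exact n (scal c)"
  unfolding cartier_exact_def using cartier_scal by (metis add.left_neutral dd_0)

lemma cartier_exact_add: "cartier_exact n z \<Longrightarrow> cartier_exact n w \<Longrightarrow> cartier_exact n (z + w)"
proof -
  assume "cartier_exact n z" "cartier_exact n w"
  then obtain y q y' q' where "cartier n q" "cartier n q'" "z = dd y + q" "w = dd y' + q'"
    unfolding cartier_exact_def by blast
  then have "cartier n (q + q')" "z + w = dd (y + y') + (q + q')"
    by (auto intro: cartier_add simp: dd_add algebra_simps)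
  then show ?thesis unfolding cartier_exact_def by blast
qed

lemma cartier_exact_sum: "(\<And>i. i \<in> A \<Longrightarrow> cartier_exact n (f i)) \<Longrightarrow> cartier_exact n (sum f A)"
  by (induction A rule: infinite_finite_induct) (auto intro: cartier_exact_add simp: cartier_exact_scal[of n 0, simplified])

text \<open>Both factors are closed, so by the Leibniz rule \<open>dd y * w\<close> and
  \<open>q * dd y'\<close> are exact, with primitives \<open>y * w\<close> and
  \<open>bar q * y'\<close>. Only \<open>q * q'\<close> remains, with one factor more.\<close>

lemma cartier_exact_mult:
  fixes z w :: "'k::field endo"
  assumes two: "(2::'k) \<noteq> 0" and z: "cartier_exact n z" and w: "w = dd y' + q'" and q': "cartier1 q'"
  shows "cartier_exact (Suc n) (z * w)"
proof -
  obtain y q where q: "cartier n q" and z: "z = dd y + q" using z unfolding cartier_exact_def by blast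
  have "dd w = 0" using two q' by (simp add: w dd_add cartier1_dd)
  then have 1: "dd (y * w) = dd y * w" by (simp add: dd_mult)
  have "dd (bar q) = 0" using bar_dd[of q] cartier_dd[OF q] by simp
  then have 2: "dd (bar q * y') = q * dd y'" by (simp add: dd_mult)
  have "z * w = dd (y * w + bar q * y') + q * q'"
    by (simp add: dd_add 1 2) (simp add: z w algebra_simps)
  then show ?thesis using cartier_mult_cartier1[OF q' q] unfolding cartier_exact_def by blast
qed

lemma nilcartier_0: "CHAR('k::field) > 0 \<Longrightarrow> nilcartier (0 :: 'k endo)"
  unfolding nilcartier_def using cartier1_0 by (auto simp: homog_zero zero_power intro!: exI[of _ 0])

lemma nilcartier_tvar: "CHAR('k::field) > 0 \<Longrightarrow> nilcartier (tvar i :: 'k endo)"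
proof -
  assume p: "CHAR('k) > 0"
  have "tvar i ^ (CHAR('k) - Suc 0) * dd (tvar i) = dd 0 + tvar i ^ (CHAR('k) - Suc 0) * (theta i :: 'k endo)" by simp
  then show ?thesis unfolding nilcartier_def using cartier1_generator[of i, where 'k='k] homog_tvar tvar_CHAR[OF p] by metis
qed

lemma nilcartier_add:
  fixes b c :: "'k::field endo"
  assumes p: "prime CHAR('k)" and b: "nilcartier b" and c: "nilcartier c"
  shows "nilcartier (b + c)"
proof -
  let ?p = "CHAR('k)"
  have o: "homog False b" "homog False c" using b c by (auto simp: nilcartier_def)
  obtain y q y' q' where kq: "cartier1 q" "cartier1 q'"
    and eq: "b ^ (?p - Suc 0) * dd b = dd y + q" "c ^ (?p - Suc 0) * dd c = dd y' + q'"
    using b c unfolding nilcartier_def by blast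
  obtain z where z: "(b + c) ^ (?p - Suc 0) * dd (b + c) = b ^ (?p - Suc 0) * dd b + c ^ (?p - Suc 0) * dd c + dd z"
    using power_form_add[OF p o] by blast
  note z
  also have "b ^ (?p - Suc 0) * dd b + c ^ (?p - Suc 0) * dd c + dd z = dd (y + y' + z) + (q + q')"
    unfolding eq by (simp add: dd_add algebra_simps)
  finally have "(b + c) ^ (?p - Suc 0) * dd (b + c) = dd (y + y' + z) + (q + q')" .
  moreover have "(b + c) ^ ?p = 0"
    using freshman_endo[OF p homog_even_comm[OF o]] b c by (simp add: nilcartier_def)
  ultimately show ?thesis
    unfolding nilcartier_def using homog_add[OF o] cartier1_add[OF kq] by blast
qed

lemma nilcartier_scale:
  fixes b :: "'k::field endo"
  assumes b: "nilcartier b"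
  shows "nilcartier (scal c * b)"
proof -
  let ?p = "CHAR('k)"
  have o: "homog False b" using b by (auto simp: nilcartier_def)
  obtain y q where kq: "cartier1 q" and eq: "b ^ (?p - Suc 0) * dd b = dd y + q"
    using b unfolding nilcartier_def by blast
  have sp: "scal c ^ n = scal (c ^ n)" for n by (induction n) (simp_all add: scal_mult)
  have pw: "(scal c * b) ^ n = scal (c ^ n) * b ^ n" for n
    by (simp only: power_mult_commute[OF scal_comm] sp)
  have "scal (c ^ (?p - Suc 0)) * b ^ (?p - Suc 0) * (scal c * dd b) = scal (c ^ (?p - Suc 0)) * (scal c * (b ^ (?p - Suc 0) * dd b))"
    by (simp only: mult.assoc scal_left_commute[of "b ^ (?p - Suc 0)" c])
  also have "\<dots> = scal (c ^ (?p - Suc 0) * c) * (b ^ (?p - Suc 0) * dd b)" by (simp add: scal_mult mult.assoc)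
  finally have "(scal c * b) ^ (?p - Suc 0) * dd (scal c * b) = dd (scal (c ^ (?p - Suc 0) * c) * y) + scal (c ^ (?p - Suc 0) * c) * q"
    by (simp add: pw dd_scal_mult eq distrib_left)
  moreover have "(scal c * b) ^ ?p = 0" using b by (simp add: pw nilcartier_def)
  ultimately show ?thesis
    unfolding nilcartier_def using homog_scale[OF o] cartier1_scale[OF kq] by blast
qed

text \<open>In \<open>(b * c) ^ (p - 1) * d (b * c)\<close> one Leibniz term contains
  \<open>c ^ p\<close> and the other \<open>b ^ p\<close>, so both vanish.\<close>

lemma nilcartier_mult:
  fixes b c :: "'k::field endo"
  assumes p: "CHAR('k) > 0" and b: "nilcartier b" and c: "nilcartier c"
  shows "nilcartier (b * c)"
proof -
  let ?p = "CHAR('k)"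
  have o: "homog False b" "homog False c" using b c by (auto simp: nilcartier_def)
  have bc: "b * c = c * b" by (rule homog_even_comm[OF o])
  have z: "b ^ ?p = 0" "c ^ ?p = 0" using b c by (auto simp: nilcartier_def)
  have S: "x ^ (?p - Suc 0) * x = x ^ ?p" for x :: "'k endo" using power_minus_mult[OF p, of x] by simp
  have "b ^ (?p - Suc 0) * c ^ (?p - Suc 0) * (dd b * c) = b ^ (?p - Suc 0) * (c ^ (?p - Suc 0) * c) * dd b"
    using homog_even_comm[OF o(2) homog_dd[OF o(1)]] by (simp only: mult.assoc)
  moreover have "c ^ (?p - Suc 0) * (b * x) = b * (c ^ (?p - Suc 0) * x)" for x
    by (simp only: mult.assoc[symmetric] mult_power_commute[OF bc[symmetric]])
  then have "b ^ (?p - Suc 0) * c ^ (?p - Suc 0) * (b * dd c) = (b ^ (?p - Suc 0) * b) * c ^ (?p - Suc 0) * dd c"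
    by (simp only: mult.assoc)
  ultimately have "(b * c) ^ (?p - Suc 0) * dd (b * c) = 0"
    by (simp add: power_mult_commute[OF bc] dd_mult homog_bar[OF o(1)] distrib_left S z)
  moreover have "(b * c) ^ ?p = 0" by (simp add: power_mult_commute[OF bc] z)
  ultimately show ?thesis
    unfolding nilcartier_def using homog_mult[OF o] cartier1_0 by (auto intro!: exI[of _ 0])
qed

text \<open>The square of \<open>b * c\<close> contains \<open>b * b = 0\<close> after one
  interchange, and \<open>p > 2\<close> gives \<open>p - 1 \<ge> 2\<close>. So
  \<open>(b * c) ^ (p - 1)\<close> is already zero.\<close>

lemma nilcartier_odd_mult:
  fixes b c :: "'k::field endo"
  assumes p: "CHAR('k) > 2" and two: "(2::'k) \<noteq> 0" and b: "homog True b" and c: "homog True c"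
  shows "nilcartier (b * c)"
proof -
  let ?p = "CHAR('k)"
  have cb: "c * b = - (b * c)" using homog_comm[OF c b] by simp
  have bb: "b * b = 0" by (rule homog_odd_sq[OF b two])
  have "b * c * (b * c) = b * (c * b) * c" by (simp only: mult.assoc)
  also have "\<dots> = - (b * b * c * c)" by (simp only: cb mult.assoc mult_minus_left mult_minus_right)
  finally have sq: "(b * c) * (b * c) = 0" by (simp only: bb mult_zero_left minus_zero)
  have "(b * c) ^ n = 0" if "n \<ge> 2" for n
  proof -
    have "n = 2 + (n - 2)" using that by simp
    then have "(b * c) ^ n = (b * c) ^ 2 * (b * c) ^ (n - 2)" by (metis power_add)
    also have "(b * c) ^ 2 = (b * c) * (b * c)" by (rule power2_eq_square)
    finally show ?thesis by (simp only: sq mult_zero_left)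
  qed
  moreover have "?p \<ge> 2" "?p - Suc 0 \<ge> 2" using p by auto
  ultimately show ?thesis
    unfolding nilcartier_def using homog_mult[OF b c] cartier1_0 by (auto intro!: exI[of _ 0])
qed

text \<open>Odd factors of an even product come in pairs, whose product is nilpotent; for two even
  factors the products are expanded. The parity is kept as a variable so that the induction passes
  through odd elements too.\<close>

lemma even_decomp:
  fixes z :: "'k::field endo"
  assumes p: "prime CHAR('k)" "CHAR('k) > 2" and two: "(2::'k) \<noteq> 0"
  shows "homog s z \<Longrightarrow> \<not> s \<Longrightarrow> \<exists>c b. nilcartier b \<and> z = scal c + b"
proof (induction rule: homog.induct)
  case (homog_scal c)
  then show ?case using nilcartier_0[where 'k='k] p by (intro exI[of _ c] exI[of _ 0]) auto
next
  case (homog_tvar i)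
  then show ?case using nilcartier_tvar[where 'k='k, of i] p by (intro exI[of _ 0] exI[of _ "tvar i"]) auto
next
  case (homog_add s x y)
  then obtain c b c' b' where *: "nilcartier b" "x = scal c + b" "nilcartier b'" "y = scal c' + b'" by blast
  have "x + y = scal (c + c') + (b + b')" by (simp add: * scal_add algebra_simps)
  then show ?case using nilcartier_add[OF p(1) *(1,3)] by blast
next
  case (homog_mult s x t y)
  show ?case
  proof (cases s)
    case True
    then have "nilcartier (x * y)" using homog_mult.prems homog_mult.hyps nilcartier_odd_mult[OF p(2) two] by auto
    then show ?thesis by (intro exI[of _ 0] exI[of _ "x * y"]) simp
  next
    case False
    then obtain c b c' b' where *: "nilcartier b" "x = scal c + b" "nilcartier b'" "y = scal c' + b'"
      using homog_mult by blast
    have "x * y = scal (c * c') + (scal c * b' + scal c' * b + b * b')"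
      by (simp add: * distrib_left distrib_right scal_mult scal_comm[of c' b] add_ac)
    moreover have "nilcartier (scal c * b' + scal c' * b + b * b')"
      using p * by (intro nilcartier_add nilcartier_scale nilcartier_mult) auto
    ultimately show ?thesis by (intro exI conjI)
  qed
qed auto

subsection \<open>The top coefficient\<close>

text \<open>The top coefficient vanishes on exact forms because \<open>d\<close> creates the exponent \<open>p - 1\<close> only
with the factor \<open>p = 0\<close>.\<close>

definition top_exp :: "nat \<Rightarrow> nat \<Rightarrow> nat \<Rightarrow> nat" where
  "top_exp q m = (\<lambda>i. if i < m then q else 0)"

definition top_coeff :: "nat \<Rightarrow> 'k::field endo \<Rightarrow> 'k" where
  "top_coeff m z = app z vacuum (top_exp (CHAR('k) - Suc 0) m) {..<m}"

lemma top_coeff_add: "top_coeff m (x + y) = top_coeff m x + top_coeff m y"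
  by (simp add: top_coeff_def app_plus)

lemma top_coeff_scal: "top_coeff m (scal c * y) = c * top_coeff m y"
  by (simp add: top_coeff_def app_times app_scal)

lemma top_coeff_dd:
  assumes "CHAR('k) > 0"
  shows "top_coeff m (dd y) = (0 :: 'k::field)"
proof -
  let ?a = "top_exp (CHAR('k) - Suc 0) m"
  have admissible: "admissible TYPE('k) ?a" using assms by (auto simp: admissible_def top_exp_def)
  have "top_coeff m (dd y) = app D (app y vacuum) ?a {..<m} - app (bar y) (app D vacuum) ?a {..<m}"
    by (simp add: top_coeff_def dd_def app_minus app_times)
  \<comment> \<open>\<open>D\<close> kills the form \<open>1\<close>, so only the first half of the
    supercommutator contributes. Then every summand of \<open>dform\<close> carries the factor
    \<open>p = 0\<close>.\<close>
  also have "\<dots> = dform (app y vacuum) ?a {..<m}" using admissible by (simp add: app_D app_D_vacuum app_zero)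
  also have "\<dots> = 0"
    unfolding dform_def using assms
    by (intro sum.neutral) (simp add: top_exp_def del: of_nat_Suc)
  finally show ?thesis .
qed

lemma admissible_diff: "admissible TYPE('k::field) a \<Longrightarrow> admissible TYPE('k) (a(i := a i - n))"
  by (auto simp: admissible_def less_imp_diff_less)

text \<open>Each factor raises the degree by at most one. The form \<open>v\<close> and its degree
  bound \<open>s\<close> are arbitrary because the rightmost factor of a product acts first.\<close>

lemma cartier_degree:
  fixes q :: "'k::field endo"
  assumes "cartier n q" "\<And>a U. s < card U \<Longrightarrow> v a U = 0" "s + n < card U"
  shows "app q v a U = 0"
  using assms
proof (induction arbitrary: v s a U rule: cartier.induct)
  case (cartier_scal n c)
  then show ?case by (simp add: app_scal truncate_def)
next
  case (cartier_step n q j)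
  have "app (tvar j ^ (CHAR('k) - Suc 0)) (app (theta j) v) a U = 0" if "Suc s < card U" for a U
  proof (cases "admissible TYPE('k) a \<and> finite U")
    case True
    then have "admissible TYPE('k) (a(j := a j - (CHAR('k) - Suc 0)))"
      by (blast intro: admissible_diff)
    then show ?thesis using True that cartier_step.prems(1) by (auto simp: app_tvar_power app_theta)
  qed (simp add: app_not_admissible)
  from cartier_step.IH[of "Suc s", OF this] show ?case
    using cartier_step.prems(2) by (simp add: app_times)
next
  case (cartier_add n q r)
  have "app q v a U = 0" "app r v a U = 0"
    by (rule cartier_add.IH[of s]; use cartier_add.prems in blast)+
  then show ?case by (simp add: app_plus)
qed

lemma top_coeff_cartier_exact:
  fixes z :: "'k::field endo"
  assumes "cartier_exact n z" "n < m" "CHAR('k) > 0"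
  shows "top_coeff m z = 0"
proof -
  obtain y q where q: "cartier n q" and z: "z = dd y + q" using assms(1) unfolding cartier_exact_def by blast
  have "app q vacuum (top_exp (CHAR('k) - Suc 0) m) {..<m} = 0"
  proof (rule cartier_degree[OF q, of 0])
    show "vacuum a U = (0::'k)" if "0 < card U" for a U using that by (auto simp: vacuum_def)
  qed (use assms in simp)
  then have "top_coeff m q = 0" by (simp add: top_coeff_def)
  then show ?thesis unfolding z top_coeff_add top_coeff_dd[OF assms(3)] by simp
qed

subsection \<open>Evaluations of the free algebra\<close>

definition fa_w :: "nat list \<Rightarrow> nat list \<Rightarrow> 'k::field" where
  "fa_w u = (\<lambda>w. if w = u then 1 else 0)"

lemma fa_one_w: "fa_one = fa_w []"
  by (simp add: fa_one_def fa_w_def)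

lemma FA_0: "(\<lambda>_. 0) \<in> FA"
  by (simp add: FA_def)

lemma FA_add: "f \<in> FA \<Longrightarrow> g \<in> FA \<Longrightarrow> (\<lambda>w. f w + g w) \<in> FA"
  unfolding FA_def
  by (auto intro: finite_subset[of _ "{w. f w \<noteq> 0} \<union> {w. g w \<noteq> 0}"])

lemma FA_scale: "f \<in> FA \<Longrightarrow> (\<lambda>w. c * f w) \<in> FA"
  unfolding FA_def by (auto intro: finite_subset[of _ "{w. f w \<noteq> 0}"])

lemma FA_w: "fa_w u \<in> FA"
  by (simp add: FA_def fa_w_def)

lemma FA_one: "fa_one \<in> FA"
  by (simp add: fa_one_w FA_w)

lemma FA_induct [consumes 1, case_names zero add]:
  assumes "f \<in> FA" "P (\<lambda>_. 0)"
    and "\<And>g c w. g \<in> FA \<Longrightarrow> f w \<noteq> 0 \<Longrightarrow> P g \<Longrightarrow> P (\<lambda>y. g y + c * fa_w w y)"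
  shows "P f"
  using assms(1) unfolding FA_def mem_Collect_eq
proof (induction f rule: finsupp_induct)
  case (add g x c)
  then show ?case using assms(3)[of g x c] by (simp add: FA_def fa_w_def)
qed (rule assms(2))

lemma finite_splits: "finite {(u, v). u @ v = w}"
proof (rule finite_subset)
  show "{(u, v). u @ v = w} \<subseteq> (\<lambda>n. (take n w, drop n w)) ` {..length w}"
  proof clarify
    fix u v assume "w = u @ v"
    then show "(u, v) \<in> (\<lambda>n. (take n (u @ v), drop n (u @ v))) ` {..length (u @ v)}"
      by (intro image_eqI[of _ _ "length u"]) auto
  qed
qed simp

lemma fa_mult_w: "fa_mult (fa_w u) (fa_w v) = (fa_w (u @ v) :: nat list \<Rightarrow> 'k::field)"
proof
  fix w
  have "fa_mult (fa_w u) (fa_w v) w =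
      (\<Sum>z\<in>{(a, b). a @ b = w}. if z = (u, v) then 1 else (0::'k))"
    unfolding fa_mult_def by (rule sum.cong) (auto simp: fa_w_def split: if_splits)
  also have "\<dots> = fa_w (u @ v) w"
    using finite_splits[of w] by (auto simp: fa_w_def)
  finally show "fa_mult (fa_w u) (fa_w v) w = (fa_w (u @ v) w :: 'k)" .
qed

lemma fa_mult_add_left: "fa_mult (\<lambda>w. f w + g w) h = (\<lambda>w. fa_mult f h w + fa_mult g h w)"
  and fa_mult_add_right: "fa_mult h (\<lambda>w. f w + g w) = (\<lambda>w. fa_mult h f w + fa_mult h g w)"
  and fa_mult_scale_left: "fa_mult (\<lambda>w. c * f w) h = (\<lambda>w. c * fa_mult f h w)"
  and fa_mult_scale_right: "fa_mult h (\<lambda>w. c * f w) = (\<lambda>w. c * fa_mult h f w)"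
  by (auto simp: fa_mult_def fun_eq_iff split_def algebra_simps sum.distrib sum_distrib_left)

lemma fa_mult_0_left: "fa_mult (\<lambda>_. 0) h = (\<lambda>_. 0)"
  and fa_mult_0_right: "fa_mult h (\<lambda>_. 0) = (\<lambda>_. 0)"
  by (auto simp: fa_mult_def)

lemma fa_mult_FA:
  assumes "f \<in> FA" "g \<in> FA"
  shows "fa_mult f g \<in> FA"
  using assms(1)
proof (induction rule: FA_induct)
  case (add f' c u)
  have "fa_mult (fa_w u) g \<in> FA"
    using assms(2)
    by (induction rule: FA_induct)
      (simp_all add: fa_mult_add_right fa_mult_scale_right fa_mult_0_right fa_mult_w FA_0 FA_add FA_scale FA_w)
  then show ?case using add by (simp add: fa_mult_add_left fa_mult_scale_left FA_add FA_scale)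
qed (simp add: fa_mult_0_left FA_0)

definition fa_eval :: "(nat \<Rightarrow> 'k endo) \<Rightarrow> (nat list \<Rightarrow> 'k::field) \<Rightarrow> 'k endo" where
  "fa_eval y f = (\<Sum>w\<in>{w. f w \<noteq> 0}. scal (f w) * prod_list (map y w))"

lemma fa_eval_superset:
  assumes "finite A" "{w. f w \<noteq> 0} \<subseteq> A"
  shows "fa_eval y f = (\<Sum>w\<in>A. scal (f w) * prod_list (map y w))"
  unfolding fa_eval_def using assms by (intro sum.mono_neutral_left) auto

lemma fa_eval_0: "fa_eval y (\<lambda>_. 0) = 0"
  by (simp add: fa_eval_def)

lemma fa_eval_add:
  assumes "f \<in> FA" "g \<in> FA"
  shows "fa_eval y (\<lambda>w. f w + g w) = fa_eval y f + fa_eval y g"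
proof -
  let ?A = "{w. f w \<noteq> 0} \<union> {w. g w \<noteq> 0}"
  have A: "finite ?A" using assms by (simp add: FA_def)
  then show ?thesis
    by (subst (1 2 3) fa_eval_superset[OF A]) (auto simp: sum.distrib scal_add distrib_right)
qed

lemma fa_eval_scale:
  assumes "f \<in> FA"
  shows "fa_eval y (\<lambda>w. c * f w) = scal c * fa_eval y f"
proof -
  have A: "finite {w. f w \<noteq> 0}" using assms by (simp add: FA_def)
  show ?thesis
    by (subst (1 2) fa_eval_superset[OF A]) (auto simp: sum_distrib_left scal_mult mult.assoc)
qed

lemma fa_eval_w: "fa_eval y (fa_w w) = prod_list (map y w)"
  by (subst fa_eval_superset[of "{w}"]) (auto simp: fa_w_def)

lemma fa_eval_one: "fa_eval y fa_one = 1"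
  by (simp add: fa_one_w fa_eval_w)

lemma fa_eval_mult:
  assumes "f \<in> FA" "g \<in> FA"
  shows "fa_eval y (fa_mult f g) = fa_eval y f * fa_eval y g"
  using assms(1)
proof (induction rule: FA_induct)
  case (add f' c u)
  have "fa_eval y (fa_mult (fa_w u) g) = fa_eval y (fa_w u) * fa_eval y g"
    using assms(2)
  proof (induction rule: FA_induct)
    case (add g' d v)
    then show ?case
      by (simp add: fa_mult_add_right fa_mult_scale_right fa_mult_w fa_eval_add fa_eval_scale FA_scale FA_w
          fa_mult_FA fa_eval_w distrib_left scal_left_commute[of "prod_list (map y u)" d])
  qed (simp add: fa_mult_0_right fa_eval_0)
  then show ?case using add assms(2)
    by (simp add: fa_mult_add_left fa_mult_scale_left fa_eval_add fa_eval_scale FA_scale FA_w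
        fa_mult_FA distrib_right mult.assoc)
qed (simp add: fa_mult_0_left fa_eval_0)

text \<open>The unital homomorphisms into the operator ring. One uniqueness lemma for them covers
  both an evaluation after an endomorphism and \<open>iota\<close> after a homomorphism to the
  Grassmann algebra.\<close>

definition fa_rep :: "((nat list \<Rightarrow> 'k::field) \<Rightarrow> 'k endo) \<Rightarrow> bool" where
  "fa_rep \<chi> \<longleftrightarrow>
     (\<forall>f\<in>FA. \<forall>g\<in>FA. \<chi> (\<lambda>x. f x + g x) = \<chi> f + \<chi> g) \<and>
     (\<forall>c. \<forall>f\<in>FA. \<chi> (\<lambda>x. c * f x) = scal c * \<chi> f) \<and>
     (\<forall>f\<in>FA. \<forall>g\<in>FA. \<chi> (fa_mult f g) = \<chi> f * \<chi> g) \<and>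
     \<chi> fa_one = 1"

lemma fa_rep_unique:
  assumes \<chi>: "fa_rep \<chi>" and f: "f \<in> FA"
  shows "\<chi> f = fa_eval (\<lambda>i. \<chi> (fa_w [i])) f"
  using f
proof (induction rule: FA_induct)
  case zero
  have "\<chi> (\<lambda>x. 0 * fa_one x) = scal 0 * \<chi> fa_one" using \<chi> FA_w unfolding fa_rep_def fa_one_w by blast
  then show ?case by (simp add: fa_eval_0)
next
  case (add g c w)
  have "\<chi> (fa_w w) = prod_list (map (\<lambda>i. \<chi> (fa_w [i])) w)"
  proof (induction w)
    case Nil
    then show ?case using \<chi> by (simp add: fa_rep_def fa_one_w)
  next
    case (Cons i w)
    have "\<chi> (fa_mult (fa_w [i]) (fa_w w)) = \<chi> (fa_w [i]) * \<chi> (fa_w w)"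
      using \<chi> FA_w unfolding fa_rep_def by blast
    then show ?case using Cons by (simp add: fa_mult_w)
  qed
  moreover have "\<chi> (\<lambda>y. g y + c * fa_w w y) = \<chi> g + scal c * \<chi> (fa_w w)"
    using \<chi> add.hyps FA_w FA_scale[OF FA_w] unfolding fa_rep_def by metis
  ultimately show ?case using add by (simp add: fa_eval_add fa_eval_scale FA_scale FA_w fa_eval_w)
qed

lemma fa_endoD:
  assumes "fa_endo \<psi>"
  shows "f \<in> FA \<Longrightarrow> \<psi> f \<in> FA"
    and "f \<in> FA \<Longrightarrow> g \<in> FA \<Longrightarrow> \<psi> (\<lambda>x. f x + g x) = (\<lambda>x. \<psi> f x + \<psi> g x)"
    and "f \<in> FA \<Longrightarrow> \<psi> (\<lambda>x. c * f x) = (\<lambda>x. c * \<psi> f x)"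
    and "f \<in> FA \<Longrightarrow> g \<in> FA \<Longrightarrow> \<psi> (fa_mult f g) = fa_mult (\<psi> f) (\<psi> g)"
    and "\<psi> fa_one = fa_one"
  using assms unfolding fa_endo_def unital_alg_hom_def by simp_all

lemma fa_to_GD:
  assumes "fa_to_G \<phi>"
  shows "f \<in> FA \<Longrightarrow> \<phi> f \<in> GR"
    and "f \<in> FA \<Longrightarrow> g \<in> FA \<Longrightarrow> \<phi> (\<lambda>x. f x + g x) = (\<lambda>x. \<phi> f x + \<phi> g x)"
    and "f \<in> FA \<Longrightarrow> \<phi> (\<lambda>x. c * f x) = (\<lambda>x. c * \<phi> f x)"
    and "f \<in> FA \<Longrightarrow> g \<in> FA \<Longrightarrow> \<phi> (fa_mult f g) = gr_mult (\<phi> f) (\<phi> g)"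
    and "\<phi> fa_one = gr_one"
  using assms unfolding fa_to_G_def unital_alg_hom_def by simp_all

lemma fa_eval_endo:
  assumes "fa_endo \<psi>" "f \<in> FA"
  shows "fa_eval y (\<psi> f) = fa_eval (\<lambda>i. fa_eval y (\<psi> (fa_w [i]))) f"
proof -
  have "fa_rep (\<lambda>f. fa_eval y (\<psi> f))"
    by (simp add: fa_rep_def fa_endoD[OF assms(1)] fa_eval_add fa_eval_scale fa_eval_mult fa_eval_one)
  then show ?thesis using fa_rep_unique assms(2) by blast
qed

lemma iota_hom:
  assumes "fa_to_G \<phi>" "f \<in> FA"
  shows "iota (\<phi> f) = fa_eval (\<lambda>i. iota (\<phi> (fa_w [i]))) f"
proof -
  have "fa_rep (\<lambda>f. iota (\<phi> f))"
    by (simp add: fa_rep_def fa_to_GD[OF assms(1)] iota_add iota_scale iota_mult iota_one)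
  then show ?thesis using fa_rep_unique assms(2) by blast
qed

lemma fa_eval_in_iota:
  assumes g: "\<And>i. g i \<in> GR" and f: "f \<in> FA"
  shows "\<exists>h\<in>GR. iota h = fa_eval (\<lambda>i. iota (g i)) f"
  using f
proof (induction rule: FA_induct)
  case zero
  have "(\<lambda>_. 0) \<in> GR" by (simp add: GR_def)
  then show ?case using iota_zero by (auto simp: fa_eval_0)
next
  case (add f' c w)
  have "\<exists>h\<in>GR. iota h = prod_list (map (\<lambda>i. iota (g i)) w)"
  proof (induction w)
    case Nil
    then show ?case using gr_one_GR iota_one by auto
  next
    case (Cons i w)
    then obtain h where "h \<in> GR" "iota h = prod_list (map (\<lambda>i. iota (g i)) w)" by blast
    then have "gr_mult (g i) h \<in> GR" "iota (gr_mult (g i) h) = prod_list (map (\<lambda>i. iota (g i)) (i # w))"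
      by (auto simp: gr_mult_GR g iota_mult)
    then show ?case by blast
  qed
  then obtain h h' where h: "h \<in> GR" "iota h = prod_list (map (\<lambda>i. iota (g i)) w)"
    "h' \<in> GR" "iota h' = fa_eval (\<lambda>i. iota (g i)) f'" using add by blast
  have "(\<lambda>U. h' U + c * h U) \<in> GR" using h by (intro gr_add_GR gr_scale_GR)
  moreover have "iota (\<lambda>U. h' U + c * h U) = fa_eval (\<lambda>i. iota (g i)) (\<lambda>y. f' y + c * fa_w w y)"
    using h add.hyps by (simp add: iota_add iota_scale fa_eval_add fa_eval_scale FA_scale FA_w fa_eval_w)
  ultimately show ?case by blast
qed

text \<open>The evaluation in the operator ring has its values in the image of the injective map
  \<open>iota\<close>. Pulling it back yields the homomorphism, and its laws follow from those of
  the evaluation.\<close>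

lemma hom_exists:
  fixes g :: "nat \<Rightarrow> nat set \<Rightarrow> 'k::field"
  assumes g: "\<And>i. g i \<in> GR"
  shows "\<exists>\<phi>. fa_to_G \<phi> \<and> (\<forall>f\<in>FA. iota (\<phi> f) = fa_eval (\<lambda>i. iota (g i)) f)"
proof -
  let ?E = "fa_eval (\<lambda>i. iota (g i))"
  define \<phi> where "\<phi> f = inv_into GR iota (?E f)" for f
  have 1: "\<phi> f \<in> GR" "iota (\<phi> f) = ?E f" if f: "f \<in> FA" for f
  proof -
    from fa_eval_in_iota[OF g f] obtain h where h: "h \<in> GR" "iota h = ?E f" by (rule bexE)
    have im: "?E f \<in> iota ` GR" using imageI[OF h(1), of iota] unfolding h(2) .
    show "\<phi> f \<in> GR" unfolding \<phi>_def by (rule inv_into_into[OF im])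
    show "iota (\<phi> f) = ?E f" unfolding \<phi>_def by (rule f_inv_into_f[OF im])
  qed
  have 2: "\<phi> f = h" if "f \<in> FA" "h \<in> GR" "iota h = ?E f" for f h
    using iota_inj[of "\<phi> f" h] 1 that by simp
  have "fa_to_G \<phi>"
    unfolding fa_to_G_def unital_alg_hom_def
    by (intro conjI ballI allI; (rule 1 2)?)
      (simp_all add: 1 iota_add iota_scale iota_mult iota_one fa_eval_add fa_eval_scale fa_eval_mult fa_eval_one
        FA_add FA_scale fa_mult_FA gr_add_GR gr_scale_GR gr_mult_GR gr_one_GR FA_one)
  then show ?thesis using 1 by blast
qed

subsection \<open>The image of the Grassmann algebra\<close>

lemma homog_iota_e: "finite S \<Longrightarrow> homog (odd (card S)) (iota (gr_e S) :: 'k::field endo)"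
proof (induction S rule: finite_linorder_max_induct)
  case empty
  then show ?case by (simp add: gr_e_empty iota_one homog_one)
next
  case (insert i S)
  have "iota (gr_e (insert i S)) = iota (gr_mult (gr_e S) (gr_e {i}) :: nat set \<Rightarrow> 'k)"
  proof (rule endo_eqI)
    fix v :: "'k form" and a :: "nat \<Rightarrow> nat" and U :: "nat set"
    assume a: "admissible TYPE('k) a" "finite U"
    have "gr_mult (gr_e S) (gr_e {i}) W = (gr_e (insert i S) W :: 'k)" if "W \<subseteq> U" for W
      using insert finite_subset[OF that a(2)] by (intro gr_mult_e_insert) auto
    then have "gr_mult (gr_e (insert i S)) (v a) U = gr_mult (gr_mult (gr_e S) (gr_e {i})) (v a) U"
      unfolding gr_mult_Pow[OF a(2)] by (intro sum.cong) simp_all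
    then show "app (iota (gr_e (insert i S))) v a U = app (iota (gr_mult (gr_e S) (gr_e {i}))) v a U"
      using a by (simp add: app_iota)
  qed
  then have "iota (gr_e (insert i S)) = iota (gr_e S) * (theta i :: 'k endo)"
    by (simp add: iota_mult iota_single)
  moreover have "i \<notin> S" using insert by auto
  ultimately show ?case using insert homog_mult[OF insert.IH homog_theta[of i]] by simp
qed

lemma gr_fun_induct [consumes 1, case_names zero add]:
  assumes "f \<in> GR" "P (\<lambda>_. 0)"
    and "\<And>g c S. f S \<noteq> 0 \<Longrightarrow> finite S \<Longrightarrow> P g \<Longrightarrow> P (\<lambda>y. g y + c * gr_e S y)"
  shows "P f"
proof -
  have fin: "finite {S. f S \<noteq> 0}" and S: "\<And>S. f S \<noteq> 0 \<Longrightarrow> finite S" using assms(1) by (auto simp: GR_def)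
  show ?thesis using fin
  proof (induction f rule: finsupp_induct)
    case (add g x c)
    then show ?case using assms(3)[of x g c] S by (simp add: gr_e_def)
  qed (rule assms(2))
qed

lemma is_form_iota:
  assumes "g \<in> GR"
  shows "is_form (iota g)"
  using assms
proof (induction rule: gr_fun_induct)
  case zero
  then show ?case by (simp add: iota_zero homog_is_form[OF homog_zero])
next
  case (add h c S)
  then show ?case
    by (simp add: iota_add iota_scale is_form_add is_form_scale homog_is_form[OF homog_iota_e])
qed

lemma homog_iota_even:
  assumes "g \<in> GR" "\<And>S. odd (card S) \<Longrightarrow> g S = 0"
  shows "homog False (iota g)"
  using assms(1)
proof (induction rule: gr_fun_induct)
  case zero
  then show ?case by (simp add: iota_zero homog_zero)
next
  case (add h c S)
  then show ?case
  proof -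
    have "even (card S)" using add(1) assms(2) by blast
    then show ?thesis
      using homog_iota_e[OF add(2), where 'k='a] add(3) by (simp add: iota_add iota_scale homog_add homog_scale)
  qed
qed

lemma centre_even:
  fixes z :: "nat set \<Rightarrow> 'k::field"
  assumes "z \<in> gr_centre" "(2::'k) \<noteq> 0"
  shows "homog False (iota z)"
  using assms gr_centre_odd_coeff[OF assms(1) _ assms(2)]
  by (intro homog_iota_even) (auto simp: gr_centre_def)

lemma even_centre:
  assumes "z \<in> GR" "homog False (iota z)"
  shows "z \<in> gr_centre"
proof -
  have "gr_mult z y = gr_mult y z" if "y \<in> GR" for y
  proof (rule iota_inj)
    show "iota (gr_mult z y) = iota (gr_mult y z)"
      unfolding iota_mult by (rule is_form_even_comm[OF assms(2) is_form_iota[OF that]])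
  qed (use assms that in \<open>auto simp: gr_mult_GR\<close>)
  then show ?thesis using assms(1) by (auto simp: gr_centre_def)
qed

subsection \<open>The T-space of polynomials with central values\<close>

definition central_valued :: "(nat list \<Rightarrow> 'k::field) set" where
  "central_valued = {f \<in> FA. \<forall>\<phi>. fa_to_G \<phi> \<longrightarrow> \<phi> f \<in> gr_centre}"

lemma gr_mult_add_left: "gr_mult (\<lambda>U. a U + b U) c = (\<lambda>U. gr_mult a c U + gr_mult b c U)"
  and gr_mult_add_right: "gr_mult c (\<lambda>U. a U + b U) = (\<lambda>U. gr_mult c a U + gr_mult c b U)"
  and gr_mult_scale_left: "gr_mult (\<lambda>U. d * a U) c = (\<lambda>U. d * gr_mult a c U)"
  and gr_mult_scale_right: "gr_mult c (\<lambda>U. d * a U) = (\<lambda>U. d * gr_mult c a U)"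
  by (auto simp: gr_mult_def fun_eq_iff split_def algebra_simps sum.distrib sum_distrib_left)

lemma gr_centre_add: "a \<in> gr_centre \<Longrightarrow> b \<in> gr_centre \<Longrightarrow> (\<lambda>U. a U + b U) \<in> gr_centre"
  by (simp add: gr_centre_def gr_add_GR gr_mult_add_left gr_mult_add_right)

lemma gr_centre_scale: "a \<in> gr_centre \<Longrightarrow> (\<lambda>U. c * a U) \<in> gr_centre"
  by (simp add: gr_centre_def gr_scale_GR gr_mult_scale_left gr_mult_scale_right)

lemma gr_centre_0: "(\<lambda>_. 0) \<in> gr_centre"
  by (simp add: gr_centre_def GR_def gr_mult_def)

lemma gr_centre_one: "gr_one \<in> gr_centre"
  by (rule even_centre[OF gr_one_GR]) (simp add: iota_one homog_one)

lemma fa_to_G_comp: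
  assumes "fa_to_G \<phi>" "fa_endo \<psi>"
  shows "fa_to_G (\<lambda>f. \<phi> (\<psi> f))"
  unfolding fa_to_G_def unital_alg_hom_def
  by (simp add: fa_endoD[OF assms(2)] fa_to_GD[OF assms(1)])

lemma fa_to_G_0: "fa_to_G \<phi> \<Longrightarrow> \<phi> (\<lambda>_. 0) = (\<lambda>_. 0)"
  using fa_to_GD(3)[OF _ FA_0, of \<phi> 0] by simp

lemma Tspace_central_valued: "Tspace (central_valued :: (nat list \<Rightarrow> 'k::field) set)"
  unfolding Tspace_def central_valued_def
proof (intro conjI ballI allI impI)
  fix \<psi> :: "(nat list \<Rightarrow> 'k) \<Rightarrow> nat list \<Rightarrow> 'k" and f :: "nat list \<Rightarrow> 'k"
  assume \<psi>: "fa_endo \<psi>" and f: "f \<in> {f \<in> FA. \<forall>\<phi>. fa_to_G \<phi> \<longrightarrow> \<phi> f \<in> gr_centre}"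
  then show "\<psi> f \<in> {f \<in> FA. \<forall>\<phi>. fa_to_G \<phi> \<longrightarrow> \<phi> f \<in> gr_centre}"
    using fa_endoD(1)[OF \<psi>] fa_to_G_comp[OF _ \<psi>] by blast
qed (auto simp: FA_0 FA_add FA_scale fa_to_GD gr_centre_add gr_centre_scale gr_centre_0 fa_to_G_0)

lemma Tspace_add: "Tspace V \<Longrightarrow> f \<in> V \<Longrightarrow> g \<in> V \<Longrightarrow> (\<lambda>w. f w + g w) \<in> V"
  and Tspace_scale: "Tspace V \<Longrightarrow> f \<in> V \<Longrightarrow> (\<lambda>w. c * f w) \<in> V"
  by (simp_all add: Tspace_def)

text \<open>The polynomials to be added are the identities of the Grassmann algebra. If
  \<open>f\<close> is one, then \<open>f + 1\<close> and \<open>1\<close> are central polynomials,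
  and \<open>f\<close> is their difference.\<close>

lemma CPG_eq_central_valued: "CPG = (central_valued :: (nat list \<Rightarrow> 'k::field) set)"
proof
  show "CPG \<subseteq> (central_valued :: (nat list \<Rightarrow> 'k) set)"
    unfolding CPG_def Tspan_def using Tspace_central_valued by (auto simp: central_poly_G_def central_valued_def)
next
  show "(central_valued :: (nat list \<Rightarrow> 'k) set) \<subseteq> CPG"
    unfolding CPG_def Tspan_def
  proof safe
    fix f :: "nat list \<Rightarrow> 'k" and V :: "(nat list \<Rightarrow> 'k) set"
    assume f: "f \<in> central_valued" and V: "Tspace V" "{f. central_poly_G f} \<subseteq> V"
    have fFA: "f \<in> FA" using f by (simp add: central_valued_def)
    obtain \<phi>\<^sub>0 :: "(nat list \<Rightarrow> 'k) \<Rightarrow> nat set \<Rightarrow> 'k" where hom: "fa_to_G \<phi>\<^sub>0"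
      using hom_exists[of "\<lambda>_. gr_one"] gr_one_GR by blast
    have one_nz: "gr_one \<noteq> (\<lambda>_. 0 :: 'k)" by (auto simp: gr_one_def fun_eq_iff)
    have one: "central_poly_G (fa_one :: nat list \<Rightarrow> 'k)"
      unfolding central_poly_G_def TG_def
      using hom one_nz FA_one gr_centre_one by (auto simp: fa_to_GD(5))
    show "f \<in> V"
    proof (cases "f \<in> TG")
      case False
      then have "central_poly_G f" using f by (auto simp: central_poly_G_def central_valued_def)
      then show ?thesis using V by auto
    next
      case True
      define g where "g = (\<lambda>w. f w + fa_one w)"
      have gFA: "g \<in> FA" unfolding g_def by (intro FA_add fFA FA_one)
      have gv: "\<phi> g = gr_one" if "fa_to_G \<phi>" for \<phi>
        using True that unfolding g_def fa_to_GD(2)[OF that fFA FA_one] fa_to_GD(5)[OF that]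
        by (simp add: TG_def)
      have "central_poly_G g"
        unfolding central_poly_G_def TG_def using gFA gv hom one_nz gr_centre_one by auto
      then have "g \<in> V" "fa_one \<in> V" using V one by auto
      then have "(\<lambda>w. g w + (-1) * fa_one w) \<in> V" 
        using V(1) by (intro Tspace_add Tspace_scale)
      then show ?thesis by (simp add: g_def)
    qed
  qed
qed

subsection \<open>Substitution into forms\<close>

text \<open>\<open>slice0\<close> and \<open>slice1\<close> are the parts of a form at
  \<open>t_n ^ k\<close> without and with \<open>dt_n\<close>. For indices below \<open>n\<close>
  the factor \<open>dt_n\<close> stands last, so it splits off on the right without a sign.\<close>

definition slice0 :: "nat \<Rightarrow> nat \<Rightarrow> 'k form \<Rightarrow> 'k form" where
  "slice0 n k v = (\<lambda>a U. v (a(n := k)) U)"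

definition slice1 :: "nat \<Rightarrow> nat \<Rightarrow> 'k form \<Rightarrow> 'k form" where
  "slice1 n k v = (\<lambda>a U. v (a(n := k)) (insert n U))"

text \<open>The substitution \<open>t\<^sub>i \<mapsto> b i\<close>, \<open>dt\<^sub>i \<mapsto> \<beta> i\<close>, splitting off the variables from the last one
downwards; only coefficients in the variables below \<open>n\<close> are used.\<close>

primrec fsubst :: "(nat \<Rightarrow> 'k endo) \<Rightarrow> (nat \<Rightarrow> 'k endo) \<Rightarrow> nat \<Rightarrow> 'k::field form \<Rightarrow> 'k endo" where
  "fsubst b \<beta> 0 = (\<lambda>v. scal (v (\<lambda>_. 0) {}))"
| "fsubst b \<beta> (Suc n) = (\<lambda>v. \<Sum>k<CHAR('k). b n ^ k * (fsubst b \<beta> n (slice0 n k v) + fsubst b \<beta> n (slice1 n k v) * \<beta> n))"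

definition index_below :: "'k::field itself \<Rightarrow> nat \<Rightarrow> (nat \<Rightarrow> nat) \<Rightarrow> nat set \<Rightarrow> bool" where
  "index_below _ n a U \<longleftrightarrow> (\<forall>i. a i < CHAR('k)) \<and> (\<forall>i\<ge>n. a i = 0) \<and> U \<subseteq> {..<n}"

lemma index_below_Suc:
  assumes "index_below TYPE('k::field) n a U" "k < CHAR('k)"
  shows "index_below TYPE('k) (Suc n) (a(n := k)) U" "index_below TYPE('k) (Suc n) (a(n := k)) (insert n U)"
  using assms by (auto simp: index_below_def less_Suc_eq)

lemma index_below_admissible: "index_below TYPE('k::field) n a U \<Longrightarrow> admissible TYPE('k) a" and index_below_finite: "index_below TYPE('k::field) n a U \<Longrightarrow> finite U"
  by (auto simp: index_below_def admissible_def finite_subset)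

lemma fsubst_cong:
  fixes v w :: "'k::field form"
  assumes "\<And>a U. index_below TYPE('k) n a U \<Longrightarrow> v a U = w a U" "CHAR('k) > 0"
  shows "fsubst b \<beta> n v = fsubst b \<beta> n w"
  using assms(1)
proof (induction n arbitrary: v w)
  case 0
  have "v (\<lambda>_. 0) {} = w (\<lambda>_. 0) {}" using assms(2) by (intro 0) (auto simp: index_below_def)
  then show ?case by simp
next
  case (Suc n)
  have "fsubst b \<beta> n (slice0 n k v) = fsubst b \<beta> n (slice0 n k w)" "fsubst b \<beta> n (slice1 n k v) = fsubst b \<beta> n (slice1 n k w)"
    if "k < CHAR('k)" for k
    unfolding slice0_def slice1_def by (rule Suc.IH, rule Suc.prems, erule index_below_Suc[OF _ that])+
  then show ?case by (auto intro!: sum.cong)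
qed

lemma sl_add: "slice0 n k (\<lambda>a U. v a U + w a U) = (\<lambda>a U. slice0 n k v a U + slice0 n k w a U)"
  "slice1 n k (\<lambda>a U. v a U + w a U) = (\<lambda>a U. slice1 n k v a U + slice1 n k w a U)"
  and sl_scale: "slice0 n k (\<lambda>a U. c * v a U) = (\<lambda>a U. c * slice0 n k v a U)"
  "slice1 n k (\<lambda>a U. c * v a U) = (\<lambda>a U. c * slice1 n k v a U)"
  by (simp_all add: slice0_def slice1_def)

lemma fsubst_add: "fsubst b \<beta> n (\<lambda>a U. v a U + w a U) = fsubst b \<beta> n v + fsubst b \<beta> n w"
  by (induction n arbitrary: v w) (simp_all add: scal_add sl_add sum.distrib[symmetric] algebra_simps)

lemma fsubst_scale: "fsubst b \<beta> n (\<lambda>a U. c * v a U) = scal c * fsubst b \<beta> n v"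
proof (induction n arbitrary: v)
  case (Suc n)
  have "x * (scal c * y + scal c * z * w) = scal c * (x * (y + z * w))" for x y z w
    by (metis distrib_left mult.assoc scal_comm)
  then show ?case by (simp add: Suc sl_scale sum_distrib_left)
qed (simp add: scal_mult)

lemma fsubst_zero: "fsubst b \<beta> n (\<lambda>_ _. 0) = 0"
  using fsubst_scale[of b \<beta> n 0 "\<lambda>_ _. 0"] by simp

text \<open>\<open>t_shift\<close>, \<open>theta_shift\<close> and \<open>twist\<close> are the
  actions of \<open>tvar\<close>, \<open>theta\<close> and \<open>parity\<close> on raw coefficient
  functions. They agree with them at all indices that a substitution can see.\<close>

definition t_shift :: "nat \<Rightarrow> 'k::field form \<Rightarrow> 'k form" where
  "t_shift i v = (\<lambda>a U. if 0 < a i then v (a(i := a i - Suc 0)) U else 0)"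

definition theta_shift :: "nat \<Rightarrow> 'k::field form \<Rightarrow> 'k form" where
  "theta_shift i v = (\<lambda>a U. if i \<in> U then gsign i U * v a (U - {i}) else 0)"

definition twist :: "'k::field form \<Rightarrow> 'k form" where
  "twist v = (\<lambda>a U. (-1) ^ card U * v a U)"

lemma dform_slice0:
  assumes "n \<notin> U"
  shows "dform v (a(n := k)) U = dform (slice0 n k v) a U"
  unfolding dform_def slice0_def using assms by (intro sum.cong) (auto simp: fun_upd_twist)

text \<open>The derivative in \<open>t_n\<close> puts \<open>dt_n\<close> in front; moving it behind
  the differentials in \<open>U\<close> costs the sign that \<open>twist\<close> records.\<close>

lemma dform_slice1:
  assumes "U \<subseteq> {..<n}"
  shows "dform v (a(n := k)) (insert n U) =
    of_nat (Suc k) * twist (slice0 n (Suc k) v) a U + dform (slice1 n k v) a U"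
proof -
  have U: "finite U" "n \<notin> U" using assms by (auto simp: finite_subset)
  have "{j \<in> insert n U. j < n} = U" using assms by auto
  then have "gsign n (insert n U) = ((-1) ^ card U :: 'a)" by (simp add: gsign_def)
  moreover have "of_nat (Suc ((a(n := k)) i)) * gsign i (insert n U) * v ((a(n := k))(i := Suc ((a(n := k)) i))) (insert n U - {i}) =
      of_nat (Suc (a i)) * gsign i U * slice1 n k v (a(i := Suc (a i))) (U - {i})" if "i \<in> U" for i
  proof -
    have "i < n" "i \<noteq> n" using that assms by auto
    then show ?thesis using U by (simp add: gsign_insert slice1_def fun_upd_twist insert_Diff_if)
  qed
  ultimately show ?thesis
    unfolding dform_def using U by (simp add: twist_def slice0_def del: of_nat_Suc)
qed

text \<open>Here \<open>\<beta> i\<close> is not tied to \<open>b i\<close>, as required for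
  substituting Grassmann elements. The power condition on \<open>b i\<close> matches the relation
  \<open>t_i ^ p = 0\<close>.\<close>

locale forms_subst =
  fixes b \<beta> :: "nat \<Rightarrow> 'k::field endo"
  assumes p: "prime CHAR('k)" "CHAR('k) > 2" and two: "(2::'k) \<noteq> 0"
    and b_even: "\<And>i. homog False (b i)" and \<beta>_odd: "\<And>i. homog True (\<beta> i)"
    and b_p: "\<And>i. b i ^ CHAR('k) = 0"
begin

lemma p0: "CHAR('k) > 0"
  using p by simp

abbreviation \<Psi> :: "nat \<Rightarrow> 'k form \<Rightarrow> 'k endo" where
  "\<Psi> \<equiv> fsubst b \<beta>"

lemma is_form_fsubst: "is_form (\<Psi> n v)"
proof (induction n arbitrary: v)
  case (Suc n)
  show ?case
    unfolding fsubst.simps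
    by (intro is_form_sum is_form_mult is_form_add Suc homog_is_form[OF homog_power[OF b_even]] homog_is_form[OF \<beta>_odd])
qed (simp add: homog_is_form[OF homog_scal])

lemma bar_fsubst: "bar (\<Psi> n v) = \<Psi> n (twist v)"
proof (induction n arbitrary: v)
  case (Suc n)
  have "\<Psi> n (slice1 n k (twist v)) = - bar (\<Psi> n (slice1 n k v))" for k
  proof -
    have "\<Psi> n (slice1 n k (twist v)) = \<Psi> n (\<lambda>a U. (-1) * twist (slice1 n k v) a U)"
    proof (rule fsubst_cong[OF _ p0])
      fix a U assume "index_below TYPE('k) n a U"
      then have "finite U" "n \<notin> U" by (auto simp: index_below_def finite_subset)
      then show "slice1 n k (twist v) a U = (-1) * twist (slice1 n k v) a U" by (simp add: slice1_def twist_def)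
    qed
    then show ?thesis unfolding fsubst_scale by (simp add: Suc scal_uminus)
  qed
  moreover have "slice0 n k (twist v) = twist (slice0 n k v)" for k by (simp add: slice0_def twist_def)
  ultimately show ?case
    using homog_bar[OF b_even] homog_bar[OF \<beta>_odd]
    by (simp add: bar_sum bar_mult bar_power bar_add Suc)
qed (simp add: twist_def)

lemma \<beta>_fsubst: "\<beta> i * \<Psi> n v = bar (\<Psi> n v) * \<beta> i"
  by (rule is_form_odd_comm[OF \<beta>_odd is_form_fsubst])

lemma b_fsubst: "b i ^ k * \<Psi> n v = \<Psi> n v * b i ^ k"
  by (rule is_form_even_comm[OF homog_power[OF b_even] is_form_fsubst])

lemma \<beta>_sq: "\<beta> i * \<beta> i = 0"
  by (rule homog_odd_sq[OF \<beta>_odd two])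

lemma fsubst_tvar: "i < n \<Longrightarrow> \<Psi> n (t_shift i v) = b i * \<Psi> n v"
proof (induction n arbitrary: v)
  case (Suc n)
  define Z where "Z k = \<Psi> n (slice0 n k v) + \<Psi> n (slice1 n k v) * \<beta> n" for k
  show ?case
  proof (cases "i = n")
    case False
    then have i: "i < n" using Suc by simp
    have sl: "slice0 n k (t_shift i v) = t_shift i (slice0 n k v)" "slice1 n k (t_shift i v) = t_shift i (slice1 n k v)" for k
      using False by (auto simp: slice0_def slice1_def t_shift_def fun_eq_iff fun_upd_twist)
    have "b n ^ k * (\<Psi> n (slice0 n k (t_shift i v)) + \<Psi> n (slice1 n k (t_shift i v)) * \<beta> n) = b i * (b n ^ k * Z k)" for k
    proof -
      have "b n ^ k * b i = b i * b n ^ k"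
        by (rule homog_even_comm[OF homog_power[OF b_even] b_even])
      then show ?thesis
        unfolding sl Suc.IH[OF i] Z_def by (simp only: distrib_left mult.assoc[symmetric])
    qed
    then show ?thesis by (simp add: sum_distrib_left Z_def)
  next
    case True
    obtain q where q: "CHAR('k) = Suc q" using p0 gr0_implies_Suc by blast
    have sl: "slice0 n 0 (t_shift n v) = (\<lambda>_ _. 0)" "slice1 n 0 (t_shift n v) = (\<lambda>_ _. 0)"
      "slice0 n (Suc k) (t_shift n v) = slice0 n k v" "slice1 n (Suc k) (t_shift n v) = slice1 n k v" for k
      by (auto simp: slice0_def slice1_def t_shift_def fun_eq_iff)
    have "\<Psi> (Suc n) (t_shift n v) = (\<Sum>k<q. b n ^ Suc k * Z k)"
      unfolding fsubst.simps q by (subst sum.lessThan_Suc_shift) (simp add: sl fsubst_zero Z_def)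
    \<comment> \<open>The added summand contains \<open>b n ^ p = 0\<close>; on the left it is
      missing because of the truncation.\<close>
    also have "\<dots> = (\<Sum>k<Suc q. b n ^ Suc k * Z k)"
      using b_p[of n] unfolding q by simp
    also have "\<dots> = b n * \<Psi> (Suc n) v"
      unfolding fsubst.simps q sum_distrib_left by (simp add: Z_def mult.assoc)
    finally show ?thesis using True by simp
  qed
qed simp

lemma fsubst_theta: "i < n \<Longrightarrow> \<Psi> n (theta_shift i v) = \<beta> i * \<Psi> n v"
proof (induction n arbitrary: v)
  case (Suc n)
  show ?case
  proof (cases "i = n")
    case False
    then have i: "i < n" using Suc by simp
    have "slice0 n k (theta_shift i v) = theta_shift i (slice0 n k v)" for k
      by (auto simp: slice0_def theta_shift_def fun_eq_iff)
    moreover have "\<Psi> n (slice1 n k (theta_shift i v)) = \<Psi> n (theta_shift i (slice1 n k v))" for k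
    proof (rule fsubst_cong[OF _ p0])
      fix a U assume "index_below TYPE('k) n a U"
      then have "finite U" "n \<notin> U" by (auto simp: index_below_def finite_subset)
      then show "slice1 n k (theta_shift i v) a U = theta_shift i (slice1 n k v) a U"
        using i by (auto simp: slice1_def theta_shift_def gsign_insert insert_Diff_if)
    qed
    moreover have "b n ^ k * \<beta> i = \<beta> i * b n ^ k" for k
      by (rule homog_even_comm[OF homog_power[OF b_even] \<beta>_odd])
    then have "b n ^ k * (\<beta> i * x + \<beta> i * y * \<beta> n) = \<beta> i * (b n ^ k * (x + y * \<beta> n))" for k x y
      by (simp only: distrib_left mult.assoc[symmetric])
    ultimately show ?thesis by (simp add: Suc.IH[OF i] sum_distrib_left)
  next
    case True
    have 0: "\<Psi> n (slice0 n k (theta_shift n v)) = 0" for k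
    proof -
      have "\<Psi> n (slice0 n k (theta_shift n v)) = \<Psi> n (\<lambda>_ _. 0)"
        by (rule fsubst_cong[OF _ p0]) (auto simp: index_below_def slice0_def theta_shift_def)
      then show ?thesis by (simp add: fsubst_zero)
    qed
    \<comment> \<open>Multiplication by \<open>dt_n\<close> happens on the left, but
      \<open>dt_n\<close> is split off on the right; passing it through the form yields
      \<open>bar\<close>.\<close>
    have 1: "\<Psi> n (slice1 n k (theta_shift n v)) = bar (\<Psi> n (slice0 n k v))" for k
      unfolding bar_fsubst
    proof (rule fsubst_cong[OF _ p0])
      fix a U assume "index_below TYPE('k) n a U"
      then have U: "finite U" "n \<notin> U" "{j \<in> insert n U. j < n} = U" by (auto simp: index_below_def finite_subset)
      then show "slice1 n k (theta_shift n v) a U = twist (slice0 n k v) a U"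
        by (simp add: slice1_def slice0_def theta_shift_def twist_def gsign_def)
    qed
    have "b n ^ k * (bar x * \<beta> n) = \<beta> n * (b n ^ k * (x + y * \<beta> n))"
      if "\<beta> n * x = bar x * \<beta> n" "\<beta> n * y = bar y * \<beta> n" for k x y
    proof -
      have "\<beta> n * b n ^ k = b n ^ k * \<beta> n"
        using homog_even_comm[OF homog_power[OF b_even] \<beta>_odd] by simp
      then have "\<beta> n * (b n ^ k * (x + y * \<beta> n)) = b n ^ k * (\<beta> n * (x + y * \<beta> n))"
        by (simp only: mult.assoc[symmetric])
      also have "\<beta> n * (x + y * \<beta> n) = bar x * \<beta> n + bar y * (\<beta> n * \<beta> n)"
        by (simp only: distrib_left mult.assoc[symmetric] that)
      finally show ?thesis by (simp add: \<beta>_sq)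
    qed
    from this[OF \<beta>_fsubst \<beta>_fsubst] show ?thesis
      unfolding True fsubst.simps sum_distrib_left by (intro sum.cong) (simp_all only: 0 1 add_0_left)
  qed
qed simp

end

locale forms_subst_d = forms_subst b \<beta> for b \<beta> :: "nat \<Rightarrow> 'k::field endo" +
  assumes db: "\<And>i. dd (b i) = \<beta> i" and b_nil: "\<And>i. nilcartier (b i)"
begin

lemma d\<beta>: "dd (\<beta> i) = 0"
  using dd_dd[OF two, of "b i"] by (simp add: db)

lemma dd_bk: "dd (b i ^ k) = of_nat k * (b i ^ (k - Suc 0) * \<beta> i)"
  using dd_power[OF b_even, of i k] by (simp add: db)

lemma fsubst_slice1_dform:
  "\<Psi> n (slice1 n k (dform v)) = of_nat (Suc k) * bar (\<Psi> n (slice0 n (Suc k) v)) + \<Psi> n (dform (slice1 n k v))"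
proof -
  have "\<Psi> n (slice1 n k (dform v)) =
      \<Psi> n (\<lambda>a U. of_nat (Suc k) * twist (slice0 n (Suc k) v) a U + dform (slice1 n k v) a U)"
  proof (rule fsubst_cong[OF _ p0])
    fix a U assume "index_below TYPE('k) n a U"
    then have "U \<subseteq> {..<n}" by (simp add: index_below_def)
    then show "slice1 n k (dform v) a U = of_nat (Suc k) * twist (slice0 n (Suc k) v) a U + dform (slice1 n k v) a U"
      using dform_slice1[of U n v a k] by (simp add: slice1_def)
  qed
  then show ?thesis
    unfolding fsubst_add fsubst_scale by (simp only: bar_fsubst scal_of_nat)
qed

lemma fsubst_slice0_dform: "\<Psi> n (slice0 n k (dform v)) = \<Psi> n (dform (slice0 n k v))"
proof (rule fsubst_cong[OF _ p0])
  fix a U assume "index_below TYPE('k) n a U"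
  then have "n \<notin> U" by (auto simp: index_below_def)
  then show "slice0 n k (dform v) a U = dform (slice0 n k v) a U"
    using dform_slice0[of n U v a k] by (simp add: slice0_def[of n k "dform v"])
qed

text \<open>The chain rule, proved by splitting off the last variable and comparing the coefficients
  of the powers of \<open>b n\<close>.\<close>

lemma fsubst_dform: "\<Psi> n (dform v) = dd (\<Psi> n v)"
proof (induction n arbitrary: v)
  case 0
  then show ?case by (simp add: dform_def)
next
  case (Suc n)
  obtain q where q: "CHAR('k) = Suc q" using p0 gr0_implies_Suc by blast
  define X where "X k = \<Psi> n (slice0 n k v)" for k
  define Y where "Y k = \<Psi> n (slice1 n k v)" for k
  let ?b = "b n" and ?\<beta> = "\<beta> n"
  have t: "dd (?b ^ k * (X k + Y k * ?\<beta>)) = ?b ^ k * (dd (X k) + dd (Y k) * ?\<beta>) +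
      of_nat k * (?b ^ (k - Suc 0) * (bar (X k) * ?\<beta>))" for k
  proof -
    have "?\<beta> * (X k + Y k * ?\<beta>) = bar (X k) * ?\<beta> + bar (Y k) * (?\<beta> * ?\<beta>)"
      unfolding distrib_left mult.assoc[symmetric] X_def Y_def \<beta>_fsubst ..
    then have "of_nat k * (?b ^ (k - Suc 0) * ?\<beta>) * (X k + Y k * ?\<beta>) =
        of_nat k * (?b ^ (k - Suc 0) * (bar (X k) * ?\<beta>))"
      by (simp add: \<beta>_sq mult.assoc)
    then show ?thesis
      by (simp add: dd_mult[of "?b ^ k"] dd_bk bar_power homog_bar[OF b_even] dd_add dd_mult[of "Y k"] d\<beta> add.commute)
  qed
  have "\<Psi> (Suc n) (dform v) = (\<Sum>k<CHAR('k). ?b ^ k * (dd (X k) + dd (Y k) * ?\<beta>)) +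
      (\<Sum>k<CHAR('k). of_nat (Suc k) * (?b ^ k * (bar (X (Suc k)) * ?\<beta>)))"
    unfolding fsubst.simps fsubst_slice0_dform fsubst_slice1_dform Suc sum.distrib[symmetric]
    by (rule sum.cong)
      (simp_all add: X_def Y_def distrib_left distrib_right mult.assoc of_nat_left_commute add_ac del: of_nat_Suc)
  \<comment> \<open>The last summand would involve the meaningless slice at exponent
    \<open>p\<close>; its coefficient is \<open>p = 0\<close>.\<close>
  also have "(\<Sum>k<CHAR('k). of_nat (Suc k) * (?b ^ k * (bar (X (Suc k)) * ?\<beta>))) =
      (\<Sum>k<q. of_nat (Suc k) * (?b ^ k * (bar (X (Suc k)) * ?\<beta>)))"
    using of_nat_CHAR_endo[where 'k='k] unfolding q by (simp del: of_nat_Suc)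
  also have "\<dots> = (\<Sum>k<CHAR('k). of_nat k * (?b ^ (k - Suc 0) * (bar (X k) * ?\<beta>)))"
    unfolding q by (subst sum.lessThan_Suc_shift) (simp del: of_nat_Suc)
  finally show ?case
    by (simp add: dd_sum sum.distrib t X_def[symmetric] Y_def[symmetric])
qed

text \<open>Split the form into \<open>t_n ^ k * (x_k + y_k * dt_n)\<close>. Closedness says that
  all \<open>x_k\<close> are closed and \<open>d y_k = - (k + 1) * bar x_(k+1)\<close>, so
  \<open>y_(p-1)\<close> is closed as well. For \<open>k < p - 1\<close> the term of
  \<open>x_(k+1)\<close> and that of \<open>y_k\<close> together are exact. What is left is
  \<open>x_0\<close> and \<open>t_n ^ (p - 1) * y_(p-1) * dt_n\<close>, and only the latter adds a
  factor.\<close>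

lemma poincare:
  assumes "\<And>a U. index_below TYPE('k) n a U \<Longrightarrow> dform v a U = 0"
  shows "cartier_exact n (\<Psi> n v)"
  using assms
proof (induction n arbitrary: v)
  case 0
  then show ?case by (simp add: cartier_exact_scal)
next
  case (Suc n)
  obtain q where q: "CHAR('k) = Suc q" using p0 gr0_implies_Suc by blast
  define X where "X k = \<Psi> n (slice0 n k v)" for k
  define Y where "Y k = \<Psi> n (slice1 n k v)" for k
  let ?b = "b n" and ?\<beta> = "\<beta> n"
  have X: "cartier_exact n (X k)" if k: "k < CHAR('k)" for k
    unfolding X_def
  proof (rule Suc.IH)
    fix a U assume i: "index_below TYPE('k) n a U"
    then have "n \<notin> U" by (auto simp: index_below_def)
    then show "dform (slice0 n k v) a U = 0"
      using Suc.prems[OF index_below_Suc(1)[OF i k]] dform_slice0 by metis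
  qed
  have 0: "of_nat (Suc k) * twist (slice0 n (Suc k) v) a U + dform (slice1 n k v) a U = 0"
    if i: "index_below TYPE('k) n a U" and k: "k < CHAR('k)" for k a U
  proof -
    have "U \<subseteq> {..<n}" using i by (simp add: index_below_def)
    then show ?thesis
      using Suc.prems[OF index_below_Suc(2)[OF i k]] dform_slice1 by metis
  qed
  have Yq: "cartier_exact n (Y q)"
    unfolding Y_def
  proof (rule Suc.IH)
    fix a U assume i: "index_below TYPE('k) n a U"
    have "of_nat (Suc q) = (0 :: 'k)" using of_nat_CHAR[where 'a='k] by (simp only: q)
    then show "dform (slice1 n q v) a U = 0" using 0[OF i, of q] by (simp add: q del: of_nat_Suc)
  qed
  have dY: "dd (Y k) = - (of_nat (Suc k) * bar (X (Suc k)))" if k: "k < CHAR('k)" for k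
  proof -
    have "of_nat (Suc k) * bar (X (Suc k)) + dd (Y k) =
        \<Psi> n (\<lambda>a U. of_nat (Suc k) * twist (slice0 n (Suc k) v) a U + dform (slice1 n k v) a U)"
      unfolding fsubst_add fsubst_scale X_def Y_def by (simp only: bar_fsubst scal_of_nat fsubst_dform)
    also have "\<dots> = \<Psi> n (\<lambda>_ _. 0)" by (rule fsubst_cong[OF _ p0]) (use 0 k in blast)
    finally show ?thesis by (simp add: fsubst_zero eq_neg_iff_add_eq_0 add.commute del: of_nat_Suc)
  qed
  \<comment> \<open>The primitive is \<open>b n ^ (k + 1) * bar (Y k)\<close> divided by
    \<open>k + 1\<close>, which is invertible because \<open>k + 1 < p\<close>.\<close>
  have ex: "cartier_exact (Suc n) (?b ^ Suc k * X (Suc k) + ?b ^ k * (Y k * ?\<beta>))" if k: "k < q" for k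
  proof -
    have "(of_nat (Suc k) :: 'k) \<noteq> 0"
    proof
      assume "(of_nat (Suc k) :: 'k) = 0"
      then have "CHAR('k) dvd Suc k" by (simp only: of_nat_eq_0_iff_char_dvd)
      then show False using k q by (auto dest: dvd_imp_le)
    qed
    moreover have "dd (?b ^ Suc k * bar (Y k)) = of_nat (Suc k) * (?b ^ Suc k * X (Suc k) + ?b ^ k * (Y k * ?\<beta>))"
    proof -
      have 1: "dd (bar (Y k)) = of_nat (Suc k) * X (Suc k)"
        using bar_dd[of "Y k"] dY[of k] k q
        by (simp add: bar_uminus bar_mult scal_of_nat[symmetric] del: of_nat_Suc)
      have 2: "?\<beta> * bar (Y k) = Y k * ?\<beta>"
        unfolding Y_def using is_form_odd_comm[OF \<beta>_odd is_form_fsubst, of n n "twist (slice1 n k v)"] bar_fsubst[symmetric] by simp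
      have "dd (?b ^ Suc k * bar (Y k)) = of_nat (Suc k) * (?b ^ k * (?\<beta> * bar (Y k))) + ?b ^ Suc k * dd (bar (Y k))"
        by (simp add: dd_mult[of "?b ^ Suc k"] dd_bk bar_power homog_bar[OF b_even] mult.assoc
            del: of_nat_Suc power_Suc)
      then show ?thesis unfolding 1 2 by (simp add: of_nat_left_commute distrib_left add.commute del: of_nat_Suc power_Suc)
    qed
    ultimately have "?b ^ Suc k * X (Suc k) + ?b ^ k * (Y k * ?\<beta>) =
        dd (scal (inverse (of_nat (Suc k))) * (?b ^ Suc k * bar (Y k)))"
      using scal_inverse_mult[of "of_nat (Suc k) :: 'k"]
      by (simp add: dd_scal_mult scal_of_nat del: of_nat_Suc power_Suc)
    then show ?thesis using cartier_exact_dd by metis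
  qed
  \<comment> \<open>At exponent \<open>p - 1\<close> no such division is possible; the assumption on
    \<open>b n\<close> takes over.\<close>
  obtain y q' where q': "cartier1 q'" and bq: "?b ^ q * ?\<beta> = dd y + q'"
    using b_nil[of n] unfolding nilcartier_def by (auto simp: q db)
  have top: "cartier_exact (Suc n) (?b ^ q * (Y q * ?\<beta>))"
  proof -
    have "?b ^ q * (Y q * ?\<beta>) = Y q * (?b ^ q * ?\<beta>)"
      unfolding Y_def by (simp only: mult.assoc[symmetric] b_fsubst)
    then show ?thesis using cartier_exact_mult[OF two Yq bq q'] by simp
  qed
  have "\<Psi> (Suc n) v = (\<Sum>k<Suc q. ?b ^ k * X k) + (\<Sum>k<Suc q. ?b ^ k * (Y k * ?\<beta>))"
    unfolding fsubst.simps q by (simp only: X_def Y_def distrib_left sum.distrib)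
  also have "(\<Sum>k<Suc q. ?b ^ k * X k) = X 0 + (\<Sum>k<q. ?b ^ Suc k * X (Suc k))"
    by (subst sum.lessThan_Suc_shift) simp
  finally have eq: "\<Psi> (Suc n) v = X 0 + (\<Sum>k<q. ?b ^ Suc k * X (Suc k) + ?b ^ k * (Y k * ?\<beta>)) + ?b ^ q * (Y q * ?\<beta>)"
    by (simp add: sum.distrib add_ac)
  have "cartier_exact (Suc n) (\<Sum>k<q. ?b ^ Suc k * X (Suc k) + ?b ^ k * (Y k * ?\<beta>))"
    by (rule cartier_exact_sum) (rule ex, simp)
  then show ?case unfolding eq by (intro cartier_exact_add[OF cartier_exact_add] cartier_exact_Suc[OF X[OF p0]] top)
qed

end

section \<open>Values at the generic point\<close>

lemma prod_list_induct:
  assumes "P 1" "\<And>x y. x \<in> set xs \<Longrightarrow> P y \<Longrightarrow> P (x * y)"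
  shows "P (prod_list xs)"
  using assms by (induction xs) auto

lemma fsubst_vacuum: "CHAR('k::field) > 0 \<Longrightarrow> fsubst b \<beta> n (vacuum :: 'k form) = 1"
proof (induction n)
  case 0
  then show ?case by (simp add: vacuum_def)
next
  case (Suc n)
  have 0: "fsubst b \<beta> n (slice0 n k vacuum) = (if k = 0 then 1 else 0 :: 'k endo)" for k
  proof (cases "k = 0")
    case True
    have "fsubst b \<beta> n (slice0 n 0 (vacuum :: 'k form)) = fsubst b \<beta> n vacuum"
    proof (rule fsubst_cong[OF _ Suc.prems])
      fix a U assume "index_below TYPE('k) n a U"
      then have "a(n := 0) = a" by (auto simp: index_below_def)
      then show "slice0 n 0 vacuum a U = (vacuum a U :: 'k)" unfolding slice0_def by simp
    qed
    then show ?thesis using True Suc by simp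
  next
    case False
    then have "a(n := k) \<noteq> (\<lambda>_. 0)" for a :: "nat \<Rightarrow> nat" by (metis fun_upd_same)
    then have "slice0 n k (vacuum :: 'k form) = (\<lambda>_ _. 0)" by (simp add: slice0_def vacuum_def)
    then show ?thesis using False by (simp add: fsubst_zero)
  qed
  have 1: "slice1 n k (vacuum :: 'k form) = (\<lambda>_ _. 0)" for k by (auto simp: slice1_def vacuum_def)
  have "fsubst b \<beta> (Suc n) (vacuum :: 'k form) = (\<Sum>k<CHAR('k). if k = 0 then 1 else 0)"
    unfolding fsubst.simps by (intro sum.cong) (auto simp: 0 1 fsubst_zero)
  then show ?case using Suc.prems by simp
qed

definition generic_point :: "(nat \<Rightarrow> 'k) \<Rightarrow> nat \<Rightarrow> 'k::field endo" where
  "generic_point \<alpha> i = scal (\<alpha> i) + tvar i + theta i"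

definition supported :: "nat \<Rightarrow> 'k::field form \<Rightarrow> bool" where
  "supported N v \<longleftrightarrow> (\<forall>a U. v a U \<noteq> 0 \<longrightarrow> (\<forall>i\<ge>N. a i = 0) \<and> U \<subseteq> {..<N})"

lemma supportedI: "(\<And>a U. v a U \<noteq> 0 \<Longrightarrow> (\<forall>i\<ge>N. a i = 0) \<and> U \<subseteq> {..<N}) \<Longrightarrow> supported N v"
  by (simp add: supported_def)

lemma app_generic_point:
  assumes "admissible TYPE('k::field) a" "finite U"
  shows "app (generic_point \<alpha> i) v a U = \<alpha> i * (v :: 'k form) a U + t_shift i v a U + theta_shift i v a U"
  using assms by (simp add: generic_point_def app_plus app_scal app_tvar app_theta t_shift_def theta_shift_def truncate_admissible)

lemma supported_generic_point:
  assumes v: "supported N v" and i: "i < N"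
  shows "supported N (app (generic_point \<alpha> i) (v :: 'k::field form))"
proof (rule supportedI)
  fix a U
  assume nz: "app (generic_point \<alpha> i) v a U \<noteq> 0"
  then have admissible: "admissible TYPE('k) a" "finite U" using app_not_admissible by blast+
  then have "v a U \<noteq> 0 \<or> t_shift i v a U \<noteq> 0 \<or> theta_shift i v a U \<noteq> 0" using nz by (auto simp: app_generic_point)
  then consider "v a U \<noteq> 0" | "v (a(i := a i - Suc 0)) U \<noteq> 0" | "i \<in> U" "v a (U - {i}) \<noteq> 0"
    by (auto simp: t_shift_def theta_shift_def split: if_splits)
  then show "(\<forall>j\<ge>N. a j = 0) \<and> U \<subseteq> {..<N}"
  proof cases
    case 1
    then show ?thesis using v by (simp add: supported_def)
  next
    case 2
    then have *: "\<forall>j\<ge>N. (a(i := a i - Suc 0)) j = 0" "U \<subseteq> {..<N}" using v unfolding supported_def by blast+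
    then show ?thesis using i by (metis fun_upd_other not_less)
  next
    case 3
    then show ?thesis using v i unfolding supported_def by blast
  qed
qed

lemma supported_add_scale: "supported N u \<Longrightarrow> supported N v \<Longrightarrow> supported N (\<lambda>a U. u a U + c * v a U)"
  unfolding supported_def by (metis add_0 mult_zero_right)

lemma supported_fa_eval:
  assumes f: "f \<in> FA" and vars: "\<And>w i. f w \<noteq> 0 \<Longrightarrow> i \<in> set w \<Longrightarrow> i < N"
  shows "supported N (app (fa_eval (generic_point \<alpha>) f) (vacuum :: 'k::field form))"
  using f
proof (induction rule: FA_induct)
  case zero
  then show ?case by (simp add: fa_eval_0 app_0 supported_def)
next
  case (add g c w)
  have "supported N (app (prod_list (map (generic_point \<alpha>) w)) vacuum)"
  proof (rule prod_list_induct)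
    show "supported N (app 1 (vacuum :: 'k form))"
      by (simp add: app_one supported_def) (simp add: vacuum_def)
    show "supported N (app (x * y) vacuum)"
      if x: "x \<in> set (map (generic_point \<alpha>) w)" and y: "supported N (app y vacuum)" for x y :: "'k endo"
    proof -
      obtain i where "i \<in> set w" "x = generic_point \<alpha> i" using x by auto
      then show ?thesis unfolding app_times using supported_generic_point[OF y vars[OF add(2)]] by blast
    qed
  qed
  then show ?case using add
    by (simp add: fa_eval_add fa_eval_scale FA_scale FA_w fa_eval_w app_plus app_times app_scal supported_add_scale)
qed

context forms_subst
begin

lemma fsubst_generic_point:
  assumes "i < N"
  shows "\<Psi> N (app (generic_point \<alpha> i) v) = (scal (\<alpha> i) + b i + \<beta> i) * \<Psi> N v"
proof -
  have "\<Psi> N (app (generic_point \<alpha> i) v) = \<Psi> N (\<lambda>a U. (\<alpha> i * v a U + t_shift i v a U) + theta_shift i v a U)"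
    by (rule fsubst_cong[OF _ p0]) (simp add: app_generic_point index_below_admissible index_below_finite)
  then show ?thesis
    unfolding fsubst_add fsubst_scale fsubst_tvar[OF assms] fsubst_theta[OF assms] by (simp add: distrib_right)
qed

text \<open>The value at the generic point is universal: every value of \<open>f\<close> at points
  with the constants \<open>\<alpha>\<close> arises from it by substitution, so properties of its
  coefficients transfer.\<close>

lemma fsubst_fa_eval:
  assumes f: "f \<in> FA" and vars: "\<And>w i. f w \<noteq> 0 \<Longrightarrow> i \<in> set w \<Longrightarrow> i < N"
  shows "\<Psi> N (app (fa_eval (generic_point \<alpha>) f) vacuum) = fa_eval (\<lambda>i. scal (\<alpha> i) + b i + \<beta> i) f"
  using f
proof (induction rule: FA_induct)
  case zero
  then show ?case by (simp add: fa_eval_0 app_0 fsubst_zero)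
next
  case (add g c w)
  have "\<Psi> N (app (prod_list (map (generic_point \<alpha>) w)) vacuum) = prod_list (map (\<lambda>i. scal (\<alpha> i) + b i + \<beta> i) w)"
    using vars[OF add(2)]
  proof (induction w)
    case Nil
    then show ?case using fsubst_vacuum[OF p0] by (simp add: app_one)
  next
    case (Cons i w)
    then show ?case by (simp add: app_times fsubst_generic_point)
  qed
  then show ?case using add fsubst_scale[of b \<beta> N c "app (prod_list (map (generic_point \<alpha>) w)) vacuum"]
    by (simp add: fa_eval_add fa_eval_scale FA_scale FA_w fa_eval_w app_plus fsubst_add app_times app_scal)
qed

end

subsection \<open>Generic elements of the Grassmann algebra\<close>

text \<open>Elements in generators with index below \<open>s\<close>. Multiplication by the fresh
  generator \<open>theta s\<close> is injective on them, which is how coefficients are recovered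
  later.\<close>

definition gr_below :: "nat \<Rightarrow> 'k::field endo \<Rightarrow> bool" where
  "gr_below s z \<longleftrightarrow> (\<exists>g. z = iota g \<and> (\<forall>S. g S \<noteq> 0 \<longrightarrow> S \<subseteq> {..<s}))"

lemma gr_below_add: "gr_below s z \<Longrightarrow> gr_below s w \<Longrightarrow> gr_below s (z + w)"
proof -
  assume "gr_below s z" "gr_below s w"
  then obtain g h where gh: "z = iota g" "\<And>S. g S \<noteq> 0 \<Longrightarrow> S \<subseteq> {..<s}" "w = iota h" "\<And>S. h S \<noteq> 0 \<Longrightarrow> S \<subseteq> {..<s}"
    unfolding gr_below_def by blast
  have "S \<subseteq> {..<s}" if "g S + h S \<noteq> 0" for S
    using gh(2)[of S] gh(4)[of S] that by (cases "g S = 0") auto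
  moreover have "z + w = iota (\<lambda>U. g U + h U)" by (simp add: gh iota_add)
  ultimately show ?thesis unfolding gr_below_def by blast
qed

lemma gr_below_mult: "gr_below s z \<Longrightarrow> gr_below s w \<Longrightarrow> gr_below s (z * w)"
proof -
  assume "gr_below s z" "gr_below s w"
  then obtain g h where gh: "z = iota g" "\<And>S. g S \<noteq> 0 \<Longrightarrow> S \<subseteq> {..<s}" "w = iota h" "\<And>S. h S \<noteq> 0 \<Longrightarrow> S \<subseteq> {..<s}"
    unfolding gr_below_def by blast
  have "U \<subseteq> {..<s}" if nz: "gr_mult g h U \<noteq> 0" for U
  proof -
    obtain x where "x \<in> {(S, R). S \<union> R = U \<and> S \<inter> R = {}}" "(case x of (S, R) \<Rightarrow> gr_sign S R * g S * h R) \<noteq> 0"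
      using nz unfolding gr_mult_def by (rule sum.not_neutral_contains_not_neutral)
    then obtain S R where "U = S \<union> R" "g S \<noteq> 0" "h R \<noteq> 0" by (cases x) auto
    then show ?thesis using gh(2) gh(4) by blast
  qed
  moreover have "z * w = iota (gr_mult g h)" by (simp add: gh iota_mult)
  ultimately show ?thesis unfolding gr_below_def by blast
qed

lemma gr_below_scal: "gr_below s (scal c)"
proof -
  have "scal c = iota (\<lambda>U. c * gr_one U)" by (simp add: iota_scale iota_one)
  moreover have "S \<subseteq> {..<s}" if "c * gr_one S \<noteq> 0" for S
    using that by (auto simp: gr_one_def split: if_splits)
  ultimately show ?thesis unfolding gr_below_def by blast
qed

lemma gr_below_theta: "i < s \<Longrightarrow> gr_below s (theta i)"
  unfolding gr_below_def iota_single[symmetric]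
  by (intro exI[of _ "gr_e {i}"] conjI refl) (simp add: gr_e_def)

lemma gr_below_mono: "gr_below s z \<Longrightarrow> s \<le> t \<Longrightarrow> gr_below t z"
  unfolding gr_below_def by (elim exE conjE, rule exI, rule conjI, assumption) fastforce

lemma gr_below_power: "gr_below s z \<Longrightarrow> gr_below s (z ^ n)"
  using gr_below_scal[of s 1] by (induction n) (auto intro: gr_below_mult)

lemma gr_below_sum: "(\<And>i. i \<in> A \<Longrightarrow> gr_below s (f i)) \<Longrightarrow> gr_below s (sum f A)"
  using gr_below_scal[of s 0] by (induction A rule: infinite_finite_induct) (auto intro: gr_below_add)

lemma gr_below_strip:
  fixes z :: "'k::field endo"
  assumes "gr_below s z" "z * theta s = 0"
  shows "z = 0"
proof -
  obtain g where g: "z = iota g" "\<And>S. g S \<noteq> 0 \<Longrightarrow> S \<subseteq> {..<s}" using assms(1) unfolding gr_below_def by blast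
  have "g U = 0" for U
  proof (rule ccontr)
    assume "g U \<noteq> 0"
    then have "U \<subseteq> {..<s}" by (rule g(2))
    then have U: "finite U" "s \<notin> U" "\<And>u. u \<in> U \<Longrightarrow> u < s" by (auto simp: finite_subset)
    have "iota (gr_mult g (gr_e {s})) = (0 :: 'k endo)" using assms(2) by (simp add: g iota_mult iota_single)
    then have "gr_mult g (gr_e {s}) (insert s U) = 0"
      using app_iota_vacuum[of "insert s U" "gr_mult g (gr_e {s})"] U(1) by (simp add: app_0)
    then show False using U \<open>g U \<noteq> 0\<close> by (simp add: gr_mult_e_right gr_sign_below)
  qed
  then have "g = (\<lambda>_. 0)" by blast
  then show ?thesis using g(1) by (simp add: iota_zero)
qed

text \<open>A sum of \<open>p - 1\<close> products of two generators has nonzero \<open>(p - 1)\<close>-st power and zero \<open>p\<close>-th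
power; using disjoint blocks of generators, truncated forms thus embed into the Grassmann algebra.\<close>

definition pairs :: "nat \<Rightarrow> nat \<Rightarrow> 'k::field endo" where
  "pairs t m = (\<Sum>j<m. theta (t + 2 * j) * theta (Suc (t + 2 * j)))"

lemma homog_pairs: "homog False (pairs t m)"
  unfolding pairs_def by (intro homog_sum homog_mult'[OF homog_theta homog_theta]) simp

lemma gr_below_pairs: "gr_below (t + 2 * m) (pairs t m)"
  unfolding pairs_def by (intro gr_below_sum gr_below_mult gr_below_theta) auto

lemma power_add_sq0:
  fixes P Q :: "'a::ring_1"
  assumes "P * Q = Q * P" "Q * Q = 0"
  shows "(P + Q) ^ Suc n = P ^ Suc n + of_nat (Suc n) * (P ^ n * Q)"
proof (induction n)
  case (Suc n)
  have PQ: "Q * P ^ n = P ^ n * Q" for n using mult_power_commute[OF assms(1)] by simp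
  have "(P + Q) ^ Suc (Suc n) = (P + Q) * (P ^ Suc n + of_nat (Suc n) * (P ^ n * Q))"
    using Suc by simp
  also have "\<dots> = P ^ Suc (Suc n) + of_nat (Suc n) * (P ^ Suc n * Q) + Q * P ^ Suc n + of_nat (Suc n) * (Q * P ^ n * Q)"
    by (simp add: distrib_left distrib_right of_nat_left_commute mult.assoc add_ac del: of_nat_Suc)
  also have "Q * P ^ n * Q = 0" by (simp only: PQ mult.assoc assms(2) mult_zero_right)
  also have "Q * P ^ Suc n = P ^ Suc n * Q" by (rule PQ)
  finally show ?case by (simp add: distrib_right add_ac)
qed simp

lemma pairs_sq:
  fixes t j :: nat
  shows "(theta t * theta j) * (theta t * theta j) = (0 :: 'k::field endo)"
proof (cases "t = j")
  case False
  have "(theta t * theta j) * (theta t * theta j) = theta t * (theta j * theta t) * (theta j :: 'k endo)" by (simp add: mult.assoc)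
  also have "\<dots> = - ((theta t * theta t) * theta j * theta j)"
    using False by (simp only: theta_theta[OF False[symmetric]] mult.assoc mult_minus_left mult_minus_right)
  finally show ?thesis by (simp add: theta_sq)
qed (simp add: theta_sq)

text \<open>The summands commute and have square zero, so a power of the sum is a factorial times a
  sum of products of distinct summands. With \<open>m\<close> summands nothing survives beyond the
  exponent \<open>m\<close>.\<close>

lemma pairs_power:
  "pairs t m ^ Suc m = (0 :: 'k::field endo)"
  "pairs t (Suc m) ^ Suc m = of_nat (Suc m) * (pairs t m ^ m * (theta (t + 2 * m) * theta (Suc (t + 2 * m)) :: 'k endo))"
proof -
  let ?Q = "\<lambda>m. theta (t + 2 * m) * theta (Suc (t + 2 * m)) :: 'k endo"
  have S: "pairs t (Suc m) = pairs t m + ?Q m" for m by (simp add: pairs_def)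
  have "pairs t m * ?Q m = ?Q m * pairs t m" for m
    by (rule homog_even_comm[OF homog_pairs homog_mult[OF homog_theta homog_theta]])
  note pw = power_add_sq0[OF this pairs_sq]
  show 1: "pairs t m ^ Suc m = (0 :: 'k endo)" for m
  proof (induction m)
    case 0
    then show ?case by (simp add: pairs_def)
  next
    case (Suc m)
    have "(pairs t m :: 'k endo) ^ Suc (Suc m) = pairs t m * pairs t m ^ Suc m" by (rule power_Suc)
    then show ?case unfolding S pw Suc by simp
  qed
  show "pairs t (Suc m) ^ Suc m = of_nat (Suc m) * (pairs t m ^ m * ?Q m)"
    unfolding S pw 1 by simp
qed

text \<open>The power is \<open>m!\<close> times the product of all generators in the pairs. The
  factorial is invertible by assumption, and the generators are fresh for \<open>z\<close>, so they
  can be removed one after another from the right.\<close>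

lemma pairs_strip:
  fixes z :: "'k::field endo"
  assumes "gr_below t z" "\<And>k. 0 < k \<Longrightarrow> k \<le> m \<Longrightarrow> of_nat k \<noteq> (0::'k)" "z * pairs t m ^ m = 0"
  shows "z = 0"
  using assms(2,3)
proof (induction m)
  case (Suc m)
  have nz: "of_nat (Suc m) \<noteq> (0::'k)" using Suc.prems(1) by blast
  let ?x = "z * pairs t m ^ m"
  let ?i = "t + 2 * m"
  have "scal (of_nat (Suc m)) * (?x * theta ?i * theta (Suc ?i)) = 0"
    using Suc.prems(2) unfolding pairs_power(2) scal_of_nat of_nat_left_commute
    by (simp only: mult.assoc)
  then have "?x * theta ?i * theta (Suc ?i) = 0" using scal_inverse_mult[OF nz] by (metis mult_zero_right)
  moreover have x: "gr_below ?i ?x"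
    by (intro gr_below_mult gr_below_power gr_below_pairs gr_below_mono[OF assms(1)]) simp
  moreover have "gr_below (Suc ?i) (?x * theta ?i)"
    by (intro gr_below_mult gr_below_mono[OF x] gr_below_theta) simp_all
  ultimately have "?x = 0" using gr_below_strip by blast
  then show ?case using Suc.IH Suc.prems(1) by simp
qed simp

text \<open>Each variable receives one generator for \<open>dt_i\<close> and \<open>p - 1\<close>
  pairs for \<open>t_i\<close>. The offset \<open>1\<close> is there because the generators of the
  Grassmann algebra are numbered from \<open>1\<close>.\<close>

definition block_start :: "'k::field itself \<Rightarrow> nat \<Rightarrow> nat" where
  "block_start _ i = 1 + (2 * (CHAR('k) - 1) + 1) * i"

definition generic_even :: "nat \<Rightarrow> 'k::field endo" where
  "generic_even i = pairs (Suc (block_start TYPE('k) i)) (CHAR('k) - 1)"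

definition generic_odd :: "nat \<Rightarrow> 'k::field endo" where
  "generic_odd i = theta (block_start TYPE('k) i)"

lemma gr_below_generic_even: "gr_below (block_start TYPE('k) (Suc i)) (generic_even i :: 'k::field endo)"
  using gr_below_pairs[of "Suc (block_start TYPE('k) i)" "CHAR('k) - 1", where 'a='k]
  unfolding generic_even_def by (rule gr_below_mono) (simp add: block_start_def)

lemma gr_below_generic_odd: "gr_below (block_start TYPE('k) (Suc i)) (generic_odd i :: 'k::field endo)"
  unfolding generic_odd_def by (rule gr_below_theta) (simp add: block_start_def)

lemma block_start_mono: "i \<le> j \<Longrightarrow> block_start TYPE('k::field) i \<le> block_start TYPE('k) j"
  unfolding block_start_def by (intro add_left_mono mult_le_mono2)

lemma forms_subst_g:
  assumes "prime CHAR('k)" "CHAR('k) > 2" "(2::'k::field) \<noteq> 0"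
  shows "forms_subst (generic_even :: nat \<Rightarrow> 'k endo) generic_odd"
proof
  fix i
  have "CHAR('k) = Suc (CHAR('k) - 1)" using assms by simp
  then show "(generic_even i :: 'k endo) ^ CHAR('k) = 0" unfolding generic_even_def by (metis pairs_power(1))
qed (auto simp: generic_even_def generic_odd_def homog_pairs homog_theta assms)

lemma gr_below_fsubst_g: "gr_below (block_start TYPE('k) n) (fsubst generic_even generic_odd n (v :: 'k::field form))"
proof (induction n arbitrary: v)
  case (Suc n)
  have "gr_below (block_start TYPE('k) (Suc n)) (fsubst generic_even generic_odd n w)" for w :: "'k form"
    by (rule gr_below_mono[OF Suc block_start_mono]) simp
  then show ?case
    unfolding fsubst.simps by (intro gr_below_sum gr_below_mult gr_below_add gr_below_power gr_below_generic_even gr_below_generic_odd)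
qed (simp add: gr_below_scal)

text \<open>The coefficients with respect to the last block are isolated by multiplying with
  suitable elements of that block. Its generators are fresh for the remaining blocks and can be
  stripped off.\<close>

lemma fsubst_g_inj:
  fixes v :: "'k::field form"
  assumes p: "prime CHAR('k)" "CHAR('k) > 2" "(2::'k) \<noteq> 0"
    and "fsubst generic_even generic_odd n v = 0" "index_below TYPE('k) n a U"
  shows "v a U = 0"
  using assms(4,5)
proof (induction n arbitrary: v a U)
  case 0
  then have a: "a = (\<lambda>_. 0)" "U = {}" by (auto simp: index_below_def)
  have "app (scal (v (\<lambda>_. 0) {})) vacuum (\<lambda>_. 0) {} = (0::'k)" using 0(1) by (simp add: app_0)
  then have "v (\<lambda>_. 0) {} * (vacuum (\<lambda>_. 0) {} :: 'k) = 0" by (simp add: app_scal)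
  then show ?case by (simp add: vacuum_def a)
next
  case (Suc n)
  interpret forms_subst "generic_even :: nat \<Rightarrow> 'k endo" generic_odd by (rule forms_subst_g[OF p])
  let ?q = "CHAR('k) - 1" and ?s = "block_start TYPE('k) n"
  let ?b = "generic_even n :: 'k endo" and ?\<beta> = "generic_odd n :: 'k endo"
  define X where "X k = \<Psi> n (slice0 n k v)" for k
  define Y where "Y k = \<Psi> n (slice1 n k v)" for k
  define Z where "Z k = X k + Y k * ?\<beta>" for k
  have Zsum: "(\<Sum>k<CHAR('k). ?b ^ k * Z k) = 0"
    using Suc.prems(1) by (simp add: Z_def X_def Y_def)
  have nz: "of_nat k \<noteq> (0::'k)" if "0 < k" "k \<le> ?q" for k
    using that by (auto simp: of_nat_eq_0_iff_char_dvd dest: dvd_imp_le)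
  have bX: "gr_below ?s (X k)" "gr_below ?s (Y k)" for k unfolding X_def Y_def by (rule gr_below_fsubst_g)+
  have strip: "x = 0" if x: "gr_below ?s x" "x * ?\<beta> * ?b ^ ?q = 0" for x
  proof -
    have "gr_below (Suc ?s) (x * ?\<beta>)" unfolding generic_odd_def by (intro gr_below_mult gr_below_mono[OF x(1)] gr_below_theta) simp_all
    then have "x * ?\<beta> = 0" using pairs_strip[of "Suc ?s" "x * ?\<beta>" ?q] nz x(2) unfolding generic_even_def by blast
    then show ?thesis using gr_below_strip[OF x(1)] unfolding generic_odd_def by blast
  qed
  have Z0: "X k = 0 \<and> Y k = 0" if "k < CHAR('k)" for k
    using that
  proof (induction k rule: less_induct)
    case (less k)
    \<comment> \<open>This factor kills all exponents above \<open>k\<close>, since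
      \<open>?b ^ p = 0\<close>; the coefficients below \<open>k\<close> vanish by
      induction.\<close>
    have "?b ^ (?q - k) * (\<Sum>j<CHAR('k). ?b ^ j * Z j) = (\<Sum>j<CHAR('k). if j = k then ?b ^ ?q * Z k else 0)"
      unfolding sum_distrib_left
    proof (rule sum.cong)
      fix j assume j: "j \<in> {..<CHAR('k)}"
      have "?b ^ (?q - k) * (?b ^ j * Z j) = ?b ^ (?q - k + j) * Z j" by (simp add: power_add mult.assoc)
      also have "\<dots> = (if j = k then ?b ^ ?q * Z k else 0)"
      proof (cases j k rule: linorder_cases)
        case less
        then have "Z j = 0" using less.IH[OF less] j by (simp add: Z_def)
        then show ?thesis using less by simp
      next
        case equal
        then show ?thesis using less.prems by simp
      next
        case greater
        then have "?q - k + j = CHAR('k) + (j - k - 1)" using less.prems by simp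
        then have "?b ^ (?q - k + j) = 0" by (simp only: power_add b_p mult_zero_left)
        then show ?thesis using greater by simp
      qed
      finally show "?b ^ (?q - k) * (?b ^ j * Z j) = (if j = k then ?b ^ ?q * Z k else 0)" .
    qed simp
    then have bZ: "?b ^ ?q * Z k = 0" using Zsum less.prems by simp
    have comm: "?b ^ ?q * (\<Psi> n w * ?\<beta>) = \<Psi> n w * ?\<beta> * ?b ^ ?q" for w
    proof -
      have b\<beta>: "?b ^ ?q * ?\<beta> = ?\<beta> * ?b ^ ?q" by (rule homog_even_comm[OF homog_power[OF b_even] \<beta>_odd])
      have "?b ^ ?q * (\<Psi> n w * ?\<beta>) = (?b ^ ?q * \<Psi> n w) * ?\<beta>" by (simp only: mult.assoc)
      also have "\<dots> = \<Psi> n w * (?b ^ ?q * ?\<beta>)" by (simp only: b_fsubst mult.assoc)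
      finally show ?thesis by (simp only: b\<beta> mult.assoc)
    qed
    \<comment> \<open>Multiplying by \<open>?\<beta>\<close> once more removes the
      \<open>Y k\<close> part because \<open>?\<beta>\<close> has square zero. So \<open>X k\<close>
      is found first and \<open>Y k\<close> afterwards.\<close>
    have "?b ^ ?q * Z k * ?\<beta> = ?b ^ ?q * (X k * ?\<beta>)"
      by (simp add: Z_def distrib_left distrib_right mult.assoc \<beta>_sq)
    then have "X k * ?\<beta> * ?b ^ ?q = 0" using bZ comm by (simp add: X_def)
    then have X0: "X k = 0" using strip bX by blast
    then have "Y k * ?\<beta> * ?b ^ ?q = 0" using bZ comm by (simp add: Z_def Y_def)
    then show ?case using X0 strip bX by blast
  qed
  \<comment> \<open>The induction hypothesis concerns indices below \<open>n\<close>; the exponent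
    at \<open>n\<close> is restored by the slices.\<close>
  define a' where "a' = a(n := 0)"
  have a': "a = a'(n := a n)" "a n < CHAR('k)" using Suc.prems(2) by (auto simp: a'_def index_below_def)
  have i: "index_below TYPE('k) n a' (U - {n})" using Suc.prems(2) p0 by (auto simp: index_below_def a'_def less_Suc_eq)
  have "\<Psi> n (slice0 n (a n) v) = 0" "\<Psi> n (slice1 n (a n) v) = 0"
    using Z0[OF a'(2)] by (auto simp: X_def Y_def)
  then have "slice0 n (a n) v a' (U - {n}) = 0" "slice1 n (a n) v a' (U - {n}) = 0"
    using Suc.IH i by blast+
  then have "v a (U - {n}) = 0" "v a (insert n (U - {n})) = 0"
    unfolding slice0_def slice1_def a'(1)[symmetric] .
  then show ?case by (cases "n \<in> U") (simp_all add: insert_absorb)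
qed

subsection \<open>Closedness and the separating T-spaces\<close>

text \<open>These elements form a subalgebra since \<open>(x + dx)(y + dy) = z + dz\<close> for \<open>z = xy + dx dy\<close>.\<close>

definition closed_shift :: "'k::field endo \<Rightarrow> bool" where
  "closed_shift z \<longleftrightarrow> (\<exists>x. homog False x \<and> z = x + dd x)"

lemma closed_shift_add: "closed_shift z \<Longrightarrow> closed_shift w \<Longrightarrow> closed_shift (z + w)"
proof -
  assume "closed_shift z" "closed_shift w"
  then obtain x y where xy: "homog False x" "z = x + dd x" "homog False y" "w = y + dd y" unfolding closed_shift_def by blast
  show ?thesis
    unfolding closed_shift_def by (rule exI[of _ "x + y"]) (simp add: xy homog_add dd_add add_ac)
qed

lemma closed_shift_scal: "closed_shift (scal c)"
  unfolding closed_shift_def by (rule exI[of _ "scal c"]) (simp add: homog_scal)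

lemma closed_shift_mult:
  fixes z w :: "'k::field endo"
  assumes two: "(2::'k) \<noteq> 0" and "closed_shift z" "closed_shift w"
  shows "closed_shift (z * w)"
proof -
  obtain x y where xy: "homog False x" "z = x + dd x" "homog False y" "w = y + dd y"
    using assms(2,3) unfolding closed_shift_def by blast
  have "homog False (x * y)" "homog False (dd x * dd y)"
    using homog_mult[OF xy(1,3)] homog_mult[OF homog_dd[OF xy(1)] homog_dd[OF xy(3)]] by simp_all
  then have "homog False (x * y + dd x * dd y)" by (rule homog_add)
  moreover have "z * w = (x * y + dd x * dd y) + dd (x * y + dd x * dd y)"
    by (simp add: xy dd_add dd_mult dd_dd[OF two] homog_bar[OF xy(1)] distrib_left distrib_right add_ac)
  ultimately show ?thesis unfolding closed_shift_def by blast
qed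

lemma closed_shift_fa_eval:
  fixes y :: "nat \<Rightarrow> 'k::field endo"
  assumes two: "(2::'k) \<noteq> 0" and y: "\<And>i. closed_shift (y i)" and f: "f \<in> FA"
  shows "closed_shift (fa_eval y f)"
  using f
proof (induction rule: FA_induct)
  case zero
  then show ?case using closed_shift_scal[of "0::'k"] by (simp add: fa_eval_0)
next
  case (add g c w)
  have "closed_shift (prod_list (map y w))"
  proof (rule prod_list_induct[where P = closed_shift])
    show "closed_shift (1 :: 'k endo)" using closed_shift_scal[of "1::'k"] by simp
    show "closed_shift (u * v)" if "u \<in> set (map y w)" "closed_shift v" for u v
      using that y by (intro closed_shift_mult[OF two]) auto
  qed
  then show ?case
    using add by (simp add: fa_eval_add fa_eval_scale FA_scale FA_w fa_eval_w closed_shift_add closed_shift_mult[OF two closed_shift_scal])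
qed

definition in_gr :: "'k::field endo \<Rightarrow> bool" where
  "in_gr z \<longleftrightarrow> (\<exists>g\<in>GR. iota g = z)"

lemma in_gr_add: "in_gr z \<Longrightarrow> in_gr w \<Longrightarrow> in_gr (z + w)"
  unfolding in_gr_def by (metis gr_add_GR iota_add)

lemma in_gr_mult: "in_gr z \<Longrightarrow> in_gr w \<Longrightarrow> in_gr (z * w)"
  unfolding in_gr_def by (metis gr_mult_GR iota_mult)

lemma in_gr_scal: "in_gr (scal c)"
  unfolding in_gr_def by (rule bexI[of _ "\<lambda>U. c * gr_one U"])
    (simp_all add: iota_scale iota_one gr_scale_GR gr_one_GR)

lemma in_gr_theta: "0 < i \<Longrightarrow> in_gr (theta i)"
  unfolding in_gr_def iota_single[symmetric] by (rule bexI[of _ "gr_e {i}"]) (simp_all add: gr_e_GR)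

lemma in_gr_sum: "(\<And>i. i \<in> A \<Longrightarrow> in_gr (f i)) \<Longrightarrow> in_gr (sum f A)"
  using in_gr_scal[of 0] by (induction A rule: infinite_finite_induct) (auto intro: in_gr_add)

lemma in_gr_generic: "in_gr (scal c + generic_even i + generic_odd i)"
  unfolding generic_even_def generic_odd_def pairs_def
  by (intro in_gr_add in_gr_scal in_gr_sum in_gr_mult in_gr_theta) (simp_all add: block_start_def)

lemma top_coeff_central_valued:
  fixes f :: "nat list \<Rightarrow> 'k::field"
  assumes p: "prime CHAR('k)" "CHAR('k) > 2" and two: "(2::'k) \<noteq> 0"
    and f: "f \<in> central_valued" and vars: "\<And>w i. f w \<noteq> 0 \<Longrightarrow> i \<in> set w \<Longrightarrow> i < N" and "N < m"
    and a: "\<And>i. homog False (a i)"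
  shows "top_coeff m (fa_eval (\<lambda>i. a i + dd (a i)) f) = 0"
proof -
  have p0: "CHAR('k) > 0" using p by simp
  have fFA: "f \<in> FA" using f by (simp add: central_valued_def)
  \<comment> \<open>Only the nilpotent part of \<open>a i\<close> can replace \<open>t_i\<close>;
    the constant part is moved into the generic point.\<close>
  have "\<forall>i. \<exists>c b. nilcartier b \<and> a i = scal c + b"
    using even_decomp[OF p two a] by simp
  then obtain \<alpha> b where b: "\<And>i. nilcartier (b i)" "\<And>i. a i = scal (\<alpha> i) + b i" by metis
  interpret forms_subst_d b "\<lambda>i. dd (b i)"
  proof
    show "homog True (dd (b i))" for i using b(1)[of i] homog_dd[of False "b i"] by (simp add: nilcartier_def)
  qed (use p two b(1) in \<open>auto simp: nilcartier_def\<close>)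
  interpret G: forms_subst "generic_even :: nat \<Rightarrow> 'k endo" generic_odd by (rule forms_subst_g[OF p two])
  define z where "z = fa_eval (generic_point \<alpha>) f"
  define v where "v = app z vacuum"
  have supp: "supported N v" unfolding v_def z_def by (rule supported_fa_eval[OF fFA vars])
  have twist: "twist v a U = v a U" if i: "index_below TYPE('k) N a U" for a U
  proof -
    \<comment> \<open>Centrality enters here, at a single homomorphism with generic values. The
      value of \<open>f\<close> is even there, and the injectivity of the substitution lifts this to
      the coefficients of \<open>v\<close>.\<close>
    have "\<forall>i. \<exists>g. g \<in> GR \<and> iota g = scal (\<alpha> i) + generic_even i + (generic_odd i :: 'k endo)"
      using in_gr_generic[of "\<alpha> _"] unfolding in_gr_def by blast
    then obtain g where g: "\<And>i. g i \<in> GR" "\<And>i. iota (g i) = scal (\<alpha> i) + generic_even i + (generic_odd i :: 'k endo)"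
      by metis
    obtain \<phi> where \<phi>: "fa_to_G \<phi>" "iota (\<phi> f) = fa_eval (\<lambda>i. iota (g i)) f"
      using hom_exists[of g, OF g(1)] fFA by blast
    have "homog False (iota (\<phi> f))"
      using f \<phi>(1) by (intro centre_even two) (simp add: central_valued_def)
    then have "homog False (G.\<Psi> N v)"
      using G.fsubst_fa_eval[OF fFA vars, where \<alpha> = \<alpha>] unfolding \<phi>(2) g(2) v_def z_def by simp
    then have "G.\<Psi> N (twist v) = G.\<Psi> N v"
      using homog_bar[of False "G.\<Psi> N v"] by (simp add: G.bar_fsubst)
    then have "G.\<Psi> N (\<lambda>a U. twist v a U + (-1) * v a U) = 0"
      unfolding fsubst_add fsubst_scale by (simp add: scal_uminus)
    from fsubst_g_inj[OF p two this i] show ?thesis by simp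
  qed
  have sigv: "app parity v = v"
  proof (intro ext)
    fix a U
    show "app parity v a U = v a U"
    proof (cases "v a U = 0 \<or> \<not> (admissible TYPE('k) a \<and> finite U)")
      case True
      then show ?thesis
      proof
        assume "v a U = 0"
        then show ?thesis using app_parity[of a U v] app_not_admissible[of a U parity v] by fastforce
      next
        assume "\<not> (admissible TYPE('k) a \<and> finite U)"
        then show ?thesis unfolding v_def by (simp add: app_not_admissible)
      qed
    next
      case False
      then have "\<forall>i. a i < CHAR('k)" "v a U \<noteq> 0" using p0 by (auto simp: admissible_def)
      then have "index_below TYPE('k) N a U"
        using supp unfolding supported_def index_below_def by metis
      then show ?thesis using twist[of a U] False by (simp only: app_parity twist_def de_Morgan_disj not_not)
    qed
  qed
  have "closed_shift (generic_point \<alpha> i)" for i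
    unfolding closed_shift_def by (rule exI[of _ "scal (\<alpha> i) + tvar i"]) (simp add: generic_point_def homog_add homog_scal homog_tvar dd_add)
  then obtain x where x: "homog False x" "z = x + dd x"
    using closed_shift_fa_eval[OF two _ fFA, of "generic_point \<alpha>"] unfolding z_def closed_shift_def by blast
  \<comment> \<open>Since \<open>v\<close> is even, \<open>z = x + dd x\<close> and
    \<open>bar z = x - dd x\<close> act equally on the form \<open>1\<close>. Their difference shows
    that \<open>dd x\<close> vanishes there, so \<open>v\<close> is the form \<open>x\<close> and
    closed.\<close>
  have "parity * z = bar z * parity" by (simp add: bar_def mult.assoc parity_parity)
  then have barv: "app (bar z) vacuum = v"
    using sigv by (metis app_times app_parity_vacuum v_def)
  have barz: "bar z = x - dd x"
    using homog_bar[OF x(1)] homog_bar[OF homog_dd[OF x(1)]] by (simp add: x(2) bar_add)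
  have "2 * app (dd x) vacuum a U = 0" for a U
  proof -
    have "2 * app (dd x) vacuum a U = app z vacuum a U - app (bar z) vacuum a U"
      unfolding barz by (simp add: x(2) app_plus app_minus)
    then show ?thesis by (simp add: barv v_def)
  qed
  then have dx: "app (dd x) vacuum = (\<lambda>_ _. 0)" using two by (auto simp: fun_eq_iff)
  then have vx: "v = app x vacuum" by (simp add: v_def x(2) app_plus)
  have "app D v = (\<lambda>_ _. 0)"
    using dx by (simp add: dd_def app_minus app_times app_D_vacuum app_zero vx)
  moreover have "truncate v = v" by (simp add: v_def)
  ultimately have "dform v a U = 0" if "index_below TYPE('k) N a U" for a U
    using app_D[of a U v] index_below_admissible[OF that] index_below_finite[OF that] by simp
  then have "cartier_exact N (\<Psi> N v)" by (rule poincare)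
  moreover have "\<Psi> N v = fa_eval (\<lambda>i. a i + dd (a i)) f"
    using fsubst_fa_eval[OF fFA vars, where \<alpha> = \<alpha>] by (simp add: v_def z_def b(2) dd_add)
  ultimately show ?thesis using top_coeff_cartier_exact[OF _ \<open>N < m\<close> p0] by metis
qed

definition separating :: "nat \<Rightarrow> (nat list \<Rightarrow> 'k::field) set" where
  "separating m = {f \<in> FA. \<forall>a. (\<forall>i. homog False (a i)) \<longrightarrow> top_coeff m (fa_eval (\<lambda>i. a i + dd (a i)) f) = 0}"

lemma Tspace_separating:
  assumes two: "(2::'k::field) \<noteq> 0"
  shows "Tspace (separating m :: (nat list \<Rightarrow> 'k) set)"
  unfolding Tspace_def
proof (intro conjI ballI allI impI)
  show "separating m \<subseteq> (FA :: (nat list \<Rightarrow> 'k) set)" by (auto simp: separating_def)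
  show "(\<lambda>_. 0 :: 'k) \<in> separating m" by (simp add: separating_def FA_0 fa_eval_0 top_coeff_def app_0)
next
  fix f g :: "nat list \<Rightarrow> 'k" assume "f \<in> separating m" "g \<in> separating m"
  then show "(\<lambda>w. f w + g w) \<in> separating m" by (simp add: separating_def FA_add fa_eval_add top_coeff_add)
next
  fix c and f :: "nat list \<Rightarrow> 'k" assume "f \<in> separating m"
  then show "(\<lambda>w. c * f w) \<in> separating m" by (simp add: separating_def FA_scale fa_eval_scale top_coeff_scal)
next
  fix \<psi> :: "(nat list \<Rightarrow> 'k) \<Rightarrow> nat list \<Rightarrow> 'k" and f :: "nat list \<Rightarrow> 'k"
  assume \<psi>: "fa_endo \<psi>" and f: "f \<in> separating m"
  have fFA: "f \<in> FA" using f by (simp add: separating_def)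
  have "top_coeff m (fa_eval (\<lambda>i. a i + dd (a i)) (\<psi> f)) = 0" if a: "\<And>i. homog False (a i)" for a :: "nat \<Rightarrow> 'k endo"
  proof -
    let ?y = "\<lambda>i. a i + dd (a i)"
    have "closed_shift (?y i)" for i unfolding closed_shift_def using a by blast
    then have "closed_shift (fa_eval ?y (\<psi> (fa_w [i])))" for i
      using fa_endoD(1)[OF \<psi> FA_w] by (intro closed_shift_fa_eval two)
    then have "\<forall>i. \<exists>x. homog False x \<and> fa_eval ?y (\<psi> (fa_w [i])) = x + dd x" unfolding closed_shift_def by blast
    then obtain a' where "\<And>i. homog False (a' i)" "\<And>i. fa_eval ?y (\<psi> (fa_w [i])) = a' i + dd (a' i)" by metis
    then show ?thesis using f unfolding fa_eval_endo[OF \<psi> fFA] by (simp add: separating_def)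
  qed
  then show "\<psi> f \<in> separating m" using fa_endoD(1)[OF \<psi> fFA] by (simp add: separating_def)
qed

subsection \<open>Central polynomials outside the separating T-spaces\<close>

text \<open>This is \<open>[x\<^sub>i, x\<^sub>j] x\<^sub>i ^ (p - 1) x\<^sub>j ^ (p - 1)\<close> for \<open>i = 2 n\<close> and \<open>j = 2 n + 1\<close>.\<close>

definition central_factor :: "nat \<Rightarrow> nat list \<Rightarrow> 'k::field" where
  "central_factor n = (let i = 2 * n; j = Suc (2 * n); r = replicate (CHAR('k) - Suc 0) i @ replicate (CHAR('k) - Suc 0) j
     in (\<lambda>w. fa_w (i # j # r) w + (-1) * fa_w (j # i # r) w))"

primrec central_prod :: "nat \<Rightarrow> nat list \<Rightarrow> 'k::field" where
  "central_prod 0 = fa_one"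
| "central_prod (Suc n) = fa_mult (central_factor n) (central_prod n)"

lemma central_factor_FA: "central_factor n \<in> FA"
  unfolding central_factor_def Let_def by (intro FA_add FA_scale FA_w)

lemma central_prod_FA: "central_prod n \<in> FA"
  by (induction n) (simp_all add: FA_one fa_mult_FA central_factor_FA)

lemma fa_eval_central_factor:
  "fa_eval y (central_factor n :: nat list \<Rightarrow> 'k::field) = (y (2 * n) * y (Suc (2 * n)) - y (Suc (2 * n)) * y (2 * n)) *
    (y (2 * n) ^ (CHAR('k) - Suc 0) * y (Suc (2 * n)) ^ (CHAR('k) - Suc 0))"
proof -
  have r: "prod_list (replicate k z) = z ^ k" for k and z :: "'k endo" by (induction k) auto
  show ?thesis
    unfolding central_factor_def Let_def fa_eval_add[OF FA_w FA_scale[OF FA_w]] fa_eval_scale[OF FA_w] fa_eval_w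
    by (simp add: r scal_uminus left_diff_distrib mult.assoc)
qed

text \<open>The commutator is \<open>2 * \<beta> * \<gamma>\<close>, and it annihilates
  \<open>\<beta>\<close> and \<open>\<gamma>\<close>; hence the odd parts disappear from the powers.
  The result is even, which gives centrality, and at \<open>t_i + dt_i\<close> it is a top monomial
  in two variables.\<close>

lemma commutator_power:
  fixes b c :: "'k::field endo"
  assumes two: "(2::'k) \<noteq> 0" and b: "homog False b" "homog False c" and \<beta>: "homog True \<beta>" "homog True \<gamma>"
  shows "((b + \<beta>) * (c + \<gamma>) - (c + \<gamma>) * (b + \<beta>)) * ((b + \<beta>) ^ q * (c + \<gamma>) ^ q) =
    scal 2 * (\<beta> * \<gamma> * (b ^ q * c ^ q))"
proof -
  have comm: "b * c = c * b" "b * \<gamma> = \<gamma> * b" "\<beta> * c = c * \<beta>" "\<gamma> * \<beta> = - (\<beta> * \<gamma>)"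
    using homog_comm[OF b] homog_comm[OF b(1) \<beta>(2)] homog_comm[OF b(2) \<beta>(1)] homog_comm[OF \<beta>(2,1)] by simp_all
  have sc2: "scal 2 = (2 :: 'k endo)" using scal_of_nat[of 2, where 'a='k] by simp
  have 1: "(b + \<beta>) * (c + \<gamma>) - (c + \<gamma>) * (b + \<beta>) = scal 2 * (\<beta> * \<gamma>)"
    by (simp add: distrib_left distrib_right comm sc2 mult_2)
  have o: "homog False (\<beta> * \<gamma>)" using homog_mult[OF \<beta>] by simp
  have pw: "\<beta> * \<gamma> * (x + \<xi>) ^ q = \<beta> * \<gamma> * x ^ q" if x: "homog False x" and \<xi>: "\<beta> * \<gamma> * \<xi> = 0" for x \<xi>
  proof (induction q)
    case (Suc q)
    have "\<beta> * \<gamma> * (x + \<xi>) ^ Suc q = (\<beta> * \<gamma> * x + \<beta> * \<gamma> * \<xi>) * (x + \<xi>) ^ q"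
      by (simp only: power_Suc mult.assoc[symmetric] distrib_left)
    also have "\<dots> = x * (\<beta> * \<gamma>) * (x + \<xi>) ^ q"
      by (simp only: \<xi> add_0_right homog_even_comm[OF x o])
    also have "\<dots> = x * (\<beta> * \<gamma> * (x + \<xi>) ^ q)"
      by (simp only: mult.assoc)
    also have "\<dots> = \<beta> * \<gamma> * x ^ Suc q"
    proof -
      have "x * (\<beta> * \<gamma> * x ^ q) = x * (\<beta> * \<gamma>) * x ^ q" by (simp only: mult.assoc)
      also have "\<dots> = \<beta> * \<gamma> * x * x ^ q" by (simp only: homog_even_comm[OF x o])
      finally show ?thesis unfolding Suc power_Suc by (simp only: mult.assoc)
    qed
    finally show ?case .
  qed simp
  have "\<beta> * \<gamma> * \<beta> = \<beta> * (\<gamma> * \<beta>)" by (simp only: mult.assoc)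
  also have "\<dots> = - (\<beta> * \<beta> * \<gamma>)" by (simp only: comm mult_minus_right mult.assoc)
  finally have z1: "\<beta> * \<gamma> * \<beta> = 0" by (simp add: homog_odd_sq[OF \<beta>(1) two])
  have z2: "\<beta> * \<gamma> * \<gamma> = 0" by (simp add: mult.assoc homog_odd_sq[OF \<beta>(2) two])
  have bq: "\<beta> * \<gamma> * b ^ q = b ^ q * (\<beta> * \<gamma>)" using homog_even_comm[OF homog_power[OF b(1)] o] by simp
  have "\<beta> * \<gamma> * ((b + \<beta>) ^ q * (c + \<gamma>) ^ q) = (\<beta> * \<gamma> * (b + \<beta>) ^ q) * (c + \<gamma>) ^ q"
    by (simp only: mult.assoc)
  also have "\<dots> = b ^ q * (\<beta> * \<gamma> * (c + \<gamma>) ^ q)"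
    unfolding pw[OF b(1) z1] bq by (simp only: mult.assoc)
  also have "\<dots> = \<beta> * \<gamma> * (b ^ q * c ^ q)"
    unfolding pw[OF b(2) z2] by (simp only: bq mult.assoc[symmetric])
  finally show ?thesis unfolding 1 by (simp only: mult.assoc)
qed

lemma central_prod_central_valued:
  assumes two: "(2::'k::field) \<noteq> 0"
  shows "central_prod n \<in> (central_valued :: (nat list \<Rightarrow> 'k) set)"
proof -
  have "\<phi> (central_prod n) \<in> gr_centre" if \<phi>: "fa_to_G \<phi>" for \<phi> :: "(nat list \<Rightarrow> 'k) \<Rightarrow> nat set \<Rightarrow> 'k"
  proof (rule even_centre[OF fa_to_GD(1)[OF \<phi> central_prod_FA]])
    define y where "y i = iota (\<phi> (fa_w [i]))" for i
    have "is_form (y i)" for i unfolding y_def by (rule is_form_iota[OF fa_to_GD(1)[OF \<phi> FA_w]])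
    then have "\<forall>i. \<exists>b c. homog False b \<and> homog True c \<and> y i = b + c" unfolding is_form_def by blast
    then obtain b c where bc: "\<And>i. homog False (b i)" "\<And>i. homog True (c i)" "\<And>i. y i = b i + c i" by metis
    have fac: "homog False (fa_eval y (central_factor n))" for n
      unfolding fa_eval_central_factor bc(3) commutator_power[OF two bc(1) bc(1) bc(2) bc(2)]
      by (intro homog_scale homog_mult'[OF homog_mult'[OF bc(2) bc(2)]] homog_mult'[OF homog_power[OF bc(1)] homog_power[OF bc(1)]]) auto
    have "homog False (fa_eval y (central_prod n))"
    proof (induction n)
      case (Suc n)
      show ?case using homog_mult[OF fac Suc] by (simp add: fa_eval_mult[OF central_factor_FA central_prod_FA])
    qed (simp add: fa_eval_one homog_one)
    then show "homog False (iota (\<phi> (central_prod n)))"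
      unfolding iota_hom[OF \<phi> central_prod_FA] y_def .
  qed
  then show ?thesis by (simp add: central_valued_def central_prod_FA)
qed

text \<open>At the points \<open>t_i + dt_i\<close> each factor contributes \<open>2\<close> times
  the top monomial in its own two variables. So the top coefficient is, up to sign, a power of
  \<open>2\<close>.\<close>

lemma central_prod_not_separating:
  assumes p: "CHAR('k) > 0" and two: "(2::'k::field) \<noteq> 0"
  shows "central_prod n \<notin> (separating (2 * n) :: (nat list \<Rightarrow> 'k) set)"
proof -
  let ?q = "CHAR('k) - Suc 0"
  let ?y = "\<lambda>i. tvar i + dd (tvar i) :: 'k endo"
  have "top_coeff (2 * n) (fa_eval ?y (central_prod n)) \<noteq> 0"
  proof (induction n)
    case 0
    have "top_exp ?q 0 = (\<lambda>_. 0)" by (simp add: top_exp_def)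
    moreover have "vacuum (\<lambda>_. 0) {} \<noteq> (0::'k)" by (simp add: vacuum_def)
    ultimately show ?case by (simp add: fa_eval_one top_coeff_def app_one)
  next
    case (Suc n)
    define i where "i = 2 * n"
    define v where "v = app (fa_eval ?y (central_prod n)) (vacuum :: 'k form)"
    let ?U = "{..<Suc (Suc i)}"
    have okx: "admissible TYPE('k) (top_exp ?q m)" for m using p by (auto simp: admissible_def top_exp_def)
    have t1: "(top_exp ?q (Suc (Suc i)))(i := 0, Suc i := 0) = top_exp ?q i"
      by (auto simp: top_exp_def)
    have ok1: "admissible TYPE('k) ((top_exp ?q (Suc (Suc i)))(i := 0))"
      using p by (auto simp: admissible_def top_exp_def)
    have U: "?U - {i} - {Suc i} = {..<i}" by auto
    have cv: "truncate v = v" by (simp add: v_def)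
    have "fa_eval ?y (central_prod (Suc n)) = scal 2 * (theta i * theta (Suc i) * (tvar i ^ ?q * tvar (Suc i) ^ ?q)) * fa_eval ?y (central_prod n)"
      unfolding central_prod.simps fa_eval_mult[OF central_factor_FA central_prod_FA] fa_eval_central_factor dd_tvar
        commutator_power[OF two homog_tvar homog_tvar homog_theta homog_theta] i_def ..
    then have "top_coeff (2 * Suc n) (fa_eval ?y (central_prod (Suc n))) =
        app (scal 2) (app (theta i) (app (theta (Suc i)) (app (tvar i ^ ?q) (app (tvar (Suc i) ^ ?q) v))))
          (top_exp ?q (Suc (Suc i))) ?U"
      by (simp only: top_coeff_def app_times v_def i_def mult_Suc_right add_2_eq_Suc)
    also have "\<dots> = 2 * (gsign i ?U * (gsign (Suc i) (?U - {i}) *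
        app (tvar i ^ ?q) (app (tvar (Suc i) ^ ?q) v) (top_exp ?q (Suc (Suc i))) (?U - {i} - {Suc i})))"
      using okx[of "Suc (Suc i)"] by (simp add: app_scal app_theta truncate_admissible del: lessThan_Suc)
    also have "app (tvar i ^ ?q) (app (tvar (Suc i) ^ ?q) v) (top_exp ?q (Suc (Suc i))) (?U - {i} - {Suc i}) =
        v (top_exp ?q i) {..<i}"
    proof -
      have "top_exp ?q (Suc (Suc i)) i = ?q" "top_exp ?q (Suc (Suc i)) (Suc i) = ?q" by (auto simp: top_exp_def)
      then show ?thesis using okx ok1 cv t1 by (simp add: U app_tvar_power)
    qed
    finally have "top_coeff (2 * Suc n) (fa_eval ?y (central_prod (Suc n))) =
        2 * (gsign i ?U * (gsign (Suc i) (?U - {i}) * v (top_exp ?q i) {..<i}))" .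
    moreover have "v (top_exp ?q i) {..<i} \<noteq> 0" using Suc by (simp add: top_coeff_def v_def i_def)
    ultimately show ?case using two by (simp add: gsign_def)
  qed
  then show ?thesis unfolding separating_def using homog_tvar by blast
qed

theorem theorem3p1:
  fixes p :: nat
  assumes "prime p" and "p > 2" and "CHAR('k::field) = p"
  shows "\<not> finitely_based (CPG :: (nat list \<Rightarrow> 'k) set)"
proof
  have p: "prime CHAR('k)" "CHAR('k) > 2" using assms by simp_all
  have two: "(2::'k) \<noteq> 0"
  proof
    assume "(2::'k) = 0"
    then have "(of_nat 2 :: 'k) = 0" by simp
    then have "CHAR('k) dvd 2" by (simp only: of_nat_eq_0_iff_char_dvd)
    then show False using p(2) by (auto dest: dvd_imp_le)
  qed
  assume "finitely_based (CPG :: (nat list \<Rightarrow> 'k) set)"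
  then obtain H :: "(nat list \<Rightarrow> 'k) set" where H: "finite H" "H \<subseteq> FA" "central_valued = Tspan H"
    unfolding finitely_based_def CPG_eq_central_valued by blast
  have "finite (\<Union>f\<in>H. \<Union>w\<in>{w. f w \<noteq> 0}. set w)"
    using H by (auto simp: FA_def)
  then obtain N where N: "\<And>f w i. f \<in> H \<Longrightarrow> f w \<noteq> 0 \<Longrightarrow> i \<in> set w \<Longrightarrow> i < N"
    unfolding finite_nat_set_iff_bounded by blast
  \<comment> \<open>Larger than the number of variables occurring in \<open>H\<close>, and even
    because each factor of \<open>central_prod\<close> uses two variables.\<close>
  let ?m = "2 * Suc N"
  have "H \<subseteq> central_valued" unfolding H(3) Tspan_def by blast
  have "f \<in> separating ?m" if f: "f \<in> H" for f
  proof -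
    have "top_coeff ?m (fa_eval (\<lambda>i. a i + dd (a i)) f) = 0" if a: "\<And>i. homog False (a i)" for a
    proof (rule top_coeff_central_valued[OF p two, of f N])
      show "f \<in> central_valued" using f \<open>H \<subseteq> central_valued\<close> by blast
    qed (use N f a in auto)
    then show ?thesis using f H(2) unfolding separating_def by blast
  qed
  then have "H \<subseteq> separating ?m" by blast
  then have "Tspan H \<subseteq> separating ?m"
    using Tspace_separating[OF two] unfolding Tspan_def by blast
  then show False
    using central_prod_central_valued[OF two, of "Suc N"] central_prod_not_separating[OF _ two, of "Suc N"] p(2) H(3) by auto
qed

end
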